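(* Let $X_1,\dots,X_m$ be independent normally distributed random variables with common mean $\mu$ and variance $1$, let $S_0=0$, $S_j=\sum_{l=1}^{j}X_l$ for $1\le j\le m$, and for $0\le i<j<k\le m$ let $$Z_{i,j,k}=\frac{S_j-S_i-(j-i)\,(S_k-S_i)/(k-i)}{\big[(j-i)\big(1-(j-i)/(k-i)\big)\big]^{1/2}} .$$ Then, as $b\to\infty$ and $m\asymp b^2$, $$\mathbb P\Big\{\max_{0<j<k\le m}|Z_{0,j,k}|\ge b\Big\}\sim \frac12\, b^3\varphi(b)\sum_{1<k\le m}\ \sum_{0<j<k} j^{-2}\;\nu\!\left[b\Big(\frac{k-j}{jk}\Big)^{1/2}\right]\nu\!\left[b\Big(\frac{k}{j(k-j)}\Big)^{1/2}\right].$$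
   Context: $\varphi$ and $\Phi$ are the standard normal probability density function and distribution function. The function $\nu:(0,\infty)\to(0,1)$ is $$\nu(x)=\frac{2}{x^{2}}\exp\Big(-2\sum_{n=1}^{\infty}\frac1n\,\Phi\big(-\tfrac{x\sqrt n}{2}\big)\Big).$$ Asymptotic notation: $m=m(b)$ is a positive integer depending on $b$; $A\asymp B$ means $0<c_1\le A/B\le c_2<\infty$ for two absolute constants $c_1,c_2$ (not depending on $b$); $A(b)\sim B(b)$ means $A(b)/B(b)\to1$ as $b\to\infty$. *)

theory Defs
  imports "HOL-Probability.Probability" "HOL-Library.Landau_Symbols"
begin

abbreviation std_normal_cdf :: "real \<Rightarrow> real" where
  "std_normal_cdf \<equiv> cdf std_normal_distribution"

text \<open>
  Only arguments \<open>x > 0\<close> are meaningful: there the series converges.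
  The index is shifted by one, since \<open>suminf\<close> starts at 0.
\<close>
definition nu :: "real \<Rightarrow> real" where
  "nu x = 2 / x\<^sup>2 *
     exp (- 2 * (\<Sum>n. 1 / real (Suc n) * std_normal_cdf (- (x * sqrt (real (Suc n)) / 2))))"

definition partial_sum :: "(nat \<Rightarrow> 'a \<Rightarrow> real) \<Rightarrow> nat \<Rightarrow> 'a \<Rightarrow> real" where
  "partial_sum X j \<omega> = (\<Sum>l = 1..j. X l \<omega>)"

text \<open>Meant for \<open>i < j < k\<close>; the differences of indices are taken in the reals.\<close>
definition Z_stat :: "(nat \<Rightarrow> 'a \<Rightarrow> real) \<Rightarrow> nat \<Rightarrow> nat \<Rightarrow> nat \<Rightarrow> 'a \<Rightarrow> real" where
  "Z_stat X i j k \<omega> =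
     (partial_sum X j \<omega> - partial_sum X i \<omega>
        - (real j - real i) * (partial_sum X k \<omega> - partial_sum X i \<omega>) / (real k - real i))
     / sqrt ((real j - real i) * (1 - (real j - real i) / (real k - real i)))"

end

theory Submission
  imports Defs
begin

text \<open>
  Subtracting the common mean changes nothing, so let \<open>\<xi>\<^sub>1, \<dots>, \<xi>\<^sub>m\<close> be independent standard
  normal variables. Each \<open>Z\<^sub>0\<^sub>,\<^sub>j\<^sub>,\<^sub>k\<close> is then the scalar product of \<open>\<xi>\<close> with a unit vector, the
  contrast of \<open>(j, k)\<close>. Since \<open>m\<close> is of order \<open>b\<^sup>2\<close>, there are of the order of \<open>b\<^sup>4\<close> pairs, and
  the union bound for the exceedance probability, of the order \<open>b\<^sup>4\<close> times the tail
  \<open>P(N \<ge> b) \<sim> \<phi>(b) / b\<close>, is sharp up to a constant factor. Hence pairs for which one of \<open>j\<close>,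
  \<open>k - j\<close>, \<open>m - k\<close> is below \<open>\<epsilon> b\<^sup>2\<close> contribute a proportion of order \<open>\<epsilon>\<close>, and it suffices to
  find, for every other pair and for both signs, the probability that the maximum of the
  absolute values exceeds \<open>b\<close> and is attained at this pair with this sign.

  Let \<open>Z\<close> be the statistic at such a pair and \<open>Z'\<close> a neighbour with correlation \<open>\<rho>\<close>. The
  residual \<open>R = Z' - \<rho> Z\<close> is independent of \<open>Z\<close> (\<open>lin_indep_orthogonal\<close>), and \<open>Z' \<le> Z\<close> means
  \<open>R \<le> (1 - \<rho>) Z\<close>. Given \<open>Z \<ge> b\<close>, the overshoot \<open>Z - b\<close> is at most \<open>1\<close> up to a negligible
  probability, and \<open>(1 - \<rho>) Z\<close> is monotone in \<open>Z\<close>, so the conditional probability of a local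
  maximum is squeezed between two probabilities that do not involve \<open>Z\<close> at all. In them, \<open>b R\<close>
  is, up to an error of norm \<open>O(1 / b)\<close>, a sum of two two-sided walks with independent Gaussian
  steps, one for the displacement of \<open>j\<close> and one for that of \<open>k\<close>, with variances \<open>\<beta>\<^sub>1\<^sup>2\<close> and
  \<open>\<beta>\<^sub>2\<^sup>2\<close> per step, and \<open>b\<^sup>2 (1 - \<rho>)\<close> is half of the variance of that sum. So, in the limit, the
  pair is a local maximum iff four independent Gaussian walks with steps of mean \<open>- \<beta>\<^sup>2 / 2\<close> and
  variance \<open>\<beta>\<^sup>2\<close> stay negative (\<open>prob_local_event\<close>); a sum of two negative numbers being
  negative, the neighbours in the coordinate directions decide. Let \<open>p(\<beta>)\<close> be the probability
  that such a walk stays negative forever. Spitzer's formula (\<open>prob_always_negative\<close>) says \<open>p(\<beta>)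
  = exp (- (\<Sum>n. \<Phi>(- \<beta> \<surd>n / 2) / n))\<close>, that is, \<open>\<nu>(\<beta>) = 2 p(\<beta>)\<^sup>2 / \<beta>\<^sup>2\<close>.

  A local maximum above \<open>b\<close> is the global one with high probability: a pair at distance \<open>d\<close> also
  exceeds \<open>b\<close> with probability at most \<open>\<phi>(b) / b\<close> times \<open>exp (- c d)\<close> (\<open>prob_far_pair_le\<close>), and
  an exceedance of the opposite sign at any inner pair is even less likely
  (\<open>prob_opposite_pair_le\<close>). Distinct pairs and signs give disjoint events, so the exceedance
  probability is asymptotically equivalent to \<open>2 \<phi>(b) / b\<close> times the sum of \<open>p(\<beta>\<^sub>1)\<^sup>2 p(\<beta>\<^sub>2)\<^sup>2\<close>
  over all pairs. Here \<open>\<beta>\<^sub>1\<^sup>2 = b\<^sup>2 k / (j (k - j))\<close> and \<open>\<beta>\<^sub>2\<^sup>2 = b\<^sup>2 j / (k (k - j))\<close>;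
  exchanging \<open>j\<close> and \<open>k - j\<close> and writing \<open>p\<close> in terms of \<open>\<nu>\<close> gives the stated double sum
  (\<open>double_sum_eq_pair_sum\<close>).
\<close>

section \<open>Ladder indices and cyclic rotation\<close>

definition walk :: "(nat \<Rightarrow> real) \<Rightarrow> nat \<Rightarrow> real" where
  "walk x n = (\<Sum>i<n. x i)"

text \<open>
  Ladder indices are weak records: ties count. Hence there is no ladder index iff \<open>walk x n < 0\<close>
  for all \<open>n \<ge> 1\<close>.
\<close>

definition ladder :: "(nat \<Rightarrow> real) \<Rightarrow> nat \<Rightarrow> bool" where
  "ladder x n \<longleftrightarrow> 0 < n \<and> (\<forall>j<n. walk x j \<le> walk x n)"

definition num_ladders :: "(nat \<Rightarrow> real) \<Rightarrow> nat \<Rightarrow> nat" where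
  "num_ladders x n = card {i \<in> {1..n}. ladder x i}"

text \<open>
  Only the first \<open>n\<close> steps are rotated; the others stay in place, so that a rotation is a
  permutation of the coordinates of an infinite sequence.
\<close>

definition rotate_steps :: "nat \<Rightarrow> nat \<Rightarrow> (nat \<Rightarrow> real) \<Rightarrow> nat \<Rightarrow> real" where
  "rotate_steps n q x i = x (if i < n then (q + i) mod n else i)"

text \<open>
  If \<open>n\<close> is the \<open>r\<close>-th ladder index of \<open>x\<close>, the weight is \<open>1 / r\<close>. Such weights are what
  \<open>ln (1 - G)\<close> produces when it is expanded into \<open>G ^ r / r\<close>.
\<close>

definition ladder_weight :: "nat \<Rightarrow> (nat \<Rightarrow> real) \<Rightarrow> real" where
  "ladder_weight n x = (if ladder x n then 1 / real (num_ladders x n) else 0)"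

lemma walk_0 [simp]: "walk x 0 = 0"
  by (simp add: walk_def)

lemma walk_cong: "(\<And>i. i < n \<Longrightarrow> x i = y i) \<Longrightarrow> walk x n = walk y n"
  by (simp add: walk_def)

lemma walk_add: "walk x (n + i) = walk x n + walk (\<lambda>l. x (n + l)) i"
  by (induction i) (auto simp: walk_def)

lemma sum_periodic_window:
  fixes g :: "nat \<Rightarrow> nat"
  assumes "\<And>t. g (t + n) = g t"
  shows "(\<Sum>i=1..n. g (q + i)) = (\<Sum>i<n. g i)"
proof (induction q)
  case 0
  have "(\<Sum>i=1..n. g i) + g 0 = (\<Sum>i<n. g i) + g n"
    by (induction n) auto
  moreover have "g n = g 0" using assms[of 0] by simp
  ultimately show ?case by simp
next
  case (Suc q)
  have "(\<Sum>i=1..n. g (Suc q + i)) + g (q + 1) = (\<Sum>i=1..n. g (q + i)) + g (q + n + 1)"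
    by (induction n) auto
  moreover have "g (q + n + 1) = g (q + 1)" using assms[of "q + 1"] by (simp add: add_ac)
  ultimately show ?case using Suc by simp
qed

text \<open>
  Feller's cyclic lemma. Repeat the steps with period \<open>n\<close> and let \<open>T\<close> be the walk so obtained.
  If the sum over one period is nonnegative, a rotation by \<open>q\<close> has \<open>n\<close> as a ladder index exactly
  when \<open>T\<close> has a two-sided record at \<open>q\<close>, and then its ladder indices are the records of the
  following period. The number \<open>r\<close> of records per period does not depend on where the period
  starts, so \<open>r\<close> rotations have weight \<open>1 / r\<close> each; \<open>r > 0\<close> since the maximum over a period is
  a record. If the sum over a period is negative, no rotation has \<open>n\<close> as a ladder index.
\<close>

lemma sum_ladder_weight_rotate:
  assumes "0 < n"
  shows "(\<Sum>q<n. ladder_weight n (rotate_steps n q x)) = (if 0 \<le> walk x n then 1 else 0)"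
proof -
  define y where "y = (\<lambda>i. x (i mod n))"
  define T where "T = walk y"
  have Tn: "T n = walk x n" unfolding T_def y_def by (rule walk_cong) simp
  have Tadd: "T (i + n) = T i + T n" for i
  proof -
    have "T (n + i) = T n + walk (\<lambda>l. y (n + l)) i" unfolding T_def by (rule walk_add)
    also have "(\<lambda>l. y (n + l)) = y" by (simp add: y_def)
    finally show ?thesis by (simp add: T_def add_ac)
  qed
  have rot: "walk (rotate_steps n q x) i = T (q + i) - T q" if "i \<le> n" for q i
  proof -
    have "walk (rotate_steps n q x) i = walk (\<lambda>l. y (q + l)) i"
      using that by (intro walk_cong) (auto simp: rotate_steps_def y_def)
    then show ?thesis unfolding T_def by (simp add: walk_add)
  qed
  \<comment> \<open>if the sum over a period is nonnegative, looking back over one period suffices for a record at \<open>t + n\<close>\<close>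
  define R where "R = (\<lambda>t. \<forall>d\<in>{1..n}. T (t + n - d) \<le> T (t + n))"
  have R_per: "R (t + n) = R t" for t
  proof -
    have "T (t + n + n - d) = T (t + n - d) + T n" if "d \<in> {1..n}" for d
      using Tadd[of "t + n - d"] that by (simp add: algebra_simps)
    moreover have "T (t + n + n) = T (t + n) + T n" by (rule Tadd)
    ultimately show ?thesis by (auto simp: R_def)
  qed
  have lad_R: "ladder (rotate_steps n q x) n \<longleftrightarrow> R q" for q
  proof -
    have "ladder (rotate_steps n q x) n \<longleftrightarrow> (\<forall>i<n. T (q + i) \<le> T (q + n))"
      using assms by (simp add: ladder_def rot)
    also have "\<dots> \<longleftrightarrow> R q"
    proof
      assume *: "\<forall>i<n. T (q + i) \<le> T (q + n)"
      show "R q" unfolding R_def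
      proof
        fix d assume d: "d \<in> {1..n}"
        then have "q + n - d = q + (n - d)" "n - d < n" by auto
        then show "T (q + n - d) \<le> T (q + n)" using * by simp
      qed
    next
      assume *: "R q"
      show "\<forall>i<n. T (q + i) \<le> T (q + n)"
      proof (intro allI impI)
        fix i assume "i < n"
        then have "n - i \<in> {1..n}" "q + n - (n - i) = q + i" by auto
        then show "T (q + i) \<le> T (q + n)" using * unfolding R_def by metis
      qed
    qed
    finally show ?thesis .
  qed
  show ?thesis
  proof (cases "0 \<le> walk x n")
    case False
    have "\<not> ladder (rotate_steps n q x) n" for q
    proof
      assume "ladder (rotate_steps n q x) n"
      then have "walk (rotate_steps n q x) 0 \<le> walk (rotate_steps n q x) n"
        using assms unfolding ladder_def by blast
      then show False using False rot[of n q] Tadd[of q] Tn by simp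
    qed
    then show ?thesis using False by (simp add: ladder_weight_def)
  next
    case True
    then have s: "0 \<le> T n" by (simp add: Tn)
    define r where "r = (\<Sum>i<n. of_bool (R i) :: nat)"
    have num: "num_ladders (rotate_steps n q x) n = r" if Rq: "R q" for q
    proof -
      have eq: "ladder (rotate_steps n q x) i \<longleftrightarrow> R (q + i)" if i: "i \<in> {1..n}" for i
      proof -
        have "ladder (rotate_steps n q x) i \<longleftrightarrow> (\<forall>j<i. T (q + j) \<le> T (q + i))"
          using i by (auto simp: ladder_def rot)
        also have "\<dots> \<longleftrightarrow> R (q + i)"
        proof
          assume *: "\<forall>j<i. T (q + j) \<le> T (q + i)"
          show "R (q + i)" unfolding R_def
          proof
            fix d assume d: "d \<in> {1..n}"
            show "T (q + i + n - d) \<le> T (q + i + n)"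
            proof (cases "d \<le> i")
              case True
              from d True have "i - d < i" by auto
              then have "T (q + (i - d)) \<le> T (q + i)" using * by blast
              moreover have "q + i + n - d = q + (i - d) + n" using True by simp
              ultimately show ?thesis by (simp add: Tadd)
            next
              case False
              then have "d - i \<in> {1..n}" "q + i + n - d = q + n - (d - i)" using d by auto
              then have "T (q + i + n - d) \<le> T (q + n)" using Rq unfolding R_def by metis
              also have "\<dots> \<le> T (q + i + n)" using * i Tadd[of q] Tadd[of "q + i"] by force
              finally show ?thesis .
            qed
          qed
        next
          assume *: "R (q + i)"
          show "\<forall>j<i. T (q + j) \<le> T (q + i)"
          proof (intro allI impI)
            fix j assume "j < i"
            then have "i - j \<in> {1..n}" "q + i + n - (i - j) = q + j + n" using i by auto
            then have "T (q + j + n) \<le> T (q + i + n)" using * unfolding R_def by metis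
            then show "T (q + j) \<le> T (q + i)" by (simp add: Tadd)
          qed
        qed
        finally show ?thesis .
      qed
      have "num_ladders (rotate_steps n q x) n = card {i \<in> {1..n}. R (q + i)}"
        unfolding num_ladders_def using eq by (intro arg_cong[where f = card]) auto
      also have "\<dots> = (\<Sum>i=1..n. of_bool (R (q + i)))"
        by (simp only: of_bool_def card_eq_sum sum.inter_filter finite_atLeastAtMost)
      also have "\<dots> = r" unfolding r_def by (rule sum_periodic_window) (simp add: R_per)
      finally show ?thesis .
    qed
    obtain t where t: "t \<in> {n..<2*n}" "\<And>i. i \<in> {n..<2*n} \<Longrightarrow> T i \<le> T t"
    proof -
      have "finite (T ` {n..<2*n})" "T ` {n..<2*n} \<noteq> {}" using assms by auto
      from Max_in[OF this] obtain t where "t \<in> {n..<2*n}" "T t = Max (T ` {n..<2*n})" by auto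
      then show ?thesis using that by auto
    qed
    have "R (t - n)" unfolding R_def
    proof
      fix d assume d: "d \<in> {1..n}"
      show "T (t - n + n - d) \<le> T (t - n + n)"
      proof (cases "n \<le> t - d")
        case True
        then have "t - d \<in> {n..<2*n}" using t(1) by auto
        then show ?thesis using t by simp
      next
        case False
        then have "t - d + n \<in> {n..<2*n}" by auto
        then have "T (t - d) + T n \<le> T t" using t(2) Tadd by metis
        then show ?thesis using s t(1) by simp
      qed
    qed
    moreover have "t - n < n" using t(1) assms by auto
    ultimately have "r > 0" unfolding r_def by (intro sum_pos2[of _ "t - n"]) auto
    have "(\<Sum>q<n. ladder_weight n (rotate_steps n q x)) = (\<Sum>q<n. of_bool (R q) * (1 / real r))"
      by (intro sum.cong) (auto simp: ladder_weight_def lad_R num)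
    also have "\<dots> = real r * (1 / real r)"
      unfolding sum_distrib_right[symmetric] r_def by simp
    finally show ?thesis using \<open>r > 0\<close> True by simp
  qed
qed

section \<open>The probability that a random walk stays negative\<close>

lemma suminf_ennreal_swap: "(\<Sum>i. \<Sum>j. f i j :: ennreal) = (\<Sum>j. \<Sum>i. f i j)"
proof -
  have "(\<Sum>i. \<Sum>j. f i j) = (\<Sum>i. \<integral>\<^sup>+j. f i j \<partial>count_space UNIV)"
    by (simp add: nn_integral_count_space_nat)
  also have "\<dots> = (\<integral>\<^sup>+j. (\<Sum>i. f i j) \<partial>count_space UNIV)"
    by (rule nn_integral_suminf[symmetric]) simp
  also have "\<dots> = (\<Sum>j. \<Sum>i. f i j)"
    by (simp add: nn_integral_count_space_nat)
  finally show ?thesis .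
qed

locale random_walk = sequence_space D for D :: "real measure" +
  assumes sets_D [measurable_cong]: "sets D = sets borel"
begin

lemma space_S [simp]: "space S = UNIV"
  using sets_eq_imp_space_eq[OF sets_D] by (simp add: space_PiM)

lemma measurable_walk [measurable]: "(\<lambda>x. walk x n) \<in> borel_measurable S"
  unfolding walk_def by measurable

lemma measurable_ladder [measurable]: "Measurable.pred S (\<lambda>x. ladder x n)"
proof -
  have le: "Measurable.pred S (\<lambda>x. walk x j \<le> walk x n)" for j
    unfolding Measurable.pred_def by (intro borel_measurable_le measurable_walk)
  have all: "Measurable.pred S (\<lambda>x. \<forall>j\<in>{..<n}. walk x j \<le> walk x n)"
    by (intro pred_intros_finite le) auto
  show ?thesis
  proof (cases "0 < n")
    case True
    then have "(\<lambda>x. ladder x n) = (\<lambda>x. \<forall>j\<in>{..<n}. walk x j \<le> walk x n)"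
      by (auto simp: ladder_def fun_eq_iff)
    then show ?thesis using all by (simp only:)
  next
    case False
    then have "(\<lambda>x. ladder x n) = (\<lambda>x. False)"
      by (auto simp: ladder_def fun_eq_iff)
    then show ?thesis by (simp only: measurable_const space_count_space UNIV_I)
  qed
qed

lemma num_ladders_eq: "num_ladders x n = (\<Sum>i=1..n. if ladder x i then 1 else 0)"
  unfolding num_ladders_def
  by (simp only: card_eq_sum sum.inter_filter finite_atLeastAtMost)

lemma measurable_num_ladders [measurable]: "(\<lambda>x. num_ladders x n) \<in> measurable S (count_space UNIV)"
  unfolding num_ladders_eq by measurable

definition ladder_event :: "nat \<Rightarrow> nat \<Rightarrow> (nat \<Rightarrow> real) set" where
  "ladder_event r n = {x. ladder x n \<and> num_ladders x n = r}"

lemma ladder_event_sets [measurable]: "ladder_event r n \<in> sets S"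
proof -
  have "{x \<in> space S. ladder x n \<and> num_ladders x n = r} \<in> sets S" by measurable
  then show ?thesis by (simp add: ladder_event_def)
qed

lemma num_ladders_mono: "n \<le> n' \<Longrightarrow> num_ladders x n \<le> num_ladders x n'"
  unfolding num_ladders_def by (intro card_mono) auto

lemma num_ladders_Suc: "num_ladders x (Suc n) = num_ladders x n + (if ladder x (Suc n) then 1 else 0)"
  by (simp add: num_ladders_eq)

lemma ladder_pos: "ladder x n \<Longrightarrow> n > 0"
  by (simp add: ladder_def)

lemma num_ladders_less:
  assumes "ladder x n'" "n < n'"
  shows "num_ladders x n < num_ladders x n'"
proof -
  obtain k where k: "n' = Suc k" using assms by (cases n') auto
  show ?thesis using num_ladders_mono[of n k x] num_ladders_Suc[of x k] assms k by auto
qed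

lemma disjoint_ladder_event: "disjoint_family (ladder_event r)"
  unfolding disjoint_family_on_def ladder_event_def
  using num_ladders_less by (force simp: nat_neq_iff)

text \<open>
  After a ladder index the walk starts afresh: everything before it lies below its level.
\<close>

lemma ladder_shift:
  assumes "ladder x n" "i > 0"
  shows "ladder x (n + i) \<longleftrightarrow> ladder (\<lambda>l. x (n + l)) i"
proof
  assume l: "ladder x (n + i)"
  have "walk (\<lambda>l. x (n + l)) j \<le> walk (\<lambda>l. x (n + l)) i" if "j < i" for j
  proof -
    have "walk x (n + j) \<le> walk x (n + i)" using l that by (simp add: ladder_def)
    then show ?thesis by (simp add: walk_add)
  qed
  then show "ladder (\<lambda>l. x (n + l)) i" using assms(2) by (simp add: ladder_def)
next
  assume l: "ladder (\<lambda>l. x (n + l)) i"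
  have ge: "walk x (n + j) \<le> walk x (n + i)" if "j < i" for j
    using l that by (auto simp: ladder_def walk_add)
  have "walk x j \<le> walk x (n + i)" if "j < n + i" for j
  proof (cases "j < n")
    case True
    then have "walk x j \<le> walk x n" using assms by (auto simp: ladder_def)
    then show ?thesis using ge[of 0] assms(2) by simp
  next
    case False
    then show ?thesis using ge[of "j - n"] that by simp
  qed
  then show "ladder x (n + i)" using assms(2) by (simp add: ladder_def)
qed

lemma first_ladder:
  assumes "ladder x i"
  shows "\<exists>n. ladder x n \<and> num_ladders x n = 1"
proof -
  define n where "n = (LEAST n. ladder x n)"
  have n: "ladder x n" unfolding n_def using assms by (rule LeastI)
  have "\<not> ladder x k" if "k < n" for k using not_less_Least that unfolding n_def by blast
  then have "{k \<in> {1..n}. ladder x k} = {n}" using n ladder_pos[OF n] by (auto simp: le_less)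
  then show ?thesis using n by (auto simp: num_ladders_def)
qed

text \<open>
  An \<open>(r + 1)\<close>-st ladder index is an \<open>r\<close>-th one, followed by the first ladder index of the walk
  that restarts there.
\<close>

lemma Suc_ladders_iff:
  assumes "r > 0"
  shows "(\<exists>n. ladder x n \<and> num_ladders x n = Suc r) \<longleftrightarrow>
    (\<exists>n. ladder x n \<and> num_ladders x n = r \<and> (\<exists>i. ladder (\<lambda>l. x (n + l)) i))"
proof
  assume "\<exists>n. ladder x n \<and> num_ladders x n = Suc r"
  then obtain n where n: "ladder x n" "num_ladders x n = Suc r" by blast
  define k where "k = (GREATEST k. ladder x k \<and> k < n)"
  have "\<exists>k. ladder x k \<and> k < n"
  proof (rule ccontr)
    assume "\<not> ?thesis"
    then have "{i \<in> {1..n}. ladder x i} = {n}" using n ladder_pos[OF n(1)] by (auto simp: le_less)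
    then show False using n assms by (simp add: num_ladders_def)
  qed
  then have k: "ladder x k \<and> k < n" unfolding k_def by (rule GreatestI_ex_nat[where b = n]) simp
  have kmax: "j \<le> k" if "ladder x j" "j < n" for j
    unfolding k_def using that by (intro Greatest_le_nat[where b = n]) auto
  have "{i \<in> {1..n}. ladder x i} = insert n {i \<in> {1..k}. ladder x i}"
    using n k kmax ladder_pos by (force simp: le_less)
  then have "num_ladders x n = Suc (num_ladders x k)"
    using k by (simp add: num_ladders_def)
  moreover have "ladder (\<lambda>l. x (k + l)) (n - k)"
    using ladder_shift[of x k "n - k"] k n by simp
  ultimately show "\<exists>n. ladder x n \<and> num_ladders x n = r \<and> (\<exists>i. ladder (\<lambda>l. x (n + l)) i)"
    using n k by auto
next
  assume "\<exists>n. ladder x n \<and> num_ladders x n = r \<and> (\<exists>i. ladder (\<lambda>l. x (n + l)) i)"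
  then obtain n where n: "ladder x n" "num_ladders x n = r" and ex: "\<exists>i. ladder (\<lambda>l. x (n + l)) i"
    by blast
  define i where "i = (LEAST i. ladder (\<lambda>l. x (n + l)) i)"
  have i: "ladder (\<lambda>l. x (n + l)) i" unfolding i_def using ex by (rule LeastI_ex)
  have imin: "\<not> ladder (\<lambda>l. x (n + l)) j" if "j < i" for j
    using not_less_Least that unfolding i_def by blast
  have i0: "i > 0" using i by (rule ladder_pos)
  have lad: "ladder x (n + i)" using ladder_shift[OF n(1) i0] i by simp
  have *: "\<not> ladder x (n + j)" if "0 < j" "j < i" for j
    using ladder_shift[OF n(1) that(1)] imin[OF that(2)] by simp
  have no: "\<not> ladder x l" if "n < l" "l < n + i" for l
  proof -
    have "n + (l - n) = l" "0 < l - n" "l - n < i" using that by auto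
    then show ?thesis using * by metis
  qed
  have "{l \<in> {1..n + i}. ladder x l} = insert (n + i) {l \<in> {1..n}. ladder x l}"
  proof (intro set_eqI iffI)
    fix l assume "l \<in> {l \<in> {1..n + i}. ladder x l}"
    then show "l \<in> insert (n + i) {l \<in> {1..n}. ladder x l}"
      using no[of l] by (cases "l \<le> n"; cases "l = n + i") auto
  next
    fix l assume "l \<in> insert (n + i) {l \<in> {1..n}. ladder x l}"
    then show "l \<in> {l \<in> {1..n + i}. ladder x l}" using lad i0 by auto
  qed
  then have "num_ladders x (n + i) = Suc (num_ladders x n)"
    using i0 by (simp add: num_ladders_def)
  then show "\<exists>n. ladder x n \<and> num_ladders x n = Suc r" using lad n by blast
qed

text \<open>
  The first \<open>n\<close> steps are independent of the sequence of later steps, and the latter has the law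
  of the whole sequence.
\<close>

lemma prob_past_future:
  assumes A [measurable]: "A \<in> sets S" and B [measurable]: "B \<in> sets S"
    and past: "\<And>x y. (\<And>i. i < n \<Longrightarrow> x i = y i) \<Longrightarrow> x \<in> A \<longleftrightarrow> y \<in> A"
  shows "emeasure S {x. x \<in> A \<and> (\<lambda>l. x (n + l)) \<in> B} = emeasure S A * emeasure S B"
proof -
  interpret SS: pair_sigma_finite S S ..
  have sh [measurable]: "(\<lambda>x l. x (n + l)) \<in> measurable S S"
    by (rule measurable_PiM_single') (auto simp: space_PiM)
  have set: "{x. x \<in> A \<and> (\<lambda>l. x (n + l)) \<in> B} \<in> sets S"
  proof -
    have "{x \<in> space S. x \<in> A \<and> (\<lambda>l. x (n + l)) \<in> B} \<in> sets S" by measurable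
    then show ?thesis by simp
  qed
  have AB: "(\<lambda>(\<omega>, \<omega>'). comb_seq n \<omega> \<omega>') -` {x. x \<in> A \<and> (\<lambda>l. x (n + l)) \<in> B} \<inter> space (S \<Otimes>\<^sub>M S) = A \<times> B"
  proof -
    have "comb_seq n \<omega> \<omega>' \<in> A \<longleftrightarrow> \<omega> \<in> A" for \<omega> \<omega>'
      by (rule past) (simp add: comb_seq_less)
    moreover have "(\<lambda>l. comb_seq n \<omega> \<omega>' (n + l)) = \<omega>'" for \<omega> \<omega>' :: "nat \<Rightarrow> real"
      by (simp add: add.commute[of n] comb_seq_add)
    ultimately show ?thesis by (auto simp: space_pair_measure)
  qed
  have "emeasure S {x. x \<in> A \<and> (\<lambda>l. x (n + l)) \<in> B} =
    emeasure (distr (S \<Otimes>\<^sub>M S) S (\<lambda>(\<omega>, \<omega>'). comb_seq n \<omega> \<omega>')) {x. x \<in> A \<and> (\<lambda>l. x (n + l)) \<in> B}"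
    by (simp add: PiM_comb_seq)
  also have "\<dots> = emeasure (S \<Otimes>\<^sub>M S)
      ((\<lambda>(\<omega>, \<omega>'). comb_seq n \<omega> \<omega>') -` {x. x \<in> A \<and> (\<lambda>l. x (n + l)) \<in> B} \<inter> space (S \<Otimes>\<^sub>M S))"
    using set by (intro emeasure_distr measurable_comb_seq)
  also have "\<dots> = emeasure (S \<Otimes>\<^sub>M S) (A \<times> B)" by (simp only: AB)
  also have "\<dots> = emeasure S A * emeasure S B"
    by (intro emeasure_pair_measure_Times A B)
  finally show ?thesis .
qed

definition reach :: "nat \<Rightarrow> (nat \<Rightarrow> real) set" where
  "reach r = {x. \<exists>n. ladder x n \<and> num_ladders x n = r}"

lemma reach_eq: "reach r = (\<Union>n. ladder_event r n)"
  by (auto simp: reach_def ladder_event_def)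

lemma reach_sets [measurable]: "reach r \<in> sets S"
  unfolding reach_eq by measurable

lemma emeasure_reach: "emeasure S (reach r) = (\<Sum>n. emeasure S (ladder_event r n))"
  unfolding reach_eq
  by (intro suminf_emeasure[symmetric] disjoint_ladder_event) auto

lemma ladder_cong:
  assumes "\<And>i. i < n \<Longrightarrow> x i = y i" "j \<le> n"
  shows "ladder x j \<longleftrightarrow> ladder y j"
proof -
  have "walk x i = walk y i" if "i \<le> j" for i using assms that by (intro walk_cong) auto
  then show ?thesis by (simp add: ladder_def)
qed

lemma num_ladders_cong: "(\<And>i. i < n \<Longrightarrow> x i = y i) \<Longrightarrow> num_ladders x n = num_ladders y n"
  unfolding num_ladders_def by (intro arg_cong[where f = card]) (auto simp: ladder_cong[of n x y])

text \<open>
  The Markov property at ladder indices: whether another ladder index follows is decided by the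
  steps after the \<open>r\<close>-th one.
\<close>

lemma emeasure_reach_Suc:
  assumes "r > 0"
  shows "emeasure S (reach (Suc r)) = emeasure S (reach r) * emeasure S (reach 1)"
proof -
  define F where "F = (\<lambda>n. {x. x \<in> ladder_event r n \<and> (\<lambda>l. x (n + l)) \<in> reach 1})"
  have ex1: "(\<exists>i. ladder y i) \<longleftrightarrow> y \<in> reach 1" for y
    using first_ladder by (auto simp: reach_def)
  have "reach (Suc r) = (\<Union>n. F n)"
  proof (intro set_eqI)
    fix x
    show "x \<in> reach (Suc r) \<longleftrightarrow> x \<in> (\<Union>n. F n)"
      using Suc_ladders_iff[OF assms, of x]
      by (simp add: reach_def[of "Suc r"] ladder_event_def F_def ex1)
  qed
  moreover have "disjoint_family F"
    using disjoint_ladder_event[of r] unfolding F_def disjoint_family_on_def by blast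
  moreover have "range F \<subseteq> sets S"
  proof -
    have sh [measurable]: "(\<lambda>x l. x (n + l)) \<in> measurable S S" for n
      by (rule measurable_PiM_single') (auto simp: space_PiM)
    have "{x \<in> space S. x \<in> ladder_event r n \<and> (\<lambda>l. x (n + l)) \<in> reach 1} \<in> sets S" for n
      by measurable
    then show ?thesis by (auto simp: F_def)
  qed
  ultimately have "emeasure S (reach (Suc r)) = (\<Sum>n. emeasure S (F n))"
    by (simp add: suminf_emeasure)
  also have "\<dots> = (\<Sum>n. emeasure S (ladder_event r n) * emeasure S (reach 1))"
    unfolding F_def
  proof (intro suminf_cong prob_past_future)
    fix n and x y :: "nat \<Rightarrow> real" assume "\<And>i. i < n \<Longrightarrow> x i = y i"
    then show "x \<in> ladder_event r n \<longleftrightarrow> y \<in> ladder_event r n"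
      using ladder_cong[of n x y n] num_ladders_cong[of n x y] by (simp add: ladder_event_def)
  qed measurable
  also have "\<dots> = emeasure S (reach r) * emeasure S (reach 1)"
    by (simp add: emeasure_reach ennreal_suminf_multc)
  finally show ?thesis .
qed

lemma emeasure_reach_power: "emeasure S (reach (Suc r)) = ennreal (measure S (reach 1) ^ Suc r)"
proof (induction r)
  case 0
  show ?case by (simp add: emeasure_eq_measure)
next
  case (Suc r)
  show ?case unfolding emeasure_reach_Suc[of "Suc r", simplified] Suc
    by (simp add: emeasure_eq_measure ennreal_mult[symmetric] mult.commute)
qed

lemma distr_rotate:
  assumes "q < n"
  shows "distr S S (rotate_steps n q) = S"
proof -
  define f where "f = (\<lambda>i. if i < n then (q + i) mod n else i)"
  have "inj f"
  proof (rule injI)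
    fix i j assume eq: "f i = f j"
    have fl: "f i < n \<longleftrightarrow> i < n" for i using assms by (auto simp: f_def)
    show "i = j"
    proof (cases "i < n")
      case True
      then have "j < n" using eq fl by metis
      then have "(q + i) mod n = (q + j) mod n" using eq True by (simp add: f_def)
      moreover have "(q + i) mod n = (if q + i < n then q + i else q + i - n)" if "i < n" for i
        using that assms by (simp add: mod_if)
      ultimately show ?thesis using True \<open>j < n\<close> by (auto split: if_splits)
    next
      case False
      then have "\<not> j < n" using eq fl by metis
      then show ?thesis using eq False by (simp add: f_def)
    qed
  qed
  then have "distr S (\<Pi>\<^sub>M i\<in>UNIV. D) (\<lambda>\<omega>. \<lambda>i\<in>UNIV. \<omega> (f i)) = S"
    using distr_PiM_reindex[of UNIV "\<lambda>_. D" f UNIV] M.prob_space_axioms by simp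
  moreover have "(\<lambda>\<omega>. \<lambda>i\<in>UNIV. \<omega> (f i)) = rotate_steps n q"
    by (auto simp: rotate_steps_def f_def fun_eq_iff)
  ultimately show ?thesis by simp
qed

lemma measurable_ladder_weight [measurable]: "ladder_weight n \<in> borel_measurable S"
  unfolding ladder_weight_def by measurable

text \<open>
  Cyclic rotations preserve the law of the steps, so the expected weight is one \<open>n\<close>-th of the
  expected sum of the weights of all rotations; that sum is an indicator by the cyclic lemma.
\<close>

lemma integral_ladder_weight:
  assumes "n > 0"
  shows "(\<integral>\<^sup>+x. ladder_weight n x \<partial>S) = ennreal (measure S {x. 0 \<le> walk x n} / real n)"
proof -
  have [measurable]: "rotate_steps n q \<in> measurable S S" for q
    unfolding rotate_steps_def by (rule measurable_PiM_single') (auto simp: space_PiM)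
  have rot: "(\<integral>\<^sup>+x. ladder_weight n (rotate_steps n q x) \<partial>S) = (\<integral>\<^sup>+x. ladder_weight n x \<partial>S)" if "q < n" for q
  proof -
    have "(\<integral>\<^sup>+x. ladder_weight n x \<partial>S) = (\<integral>\<^sup>+x. ladder_weight n x \<partial>distr S S (rotate_steps n q))"
      by (simp only: distr_rotate[OF that])
    also have "\<dots> = (\<integral>\<^sup>+x. ladder_weight n (rotate_steps n q x) \<partial>S)"
      by (intro nn_integral_distr) auto
    finally show ?thesis by simp
  qed
  have w0: "0 \<le> ladder_weight n x" for x by (simp add: ladder_weight_def)
  have "of_nat n * (\<integral>\<^sup>+x. ladder_weight n x \<partial>S) = (\<Sum>q<n. \<integral>\<^sup>+x. ladder_weight n (rotate_steps n q x) \<partial>S)"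
    using rot by simp
  also have "\<dots> = (\<integral>\<^sup>+x. (\<Sum>q<n. ennreal (ladder_weight n (rotate_steps n q x))) \<partial>S)"
    by (intro nn_integral_sum[symmetric]) measurable
  also have "\<dots> = (\<integral>\<^sup>+x. indicator {x. 0 \<le> walk x n} x \<partial>S)"
    by (intro nn_integral_cong)
       (simp add: sum_ennreal w0 sum_ladder_weight_rotate[OF assms] indicator_def)
  also have "\<dots> = emeasure S {x. 0 \<le> walk x n}"
  proof -
    have "{x \<in> space S. 0 \<le> walk x n} \<in> sets S" by measurable
    then show ?thesis by simp
  qed
  finally have *: "of_nat n * (\<integral>\<^sup>+x. ladder_weight n x \<partial>S) = ennreal (measure S {x. 0 \<le> walk x n})"
    by (simp add: emeasure_eq_measure)
  have "(\<integral>\<^sup>+x. ladder_weight n x \<partial>S) = of_nat n * (\<integral>\<^sup>+x. ladder_weight n x \<partial>S) / of_nat n"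
    using assms ennreal_mult_divide_eq[of "of_nat n" "\<integral>\<^sup>+x. ladder_weight n x \<partial>S"]
    by (simp add: mult.commute[of "of_nat n"])
  also have "\<dots> = ennreal (measure S {x. 0 \<le> walk x n} / real n)"
    unfolding * using assms by (simp add: divide_ennreal ennreal_of_nat_eq_real_of_nat)
  finally show ?thesis .
qed

lemma integral_ladder_weight_eq_suminf:
  assumes "n > 0"
  shows "(\<integral>\<^sup>+x. ladder_weight n x \<partial>S) = (\<Sum>r. ennreal (1 / real (Suc r)) * emeasure S (ladder_event (Suc r)
      n))"
proof -
  have "ennreal (ladder_weight n x) = (\<Sum>r. ennreal (1 / real (Suc r)) * indicator (ladder_event (Suc r) n)
      x)" for x
  proof (cases "ladder x n")
    case True
    then have pos: "num_ladders x n > 0"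
      using num_ladders_less[OF True ladder_pos[OF True]] by simp
    have "(\<Sum>r. ennreal (1 / real (Suc r)) * indicator (ladder_event (Suc r) n) x)
      = (\<Sum>r\<in>{num_ladders x n - 1}. ennreal (1 / real (Suc r)) * indicator (ladder_event (Suc r) n) x)"
      by (rule suminf_finite) (auto simp: ladder_event_def indicator_def)
    then show ?thesis using True pos by (simp add: ladder_weight_def ladder_event_def)
  qed (simp add: ladder_weight_def ladder_event_def)
  then have "(\<integral>\<^sup>+x. ladder_weight n x \<partial>S)
      = (\<integral>\<^sup>+x. (\<Sum>r. ennreal (1 / real (Suc r)) * indicator (ladder_event (Suc r) n) x) \<partial>S)"
    by simp
  also have "\<dots> = (\<Sum>r. ennreal (1 / real (Suc r)) * emeasure S (ladder_event (Suc r) n))"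
    by (subst nn_integral_suminf) (auto simp: nn_integral_cmult_indicator)
  finally show ?thesis .
qed

text \<open>
  The first index \<open>n \<ge> 1\<close> at which the walk is nonnegative is a ladder index.
\<close>

lemma never_nonneg_eq: "{x. \<forall>n\<ge>1. walk x n < 0} = - reach 1"
proof -
  have "(\<exists>n\<ge>1. 0 \<le> walk x n) \<longleftrightarrow> x \<in> reach 1" for x
  proof
    assume "\<exists>n\<ge>1. 0 \<le> walk x n"
    define n where "n = (LEAST n. 1 \<le> n \<and> 0 \<le> walk x n)"
    have n: "1 \<le> n \<and> 0 \<le> walk x n" unfolding n_def using \<open>\<exists>n\<ge>1. 0 \<le> walk x n\<close> by (rule LeastI_ex)
    have "walk x j \<le> 0" if "j < n" for j
      using not_less_Least[of j "\<lambda>n. 1 \<le> n \<and> 0 \<le> walk x n"] that unfolding n_def[symmetric]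
      by (cases "j = 0") (auto simp: not_le)
    then have "ladder x n" using n by (force simp: ladder_def)
    then show "x \<in> reach 1" using first_ladder by (auto simp: reach_def)
  next
    assume "x \<in> reach 1"
    then obtain n where "ladder x n" by (auto simp: reach_def)
    then have "1 \<le> n" "walk x 0 \<le> walk x n" by (auto simp: ladder_def)
    then show "\<exists>n\<ge>1. 0 \<le> walk x n" by auto
  qed
  then show ?thesis by (auto simp: not_le[symmetric])
qed

text \<open>
  Spitzer's formula. Let \<open>G\<close> be the probability of a ladder index. The probability of an \<open>r\<close>-th
  one is \<open>G ^ r\<close>, so summing the expected weights over \<open>n\<close> gives \<open>\<Sum>r. G ^ r / r = - ln (1 - G)\<close>,
  while the cyclic lemma turns the same sum into \<open>\<Sum>n. P(S\<^sub>n \<ge> 0) / n\<close>. Summability rules out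
  \<open>G = 1\<close>, where the first of the two series is harmonic.
\<close>

lemma prob_always_negative:
  assumes "summable (\<lambda>n. measure S {x. 0 \<le> walk x (Suc n)} / real (Suc n))"
  shows "measure S {x. \<forall>n\<ge>1. walk x n < 0} =
    exp (- (\<Sum>n. measure S {x. 0 \<le> walk x (Suc n)} / real (Suc n)))"
proof -
  define G where "G = measure S (reach 1)"
  define P where "P = (\<Sum>n. measure S {x. 0 \<le> walk x (Suc n)} / real (Suc n))"
  have ev0: "ladder_event r 0 = {}" for r by (auto simp: ladder_event_def ladder_def)
  have "ennreal P = (\<Sum>n. ennreal (measure S {x. 0 \<le> walk x (Suc n)} / real (Suc n)))"
    unfolding P_def using assms by (intro suminf_ennreal2[symmetric]) (auto simp del: of_nat_Suc)
  also have "\<dots> = (\<Sum>n. \<Sum>r. ennreal (1 / real (Suc r)) * emeasure S (ladder_event (Suc r) (Suc n)))"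
    by (simp only: integral_ladder_weight[OF zero_less_Suc, symmetric]
        integral_ladder_weight_eq_suminf[OF zero_less_Suc])
  also have "\<dots> = (\<Sum>r. \<Sum>n. ennreal (1 / real (Suc r)) * emeasure S (ladder_event (Suc r) (Suc n)))"
    by (rule suminf_ennreal_swap)
  also have "\<dots> = (\<Sum>r. ennreal (1 / real (Suc r)) * emeasure S (reach (Suc r)))"
  proof (intro suminf_cong)
    fix r
    have "emeasure S (reach (Suc r)) = (\<Sum>n. emeasure S (ladder_event (Suc r) (Suc n)))"
      unfolding emeasure_reach
      using suminf_offset[of "\<lambda>n. emeasure S (ladder_event (Suc r) n)" 1] by (simp add: ev0)
    then show "(\<Sum>n. ennreal (1 / real (Suc r)) * emeasure S (ladder_event (Suc r) (Suc n)))
      = ennreal (1 / real (Suc r)) * emeasure S (reach (Suc r))"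
      by simp
  qed
  also have "\<dots> = (\<Sum>r. ennreal (G ^ Suc r / real (Suc r)))"
    unfolding emeasure_reach_power G_def by (simp add: ennreal_mult[symmetric] del: power_Suc)
  finally have sum_eq: "ennreal P = (\<Sum>r. ennreal (G ^ Suc r / real (Suc r)))" .
  have G0: "0 \<le> G" "G \<le> 1" unfolding G_def by auto
  have summ: "summable (\<lambda>r. G ^ Suc r / real (Suc r))"
    using sum_eq G0 by (intro summable_suminf_not_top) auto
  have "ennreal P = ennreal (\<Sum>r. G ^ Suc r / real (Suc r))"
    unfolding sum_eq using G0 by (intro suminf_ennreal2 summ) auto
  moreover have "0 \<le> P" "0 \<le> (\<Sum>r. G ^ Suc r / real (Suc r))"
    unfolding P_def using G0 by (auto intro!: suminf_nonneg assms summ simp del: of_nat_Suc power_Suc)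
  ultimately have P_eq: "P = (\<Sum>r. G ^ Suc r / real (Suc r))" by simp
  have "G < 1"
  proof (rule ccontr)
    assume "\<not> G < 1"
    then have "summable (\<lambda>r. 1 / real (Suc r))" using summ G0 by simp
    then have "summable (\<lambda>r. inverse (real r))"
      by (subst summable_Suc_iff[symmetric]) (simp add: inverse_eq_divide)
    then show False using not_summable_harmonic[where 'a = real] by simp
  qed
  then have "ln (1 - G) = (\<Sum>n. (- 1) ^ n * (1 / real (n + 1)) * ((1 - G) - 1) ^ Suc n)"
    using G0 by (intro ln_series) auto
  also have "\<dots> = (\<Sum>n. - (G ^ Suc n / real (Suc n)))"
  proof (intro suminf_cong)
    fix n
    have "(- 1) ^ n * (- G) ^ Suc n = - (G ^ Suc n)"
      by (cases "even n") auto
    then show "(- 1) ^ n * (1 / real (n + 1)) * ((1 - G) - 1) ^ Suc n = - (G ^ Suc n / real (Suc n))"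
      by (simp add: field_simps del: power_Suc)
  qed
  also have "\<dots> = - P" using summ P_eq by (simp add: suminf_minus)
  finally have "1 - G = exp (- P)" using \<open>G < 1\<close> by (metis diff_gt_0_iff_gt exp_ln)
  moreover have "measure S {x. \<forall>n\<ge>1. walk x n < 0} = 1 - G"
    unfolding never_nonneg_eq G_def using prob_compl[OF reach_sets] by (simp add: Compl_eq_Diff_UNIV)
  ultimately show ?thesis by (simp add: P_def)
qed

end

section \<open>Gaussian tails\<close>

definition normal_tail :: "real \<Rightarrow> real" where
  "normal_tail x = measure std_normal_distribution {x..}"

lemma normal_tail_nonneg [simp]: "0 \<le> normal_tail x"
  by (simp add: normal_tail_def)

lemma normal_tail_antimono: "x \<le> y \<Longrightarrow> normal_tail y \<le> normal_tail x"
proof -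
  interpret N: real_distribution std_normal_distribution by (rule real_dist_normal_dist)
  show "x \<le> y \<Longrightarrow> ?thesis" unfolding normal_tail_def by (intro N.finite_measure_mono) auto
qed

lemma normal_tail_integral:
  "ennreal (normal_tail x) = (\<integral>\<^sup>+t. ennreal (std_normal_density t) * indicator {x..} t \<partial>lborel)"
proof -
  interpret N: real_distribution std_normal_distribution by (rule real_dist_normal_dist)
  show ?thesis unfolding normal_tail_def
    by (subst N.emeasure_eq_measure[symmetric]) (simp add: emeasure_density)
qed

text \<open>
  The function \<open>- \<phi>(x) / x\<close> has derivative \<open>\<phi>(x) (1 + 1 / x\<^sup>2)\<close>, which lies between \<open>\<phi>(x)\<close> and
  \<open>(1 + 1 / b\<^sup>2) \<phi>(x)\<close> for \<open>x \<ge> b\<close>.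
\<close>

lemma normal_tail_bounds:
  assumes "0 < b"
  shows "normal_tail b \<le> std_normal_density b / b"
    and "std_normal_density b / b \<le> (1 + 1 / b\<^sup>2) * normal_tail b"
proof -
  define f where "f = (\<lambda>x::real. std_normal_density x * (1 + 1 / x\<^sup>2))"
  define F where "F = (\<lambda>x::real. - (std_normal_density x / x))"
  have "(F has_real_derivative f x) (at x)" if "b \<le> x" for x
  proof -
    define c where "c = 1 / sqrt (2 * pi)"
    have sd: "std_normal_density = (\<lambda>x. c * exp (- x\<^sup>2 / 2))"
      by (simp add: std_normal_density_def c_def fun_eq_iff)
    show ?thesis unfolding F_def f_def sd using that assms
      by (auto intro!: derivative_eq_intros simp: field_simps power2_eq_square)
  qed
  moreover have "0 \<le> f x" for x by (simp add: f_def)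
  moreover have "(F \<longlongrightarrow> 0) at_top"
    unfolding F_def std_normal_density_def by real_asymp
  moreover have "f \<in> borel_measurable borel" unfolding f_def by measurable
  ultimately have int: "(\<integral>\<^sup>+x. ennreal (f x) * indicator {b..} x \<partial>lborel) = ennreal (std_normal_density b
      / b)"
    using nn_integral_FTC_atLeast[of f b F 0] by (simp add: F_def)
  have "ennreal (normal_tail b) \<le> ennreal (std_normal_density b / b)"
    unfolding normal_tail_integral int[symmetric]
    by (intro nn_integral_mono) (auto simp: f_def indicator_def intro!: ennreal_leI mult_right_mono[of 1,
        simplified] simp: algebra_simps)
  then show "normal_tail b \<le> std_normal_density b / b" using assms by (simp add: ennreal_le_iff)
  define k where "k = 1 + 1 / b\<^sup>2"
  have k0: "0 \<le> k" by (simp add: k_def)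
  have "ennreal (std_normal_density b / b) \<le>
    (\<integral>\<^sup>+x. ennreal k * (ennreal (std_normal_density x) * indicator {b..} x) \<partial>lborel)"
    unfolding int[symmetric]
  proof (intro nn_integral_mono)
    fix x :: real
    have "f x \<le> k * std_normal_density x" if "b \<le> x"
    proof -
      have "b\<^sup>2 \<le> x\<^sup>2" using that assms by (intro power_mono) auto
      then have "1 / x\<^sup>2 \<le> 1 / b\<^sup>2" using assms by (intro divide_left_mono) (use that in auto)
      then show ?thesis unfolding f_def k_def by (subst mult.commute) (intro mult_right_mono, auto)
    qed
    then show "ennreal (f x) * indicator {b..} x
        \<le> ennreal k * (ennreal (std_normal_density x) * indicator {b..} x)"
      using k0 by (auto simp: indicator_def ennreal_mult[symmetric] intro!: ennreal_leI)
  qed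
  also have "\<dots> = ennreal k * ennreal (normal_tail b)"
    unfolding normal_tail_integral by (intro nn_integral_cmult) measurable
  also have "\<dots> = ennreal (k * normal_tail b)" using k0 by (simp add: ennreal_mult)
  finally have "std_normal_density b / b \<le> k * normal_tail b"
    using k0 by (simp add: ennreal_le_iff)
  then show "std_normal_density b / b \<le> (1 + 1 / b\<^sup>2) * normal_tail b"
    by (simp only: k_def)
qed

lemma normal_tail_pos: "0 < b \<Longrightarrow> 0 < normal_tail b"
proof -
  assume b: "0 < b"
  then have "0 < std_normal_density b / b" by (intro divide_pos_pos normal_density_pos) auto
  then have "0 < (1 + 1 / b\<^sup>2) * normal_tail b" using normal_tail_bounds(2)[OF b] by linarith
  moreover have "0 < 1 + 1 / b\<^sup>2" by (simp add: add_pos_nonneg)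
  ultimately show "0 < normal_tail b" by (simp add: zero_less_mult_iff)
qed

lemma (in prob_space) prob_normal_ge:
  assumes X: "distributed M lborel X (normal_density \<mu> \<sigma>)" and "0 < \<sigma>"
  shows "prob {\<omega>\<in>space M. x \<le> X \<omega>} = normal_tail ((x - \<mu>) / \<sigma>)"
proof -
  have "distributed M lborel (\<lambda>\<omega>. (X \<omega> - \<mu>) / \<sigma>) std_normal_density"
    by (rule normal_standard_normal_convert[OF assms(2), THEN iffD1, OF X])
  then have d: "distr M lborel (\<lambda>\<omega>. (X \<omega> - \<mu>) / \<sigma>) = std_normal_distribution"
    and m: "(\<lambda>\<omega>. (X \<omega> - \<mu>) / \<sigma>) \<in> measurable M lborel"
    by (auto simp: distributed_def)
  have "normal_tail ((x - \<mu>) / \<sigma>) = prob ((\<lambda>\<omega>. (X \<omega> - \<mu>) / \<sigma>) -` {(x - \<mu>) / \<sigma>..} \<inter> space M)"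
    unfolding normal_tail_def d[symmetric] by (rule measure_distr[OF m]) simp
  also have "(\<lambda>\<omega>. (X \<omega> - \<mu>) / \<sigma>) -` {(x - \<mu>) / \<sigma>..} \<inter> space M = {\<omega>\<in>space M. x \<le> X \<omega>}"
    using assms(2) by (auto simp: field_simps)
  finally show ?thesis ..
qed

lemma normal_density_le: "0 < \<sigma> \<Longrightarrow> normal_density \<mu> \<sigma> x \<le> 1 / \<sigma>"
proof -
  assume s: "0 < \<sigma>"
  have "1 \<le> sqrt (2 * pi)" using pi_ge_two by (simp add: real_le_rsqrt)
  then have "\<sigma> \<le> sqrt (2 * pi * \<sigma>\<^sup>2)" using s by (simp add: real_sqrt_mult mult_le_cancel_right1)
  then have "1 / sqrt (2 * pi * \<sigma>\<^sup>2) \<le> 1 / \<sigma>" using s by (intro divide_left_mono) (auto intro!: mult_pos_pos)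
  moreover have "exp (- (x - \<mu>)\<^sup>2 / (2 * \<sigma>\<^sup>2)) \<le> 1" by simp
  ultimately have "1 / sqrt (2 * pi * \<sigma>\<^sup>2) * exp (- (x - \<mu>)\<^sup>2 / (2 * \<sigma>\<^sup>2)) \<le> 1 / \<sigma> * 1"
    using s by (intro mult_mono) auto
  then show ?thesis by (simp add: normal_density_def)
qed

lemma (in prob_space) prob_normal_interval_le:
  assumes X: "distributed M lborel X (normal_density \<mu> \<sigma>)" and "0 < \<sigma>" and "x \<le> y"
  shows "prob {\<omega>\<in>space M. x \<le> X \<omega> \<and> X \<omega> \<le> y} \<le> (y - x) / \<sigma>"
proof -
  have m: "X \<in> measurable M lborel" and d: "distr M lborel X = density lborel (normal_density \<mu> \<sigma>)"
    using X by (auto simp: distributed_def)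
  have "emeasure M {\<omega>\<in>space M. x \<le> X \<omega> \<and> X \<omega> \<le> y} = emeasure M (X -` {x..y} \<inter> space M)"
    by (rule arg_cong[where f = "emeasure M"]) auto
  also have "\<dots> = emeasure (distr M lborel X) {x..y}"
    by (rule emeasure_distr[OF m, symmetric]) simp
  also have "\<dots> = (\<integral>\<^sup>+t. ennreal (normal_density \<mu> \<sigma> t) * indicator {x..y} t \<partial>lborel)"
    unfolding d by (simp add: emeasure_density)
  also have "\<dots> \<le> (\<integral>\<^sup>+t. ennreal (1 / \<sigma>) * indicator {x..y} t \<partial>lborel)"
    using normal_density_le[OF assms(2)] by (intro nn_integral_mono mult_right_mono ennreal_leI) auto
  also have "\<dots> = ennreal ((y - x) / \<sigma>)"
    using assms by (simp add: nn_integral_cmult_indicator ennreal_mult[symmetric])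
  finally show ?thesis using assms by (simp add: emeasure_eq_measure ennreal_le_iff)
qed

lemma std_normal_cdf_uminus: "std_normal_cdf (- x) = normal_tail x"
proof -
  interpret N: real_distribution std_normal_distribution by (rule real_dist_normal_dist)
  have "distributed std_normal_distribution lborel (\<lambda>x. x) std_normal_density"
    by (auto simp: distributed_def intro!: distr_id2)
  then have "distributed std_normal_distribution lborel (\<lambda>x. 0 + (- 1) * x) (normal_density (0 + (- 1) *
      0) (\<bar>- 1\<bar> * 1))"
    by (intro N.normal_density_affine) auto
  then have "distributed std_normal_distribution lborel (\<lambda>x. - x) (normal_density 0 1)" by simp
  from N.prob_normal_ge[OF this, of x] have "measure std_normal_distribution {t. x \<le> - t} = normal_tail x"
      by simp
  moreover have "{t. x \<le> - t} = {..- x}" by auto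
  ultimately show ?thesis by (simp add: cdf_def)
qed

section \<open>Gaussian walks with negative drift and the function nu\<close>

context random_walk begin

lemma distr_coordinate: "distr S borel (\<lambda>x. x i) = D"
proof -
  have "distr S borel (\<lambda>x. x i) = distr S D (\<lambda>x. x i)"
    by (intro distr_cong) (auto simp: sets_D)
  also have "\<dots> = D"
    by (rule distr_PiM_component) (auto intro: M.prob_space_axioms)
  finally show ?thesis .
qed

lemma indep_coordinates:
  assumes "finite I" "I \<noteq> {}"
  shows "P.indep_vars (\<lambda>_. borel) (\<lambda>i x. x i) I"
proof -
  have m: "(\<lambda>x. x i) \<in> measurable S borel" for i by measurable
  have "distr S (\<Pi>\<^sub>M i\<in>I. borel) (\<lambda>x. \<lambda>i\<in>I. x i) = distr S (\<Pi>\<^sub>M i\<in>I. D) (\<lambda>x. restrict x I)"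
    by (intro distr_cong sets_PiM_cong) (auto simp: sets_D)
  also have "\<dots> = (\<Pi>\<^sub>M i\<in>I. D)"
    using assms by (intro distr_PiM_restrict_finite) auto
  also have "\<dots> = (\<Pi>\<^sub>M i\<in>I. distr S borel (\<lambda>x. x i))"
    by (simp only: distr_coordinate)
  finally show ?thesis
    by (subst P.indep_vars_iff_distr_eq_PiM'[OF assms(2) m]) simp
qed

text \<open>
  Probabilities of finite stretches of a walk may be computed for any independent steps with the
  right law, on whatever probability space they live.
\<close>

lemma walk_law_transfer:
  assumes "prob_space M" and ind: "prob_space.indep_vars M (\<lambda>_. borel) Y {..<L}"
    and Y: "\<And>i. i < L \<Longrightarrow> distr M borel (Y i) = D"
  shows "measure M {\<omega> \<in> space M. \<forall>n\<in>{1..L}. (\<Sum>i<n. Y i \<omega>) \<le> \<delta>} =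
    measure S {x. \<forall>n\<in>{1..L}. walk x n \<le> \<delta>}"
proof (cases "L = 0")
  case True
  then show ?thesis using prob_space.prob_space[OF assms(1)] P.prob_space by simp
next
  case False
  interpret PM: prob_space M by fact
  define J where "J = {..<L}"
  define B where "B = {x \<in> space (\<Pi>\<^sub>M i\<in>J. (borel :: real measure)). \<forall>n\<in>{1..L}. walk x n \<le> \<delta>}"
  have J: "J \<noteq> {}" "finite J" using False by (auto simp: J_def)
  have B: "B \<in> sets (\<Pi>\<^sub>M i\<in>J. borel)"
    unfolding B_def
  proof (intro sets.sets_Collect_finite_All)
    fix n assume n: "n \<in> {1..L}"
    have "(\<lambda>x. walk x n) \<in> borel_measurable (\<Pi>\<^sub>M i\<in>J. borel)"
      unfolding walk_def using n
      by (intro borel_measurable_sum measurable_component_singleton) (auto simp: J_def)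
    then show "{x \<in> space (\<Pi>\<^sub>M i\<in>J. borel). walk x n \<le> \<delta>} \<in> sets (\<Pi>\<^sub>M i\<in>J. borel)"
      by (intro borel_measurable_le) auto
  qed auto
  have rv: "Y i \<in> measurable M borel" if "i \<in> J" for i
    using ind that by (auto simp: J_def PM.indep_vars_def)
  have wr: "walk (restrict x J) n = walk x n" if "n \<in> {1..L}" for x n
    using that by (intro walk_cong) (auto simp: J_def)
  have PiD: "distr M (\<Pi>\<^sub>M i\<in>J. borel) (\<lambda>\<omega>. \<lambda>i\<in>J. Y i \<omega>) = (\<Pi>\<^sub>M i\<in>J. D)"
  proof -
    have "distr M (\<Pi>\<^sub>M i\<in>J. borel) (\<lambda>\<omega>. \<lambda>i\<in>J. Y i \<omega>) = (\<Pi>\<^sub>M i\<in>J. distr M borel (Y i))"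
      using PM.indep_vars_iff_distr_eq_PiM'[OF J(1) rv] ind by (simp add: J_def)
    also have "\<dots> = (\<Pi>\<^sub>M i\<in>J. D)" using Y by (intro PiM_cong) (auto simp: J_def)
    finally show ?thesis .
  qed
  have PiS: "distr S (\<Pi>\<^sub>M i\<in>J. borel) (\<lambda>x. restrict x J) = (\<Pi>\<^sub>M i\<in>J. D)"
  proof -
    have "distr S (\<Pi>\<^sub>M i\<in>J. borel) (\<lambda>x. restrict x J) = distr S (\<Pi>\<^sub>M i\<in>J. D) (\<lambda>x. restrict x J)"
      by (intro distr_cong sets_PiM_cong) (auto simp: sets_D)
    also have "\<dots> = (\<Pi>\<^sub>M i\<in>J. D)"
      using J by (intro distr_PiM_restrict_finite) auto
    finally show ?thesis .
  qed
  have "measure (\<Pi>\<^sub>M i\<in>J. D) B = measure M ((\<lambda>\<omega>. \<lambda>i\<in>J. Y i \<omega>) -` B \<inter> space M)"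
    unfolding PiD[symmetric] using rv by (intro measure_distr measurable_restrict B)
  also have "(\<lambda>\<omega>. \<lambda>i\<in>J. Y i \<omega>) -` B \<inter> space M = {\<omega> \<in> space M. \<forall>n\<in>{1..L}. (\<Sum>i<n. Y i \<omega>) \<le> \<delta>}"
    unfolding B_def using wr[of _ "\<lambda>i. Y i _"] by (auto simp: space_PiM walk_def)
  finally have 1: "measure (\<Pi>\<^sub>M i\<in>J. D) B = measure M {\<omega> \<in> space M. \<forall>n\<in>{1..L}. (\<Sum>i<n. Y i \<omega>) \<le> \<delta>}" .
  have "measure (\<Pi>\<^sub>M i\<in>J. D) B = measure S ((\<lambda>x. restrict x J) -` B \<inter> space S)"
    unfolding PiS[symmetric] by (intro measure_distr B measurable_restrict) measurable
  also have "(\<lambda>x. restrict x J) -` B \<inter> space S = {x. \<forall>n\<in>{1..L}. walk x n \<le> \<delta>}"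
    unfolding B_def using wr by (auto simp: space_PiM sets_eq_imp_space_eq[OF sets_D])
  finally show ?thesis using 1 by simp
qed

end

text \<open>
  Given that a statistic equals \<open>b\<close>, \<open>b\<close> times the difference to a neighbouring one has, up to
  small errors, minus half of its variance as its mean. Hence this relation between drift and
  variance.
\<close>

definition gauss_step :: "real \<Rightarrow> real measure" where
  "gauss_step \<beta> = density lborel (normal_density (- \<beta>\<^sup>2 / 2) \<beta>)"

definition stay_neg :: "real \<Rightarrow> real" where
  "stay_neg \<beta> = measure (\<Pi>\<^sub>M i\<in>(UNIV::nat set). gauss_step \<beta>) {x. \<forall>n\<ge>1. walk x n < 0}"

definition stay_below :: "real \<Rightarrow> nat \<Rightarrow> real \<Rightarrow> real" where
  "stay_below \<beta> L \<delta> = measure (\<Pi>\<^sub>M i\<in>(UNIV::nat set). gauss_step \<beta>) {x. \<forall>n\<in>{1..L}. walk x n \<le> \<delta>}"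

lemma random_walk_gauss_step:
  assumes "0 < \<beta>" shows "random_walk (gauss_step \<beta>)"
proof -
  have "prob_space (gauss_step \<beta>)" unfolding gauss_step_def
    using assms by (rule prob_space_normal_density)
  then show ?thesis
    by unfold_locales (auto simp: gauss_step_def prob_space_def prob_space_axioms_def finite_measure_def
        sigma_finite_measure_def finite_measure_axioms_def)
qed

locale gauss_walk =
  fixes \<beta> :: real assumes beta_pos: "0 < \<beta>"
begin

sublocale random_walk "gauss_step \<beta>"
  by (rule random_walk_gauss_step) (rule beta_pos)

lemma distributed_walk:
  assumes "0 < n"
  shows "distributed S lborel (\<lambda>x. walk x n) (normal_density (- (real n * \<beta>\<^sup>2 / 2)) (\<beta> * sqrt (real n)))"
proof -
  have c: "distributed S lborel (\<lambda>x. x i) (normal_density (- \<beta>\<^sup>2 / 2) \<beta>)" for i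
  proof -
    have "distr S lborel (\<lambda>x. x i) = distr S borel (\<lambda>x. x i)" by (intro distr_cong) auto
    moreover have "(\<lambda>x. x i) \<in> measurable S lborel" by measurable
    moreover have "distr S borel (\<lambda>x. x i) = density lborel (normal_density (- \<beta>\<^sup>2 / 2) \<beta>)"
      unfolding distr_coordinate by (simp add: gauss_step_def)
    ultimately show ?thesis unfolding distributed_def by auto
  qed
  have "distributed S lborel (\<lambda>x. \<Sum>i<n. x i)
    (normal_density (\<Sum>i<n. - \<beta>\<^sup>2 / 2) (sqrt (\<Sum>i<n. \<beta>\<^sup>2)))"
    using assms beta_pos c by (intro P.sum_indep_normal indep_coordinates) auto
  moreover have "sqrt (\<Sum>i<n. \<beta>\<^sup>2) = \<beta> * sqrt (real n)"
    using beta_pos by (simp add: real_sqrt_mult mult.commute)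
  ultimately show ?thesis by (simp add: walk_def)
qed

lemma prob_walk_nonneg:
  "measure S {x. 0 \<le> walk x (Suc n)} = normal_tail (\<beta> * sqrt (real (Suc n)) / 2)"
proof -
  have "measure S {x\<in>space S. 0 \<le> walk x (Suc n)} =
    normal_tail ((0 - - (real (Suc n) * \<beta>\<^sup>2 / 2)) / (\<beta> * sqrt (real (Suc n))))"
    using beta_pos by (intro P.prob_normal_ge distributed_walk) auto
  also have "(0 - - (real (Suc n) * \<beta>\<^sup>2 / 2)) / (\<beta> * sqrt (real (Suc n))) = \<beta> * sqrt (real (Suc n)) / 2"
    using beta_pos by (simp add: field_simps power2_eq_square real_sqrt_mult_self del: of_nat_Suc)
  finally show ?thesis by simp
qed

lemma prob_walk_interval:
  assumes "x \<le> y" "0 < n"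
  shows "measure S {\<omega>. x \<le> walk \<omega> n \<and> walk \<omega> n \<le> y} \<le> (y - x) / \<beta>"
proof -
  have "measure S {\<omega>\<in>space S. x \<le> walk \<omega> n \<and> walk \<omega> n \<le> y} \<le> (y - x) / (\<beta> * sqrt (real n))"
    using beta_pos assms by (intro P.prob_normal_interval_le[OF distributed_walk]) auto
  also have "\<dots> \<le> (y - x) / \<beta>"
    using beta_pos assms by (intro divide_left_mono) (auto simp: mult_le_cancel_left1)
  finally show ?thesis by simp
qed

end

lemma summable_normal_tail_sqrt:
  assumes "0 < \<beta>"
  shows "summable (\<lambda>n. normal_tail (\<beta> * sqrt (real (Suc n)) / 2))"
proof (rule summable_comparison_test')
  have r: "exp (- \<beta>\<^sup>2 / 8) < 1" using assms by simp
  show "summable (\<lambda>n. 2 / \<beta> * exp (- \<beta>\<^sup>2 / 8) ^ Suc n)"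
    using r by (intro summable_mult) (auto simp: summable_Suc_iff intro!: summable_geometric simp del:
        power_Suc)
  fix n :: nat
  define x where "x = \<beta> * sqrt (real (Suc n)) / 2"
  have x0: "0 < x" using assms by (simp add: x_def)
  have xb: "\<beta> / 2 \<le> x" using assms by (simp add: x_def)
  have x2: "x\<^sup>2 = \<beta>\<^sup>2 * real (Suc n) / 4" by (simp add: x_def power_mult_distrib power_divide)
  have "normal_tail x \<le> std_normal_density x / x" by (rule normal_tail_bounds(1)[OF x0])
  also have "\<dots> \<le> exp (- x\<^sup>2 / 2) / (\<beta> / 2)"
  proof (rule frac_le)
    have "1 \<le> sqrt (2 * pi)" using pi_ge_two by (simp add: real_le_rsqrt)
    then show "std_normal_density x \<le> exp (- x\<^sup>2 / 2)"
      by (simp add: std_normal_density_def divide_le_eq mult_le_cancel_left1)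
  qed (use xb assms in auto)
  also have "exp (- x\<^sup>2 / 2) = exp (- \<beta>\<^sup>2 / 8) ^ Suc n"
    unfolding exp_of_nat_mult[symmetric] x2 by (simp add: field_simps)
  finally show "norm (normal_tail (\<beta> * sqrt (real (Suc n)) / 2)) \<le> 2 / \<beta> * exp (- \<beta>\<^sup>2 / 8) ^ Suc n"
    using assms by (simp add: x_def field_simps)
qed

lemma summable_normal_tail_sqrt_div:
  assumes "0 < \<beta>"
  shows "summable (\<lambda>n. normal_tail (\<beta> * sqrt (real (Suc n)) / 2) / real (Suc n))"
proof (rule summable_comparison_test'[OF summable_normal_tail_sqrt[OF assms]])
  fix n
  show "norm (normal_tail (\<beta> * sqrt (real (Suc n)) / 2) / real (Suc n)) \<le> normal_tail (\<beta> * sqrt (real (Suc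
      n)) / 2)"
    by (simp add: divide_le_eq mult_le_cancel_left1 not_less[THEN iffD2, OF normal_tail_nonneg] del:
        of_nat_Suc)
qed

lemma stay_neg_eq:
  assumes "0 < \<beta>"
  shows "stay_neg \<beta> = exp (- (\<Sum>n. normal_tail (\<beta> * sqrt (real (Suc n)) / 2) / real (Suc n)))"
proof -
  interpret gauss_walk \<beta> by unfold_locales fact
  show ?thesis unfolding stay_neg_def
    using prob_always_negative summable_normal_tail_sqrt_div[OF assms] by (simp only: prob_walk_nonneg)
qed

text \<open>
  By Spitzer's formula the series that defines \<open>nu\<close> is \<open>- ln (stay_neg \<beta>)\<close>: the event
  \<open>walk x n \<ge> 0\<close> has probability \<open>\<Phi>(- \<beta> \<surd>n / 2)\<close>.
\<close>

lemma nu_eq_stay_neg: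
  assumes "0 < \<beta>"
  shows "nu \<beta> = 2 / \<beta>\<^sup>2 * (stay_neg \<beta>)\<^sup>2"
proof -
  define s where "s = (\<Sum>n. normal_tail (\<beta> * sqrt (real (Suc n)) / 2) / real (Suc n))"
  have "nu \<beta> = 2 / \<beta>\<^sup>2 * exp (- 2 * s)"
    unfolding nu_def s_def std_normal_cdf_uminus by simp
  also have "exp (- 2 * s) = (exp (- s))\<^sup>2" by (simp add: exp_double[symmetric] flip: exp_of_nat_mult)
  finally show ?thesis by (simp add: stay_neg_eq[OF assms] s_def)
qed

lemma stay_neg_nonneg: "0 \<le> stay_neg \<beta>"
  by (simp add: stay_neg_def)

lemma stay_neg_le_1: "0 < \<beta> \<Longrightarrow> stay_neg \<beta> \<le> 1"
proof -
  assume "0 < \<beta>"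
  then interpret gauss_walk \<beta> by unfold_locales
  show ?thesis unfolding stay_neg_def by (rule P.prob_le_1)
qed

lemma stay_neg_mono:
  assumes "0 < \<beta>" "\<beta> \<le> \<gamma>"
  shows "stay_neg \<beta> \<le> stay_neg \<gamma>"
proof -
  have "0 < \<gamma>" using assms by simp
  then show ?thesis
    unfolding stay_neg_eq[OF assms(1)] stay_neg_eq[OF \<open>0 < \<gamma>\<close>]
    using assms by (auto intro!: suminf_le summable_normal_tail_sqrt_div divide_right_mono
        normal_tail_antimono mult_right_mono simp del: of_nat_Suc)
qed

lemma stay_neg_pos: "0 < \<beta> \<Longrightarrow> 0 < stay_neg \<beta>"
  by (simp add: stay_neg_eq)

text \<open>
  Staying below a small level \<open>\<plusminus> \<delta>\<close> up to a large time \<open>L\<close> is almost the same event as staying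
  negative forever, uniformly over \<open>\<beta> \<ge> \<beta>\<^sub>0\<close>. The difference requires a nonnegative value after
  time \<open>L\<close>, whose probability is the tail of a series that decreases in \<open>\<beta>\<close>, or a value within
  \<open>\<delta>\<close> of \<open>0\<close> before, whose probability is at most \<open>\<delta> / \<beta>\<close> for each index since the density of
  \<open>walk x n\<close> is at most \<open>1 / \<beta>\<close>.
\<close>

lemma stay_below_bounds:
  fixes L\<^sub>0 :: nat
  assumes "0 < \<beta>\<^sub>0" "0 < \<eta>"
  obtains L \<delta> where "L\<^sub>0 \<le> L" "0 < \<delta>"
    "\<And>\<beta>. \<beta>\<^sub>0 \<le> \<beta> \<Longrightarrow> stay_below \<beta> L \<delta> \<le> stay_neg \<beta> + \<eta>"
    "\<And>\<beta>. \<beta>\<^sub>0 \<le> \<beta> \<Longrightarrow> stay_neg \<beta> - \<eta> \<le> stay_below \<beta> L (- \<delta>)"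
proof -
  define q where "q = (\<lambda>\<beta> n. normal_tail (\<beta> * sqrt (real (Suc n)) / 2))"
  have q0: "summable (q \<beta>)" if "0 < \<beta>" for \<beta>
    unfolding q_def by (rule summable_normal_tail_sqrt[OF that])
  obtain N where N: "\<And>n. N \<le> n \<Longrightarrow> norm (\<Sum>i. q \<beta>\<^sub>0 (i + n)) < \<eta> / 2"
    using suminf_exist_split[OF _ q0[OF assms(1)], of "\<eta> / 2"] assms by auto
  define L where "L = Suc N + L\<^sub>0"
  define \<delta> where "\<delta> = \<eta> * \<beta>\<^sub>0 / (2 * real L)"
  have L: "0 < L" by (simp add: L_def)
  have d: "0 < \<delta>" using assms L by (simp add: \<delta>_def)
  have 1: "stay_below \<beta> L \<delta> \<le> stay_neg \<beta> + \<eta> \<and> stay_neg \<beta> - \<eta> \<le> stay_below \<beta> L (- \<delta>)"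
    if b: "\<beta>\<^sub>0 \<le> \<beta>" for \<beta>
  proof -
    have bpos: "0 < \<beta>" using assms b by simp
    interpret gauss_walk \<beta> by unfold_locales (rule bpos)
    have sets_le: "{x. walk x n \<le> c} \<in> sets S" "{x. walk x n < c} \<in> sets S"
      "{x. c \<le> walk x n} \<in> sets S" for n c
    proof -
      have "{x\<in>space S. walk x n \<le> c} \<in> sets S" "{x\<in>space S. walk x n < c} \<in> sets S"
        "{x\<in>space S. c \<le> walk x n} \<in> sets S"
        by (intro borel_measurable_le borel_measurable_less measurable_walk borel_measurable_const)+
      then show "{x. walk x n \<le> c} \<in> sets S" "{x. walk x n < c} \<in> sets S"
        "{x. c \<le> walk x n} \<in> sets S" by simp_all
    qed
    have sets_int: "{x. c \<le> walk x n \<and> walk x n \<le> c'} \<in> sets S" for n c c'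
    proof -
      have "{x. c \<le> walk x n \<and> walk x n \<le> c'} = {x. c \<le> walk x n} \<inter> {x. walk x n \<le> c'}" by auto
      then show ?thesis using sets_le by auto
    qed
    have sets_below: "{x. \<forall>n\<in>{1..L}. walk x n \<le> c} \<in> sets S" for c
    proof -
      have "{x. \<forall>n\<in>{1..L}. walk x n \<le> c} = (\<Inter>n\<in>{1..L}. {x. walk x n \<le> c})" by auto
      also have "\<dots> \<in> sets S" using L sets_le by (intro sets.finite_INT) auto
      finally show ?thesis .
    qed
    have sets_neg: "{x. \<forall>n\<ge>1. walk x n < 0} \<in> sets S"
      unfolding never_nonneg_eq using reach_sets[of 1] by (metis sets.compl_sets space_S Compl_eq_Diff_UNIV)
    have small: "measure S (\<Union>n\<in>{1..L}. {x. c \<le> walk x n \<and> walk x n \<le> c + \<delta>}) \<le> \<eta> / 2" for c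
    proof -
      have "measure S (\<Union>n\<in>{1..L}. {x. c \<le> walk x n \<and> walk x n \<le> c + \<delta>})
        \<le> (\<Sum>n\<in>{1..L}. measure S {x. c \<le> walk x n \<and> walk x n \<le> c + \<delta>})"
        by (intro P.finite_measure_subadditive_finite) (auto simp: sets_int)
      also have "\<dots> \<le> (\<Sum>n\<in>{1..L}. (c + \<delta> - c) / \<beta>)"
        using d by (intro sum_mono prob_walk_interval) auto
      also have "\<dots> = real L * \<delta> / \<beta>" by simp
      also have "\<dots> \<le> real L * \<delta> / \<beta>\<^sub>0" using b assms d by (intro divide_left_mono) auto
      also have "\<dots> = \<eta> / 2" using assms L by (simp add: \<delta>_def)
      finally show ?thesis .
    qed
    have far: "measure S (\<Union>n. {x. 0 \<le> walk x (Suc (n + L))}) \<le> \<eta> / 2"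
    proof -
      have sm: "summable (\<lambda>n. q \<beta> (n + L))" using q0[OF bpos] by (simp add: summable_iff_shift)
      have sm0: "summable (\<lambda>n. q \<beta>\<^sub>0 (n + L))" using q0[OF assms(1)] by (simp add: summable_iff_shift)
      have "measure S (\<Union>n. {x. 0 \<le> walk x (Suc (n + L))}) \<le> (\<Sum>n. measure S {x. 0 \<le> walk x (Suc (n + L))})"
        using sm by (intro P.finite_measure_subadditive_countably) (auto simp: sets_le prob_walk_nonneg q_def)
      also have "\<dots> = (\<Sum>n. q \<beta> (n + L))" by (simp only: prob_walk_nonneg q_def)
      also have "\<dots> \<le> (\<Sum>n. q \<beta>\<^sub>0 (n + L))"
        using b assms unfolding q_def
        by (intro suminf_le sm[unfolded q_def] sm0[unfolded q_def] normal_tail_antimono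
            divide_right_mono mult_right_mono) auto
      also have "\<dots> \<le> \<eta> / 2" using N[of L] by (simp add: L_def)
      finally show ?thesis .
    qed
    have "stay_below \<beta> L \<delta> \<le> measure S ({x. \<forall>n\<ge>1. walk x n < 0} \<union>
        (\<Union>n\<in>{1..L}. {x. 0 \<le> walk x n \<and> walk x n \<le> 0 + \<delta>}) \<union> (\<Union>n. {x. 0 \<le> walk x (Suc (n + L))}))"
      unfolding stay_below_def
    proof (intro P.finite_measure_mono)
      show "{x. \<forall>n\<in>{1..L}. walk x n \<le> \<delta>} \<subseteq> {x. \<forall>n\<ge>1. walk x n < 0} \<union>
        (\<Union>n\<in>{1..L}. {x. 0 \<le> walk x n \<and> walk x n \<le> 0 + \<delta>}) \<union> (\<Union>n. {x. 0 \<le> walk x (Suc (n + L))})"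
      proof
        fix x assume x: "x \<in> {x. \<forall>n\<in>{1..L}. walk x n \<le> \<delta>}"
        show "x \<in> {x. \<forall>n\<ge>1. walk x n < 0} \<union>
          (\<Union>n\<in>{1..L}. {x. 0 \<le> walk x n \<and> walk x n \<le> 0 + \<delta>}) \<union> (\<Union>n. {x. 0 \<le> walk x (Suc (n + L))})"
        proof (cases "\<forall>n\<ge>1. walk x n < 0")
          case False
          then obtain n where n: "1 \<le> n" "0 \<le> walk x n" by (auto simp: not_less)
          show ?thesis
          proof (cases "n \<le> L")
            case True
            then show ?thesis using n x by auto
          next
            case False
            then have "n = Suc ((n - Suc L) + L)" by simp
            then show ?thesis using n by (metis (mono_tags, lifting) UN_I UNIV_I UnI2 mem_Collect_eq)
          qed
        qed simp
      qed
    qed (use sets_neg sets_int sets_le in auto)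
    also have "\<dots> \<le> measure S {x. \<forall>n\<ge>1. walk x n < 0} +
        measure S (\<Union>n\<in>{1..L}. {x. 0 \<le> walk x n \<and> walk x n \<le> 0 + \<delta>}) +
        measure S (\<Union>n. {x. 0 \<le> walk x (Suc (n + L))})"
      using sets_neg sets_int sets_le
      by (intro order_trans[OF measure_Un_le] add_right_mono measure_Un_le) auto
    also have "\<dots> \<le> stay_neg \<beta> + \<eta>" using small[of 0] far by (simp add: stay_neg_def)
    finally have A: "stay_below \<beta> L \<delta> \<le> stay_neg \<beta> + \<eta>" .
    have "stay_neg \<beta> \<le> measure S ({x. \<forall>n\<in>{1..L}. walk x n \<le> - \<delta>} \<union>
        (\<Union>n\<in>{1..L}. {x. - \<delta> \<le> walk x n \<and> walk x n \<le> - \<delta> + \<delta>}))"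
      unfolding stay_neg_def
    proof (intro P.finite_measure_mono)
      show "{x. \<forall>n\<ge>1. walk x n < 0} \<subseteq> {x. \<forall>n\<in>{1..L}. walk x n \<le> - \<delta>} \<union>
        (\<Union>n\<in>{1..L}. {x. - \<delta> \<le> walk x n \<and> walk x n \<le> - \<delta> + \<delta>})"
        by (auto simp: not_le) (metis atLeastAtMost_iff less_imp_le less_asym)
    qed (use sets_below sets_int in auto)
    also have "\<dots> \<le> measure S {x. \<forall>n\<in>{1..L}. walk x n \<le> - \<delta>} +
        measure S (\<Union>n\<in>{1..L}. {x. - \<delta> \<le> walk x n \<and> walk x n \<le> - \<delta> + \<delta>})"
      using sets_below sets_int by (intro measure_Un_le) auto
    also have "\<dots> \<le> stay_below \<beta> L (- \<delta>) + \<eta>"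
      using small[of "- \<delta>"] assms by (simp add: stay_below_def)
    finally show ?thesis using A by simp
  qed
  have "L\<^sub>0 \<le> L" by (simp add: L_def)
  then show thesis using that[OF _ d] 1 by blast
qed

section \<open>Independence of orthogonal Gaussian projections\<close>

abbreviation std_normal_vec :: "nat set \<Rightarrow> (nat \<Rightarrow> real) measure" where
  "std_normal_vec I \<equiv> \<Pi>\<^sub>M i\<in>I. std_normal_distribution"

interpretation std_normal: real_distribution std_normal_distribution
  by (rule real_dist_normal_dist)

interpretation std_normal_product: product_prob_space "\<lambda>_::nat. std_normal_distribution" I for I
  by unfold_locales

definition shift_vec :: "nat set \<Rightarrow> (nat \<Rightarrow> real) \<Rightarrow> (nat \<Rightarrow> real) \<Rightarrow> nat \<Rightarrow> real" where
  "shift_vec I a x = (\<lambda>l\<in>I. x l + a l)"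

lemma space_std_normal_vec: "space (std_normal_vec I) = (\<Pi>\<^sub>E i\<in>I. UNIV)"
  by (simp add: space_PiM)

lemma measurable_shift_vec [measurable]:
  "shift_vec I a \<in> measurable (std_normal_vec I) (std_normal_vec I)"
  unfolding shift_vec_def by measurable

lemma distr_std_normal_shift:
  "distr std_normal_distribution lborel (\<lambda>x. x + a) = density lborel (normal_density a 1)"
proof -
  have "distributed std_normal_distribution lborel (\<lambda>x. x) std_normal_density"
    by (auto simp: distributed_def intro!: distr_id2)
  then have "distributed std_normal_distribution lborel (\<lambda>x. a + 1 * x) (normal_density (a + 1 * 0) (\<bar>1\<bar> *
      1))"
    by (intro std_normal.normal_density_affine) auto
  then show ?thesis by (simp add: distributed_def add.commute)
qed

lemma density_std_normal_exp:
  "density std_normal_distribution (\<lambda>x. ennreal (exp (a * x - a\<^sup>2 / 2))) = density lborel (normal_density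
      a 1)"
proof -
  have "std_normal_density x * exp (a * x - a\<^sup>2 / 2) = normal_density a 1 x" for x
    by (simp add: normal_density_def exp_add[symmetric] power2_eq_square field_simps)
  then show ?thesis
    by (subst density_density_eq) (auto simp: ennreal_mult[symmetric] intro!: density_cong)
qed

text \<open>
  Both the shifted measure and the measure with the exponential density are the product of the
  normal laws with means \<open>a l\<close>; one coordinate at a time this is the identity of their
  densities.
\<close>

lemma Cameron_Martin:
  assumes I: "finite I" and f [measurable]: "f \<in> borel_measurable (std_normal_vec I)"
  shows "(\<integral>\<^sup>+x. f (shift_vec I a x) \<partial>std_normal_vec I) =
    (\<integral>\<^sup>+x. ennreal (exp ((\<Sum>l\<in>I. a l * x l) - (\<Sum>l\<in>I. (a l)\<^sup>2) / 2)) * f x \<partial>std_normal_vec I)"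
proof -
  let ?P = "std_normal_vec I"
  define g where "g = (\<lambda>x::nat \<Rightarrow> real. ennreal (exp ((\<Sum>l\<in>I. a l * x l) - (\<Sum>l\<in>I. (a l)\<^sup>2) / 2)))"
  have g_meas [measurable]: "g \<in> borel_measurable ?P" unfolding g_def by measurable
  define N where "N = (\<lambda>l. density lborel (normal_density (a l) 1))"
  have Nprob: "prob_space (N l)" for l unfolding N_def by (rule prob_space_normal_density) simp
  interpret N: product_prob_space N I
    using Nprob by (auto simp: product_prob_space_def product_prob_space_axioms_def product_sigma_finite_def
        prob_space_imp_sigma_finite)
  have setsN: "sets (PiM I N) = sets ?P" by (intro sets_PiM_cong) (auto simp: N_def)
  have 1: "distr ?P (PiM I N) (shift_vec I a) = PiM I N"
  proof (rule N.PiM_eqI)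
    fix A assume A: "\<And>i. i \<in> I \<Longrightarrow> A i \<in> sets (N i)"
    then have A': "A i \<in> sets borel" if "i \<in> I" for i using that by (simp add: N_def)
    have m: "shift_vec I a \<in> measurable ?P (PiM I N)"
      using measurable_shift_vec measurable_cong_sets[OF refl setsN] by metis
    have pre: "(\<lambda>x. x + a i) -` A i \<in> sets borel" if "i \<in> I" for i
      using measurable_sets[of "\<lambda>x. x + a i" borel borel "A i"] A'[OF that] by simp
    have "emeasure (distr ?P (PiM I N) (shift_vec I a)) (Pi\<^sub>E I A) =
        emeasure ?P (shift_vec I a -` Pi\<^sub>E I A \<inter> space ?P)"
      using I A by (intro emeasure_distr[OF m]) auto
    also have "shift_vec I a -` Pi\<^sub>E I A \<inter> space ?P = (\<Pi>\<^sub>E i\<in>I. (\<lambda>x. x + a i) -` A i)"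
      by (auto simp: space_std_normal_vec shift_vec_def PiE_iff)
    also have "emeasure ?P \<dots> = (\<Prod>i\<in>I. emeasure std_normal_distribution ((\<lambda>x. x + a i) -` A i))"
      using pre I by (intro std_normal_product.emeasure_PiM) auto
    also have "\<dots> = (\<Prod>i\<in>I. emeasure (N i) (A i))"
    proof (rule prod.cong)
      fix i assume i: "i \<in> I"
      have "emeasure (N i) (A i) = emeasure std_normal_distribution ((\<lambda>x. x + a i) -` A i \<inter> space
          std_normal_distribution)"
        unfolding N_def distr_std_normal_shift[of "a i", symmetric] using A'[OF i] by (intro
            emeasure_distr) auto
      then show "emeasure std_normal_distribution ((\<lambda>x. x + a i) -` A i) = emeasure (N i) (A i)" by simp
    qed simp
    finally show "emeasure (distr ?P (PiM I N) (shift_vec I a)) (Pi\<^sub>E I A) = (\<Prod>i\<in>I. emeasure (N i) (A i))" .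
  qed (use I in auto)
  have 2: "density ?P g = PiM I N"
  proof (rule N.PiM_eqI)
    show "sets (density ?P g) = sets (PiM I N)" by (simp add: setsN)
    fix A assume A: "\<And>i. i \<in> I \<Longrightarrow> A i \<in> sets (N i)"
    then have A': "A i \<in> sets borel" if "i \<in> I" for i using that by (simp add: N_def)
    have "Pi\<^sub>E I A \<in> sets ?P" using I A' by (intro sets_PiM_I_finite) auto
    then have "emeasure (density ?P g) (Pi\<^sub>E I A) = (\<integral>\<^sup>+x. g x * indicator (Pi\<^sub>E I A) x \<partial>?P)"
      by (intro emeasure_density) auto
    also have "\<dots> = (\<integral>\<^sup>+x. (\<Prod>i\<in>I. ennreal (exp (a i * x i - (a i)\<^sup>2 / 2)) * indicator (A i) (x i)) \<partial>?P)"
    proof (rule nn_integral_cong)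
      fix x assume x: "x \<in> space ?P"
      have "g x = (\<Prod>i\<in>I. ennreal (exp (a i * x i - (a i)\<^sup>2 / 2)))"
        unfolding g_def using I
        by (simp add: prod_ennreal exp_sum[symmetric] sum_subtractf sum_divide_distrib)
      moreover have "(indicator (Pi\<^sub>E I A) x :: ennreal) = (\<Prod>i\<in>I. indicator (A i) (x i))"
      proof (cases "x \<in> Pi\<^sub>E I A")
        case True
        then show ?thesis by (auto simp: PiE_iff)
      next
        case False
        then obtain i where "i \<in> I" "x i \<notin> A i" using x by (auto simp: space_std_normal_vec PiE_iff)
        then have "(\<Prod>i\<in>I. indicator (A i) (x i) :: ennreal) = 0"
          using I by (intro prod_zero) (auto intro!: bexI[of _ i])
        then show ?thesis using False by simp
      qed
      ultimately show "g x * indicator (Pi\<^sub>E I A) x =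
          (\<Prod>i\<in>I. ennreal (exp (a i * x i - (a i)\<^sup>2 / 2)) * indicator (A i) (x i))"
        by (simp add: prod.distrib)
    qed
    also have "\<dots> = (\<Prod>i\<in>I. \<integral>\<^sup>+t. ennreal (exp (a i * t - (a i)\<^sup>2 / 2)) * indicator (A i) t
        \<partial>std_normal_distribution)"
      using I A' by (intro std_normal_product.product_nn_integral_prod) auto
    also have "\<dots> = (\<Prod>i\<in>I. emeasure (N i) (A i))"
    proof (rule prod.cong)
      fix i assume i: "i \<in> I"
      show "(\<integral>\<^sup>+t. ennreal (exp (a i * t - (a i)\<^sup>2 / 2)) * indicator (A i) t \<partial>std_normal_distribution) =
          emeasure (N i) (A i)"
        unfolding N_def density_std_normal_exp[of "a i", symmetric] using A'[OF i]
        by (intro emeasure_density[symmetric]) auto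
    qed simp
    finally show "emeasure (density ?P g) (Pi\<^sub>E I A) = (\<Prod>i\<in>I. emeasure (N i) (A i))" .
  qed (use I in auto)
  have fN: "f \<in> borel_measurable (PiM I N)"
    using f measurable_cong_sets[OF setsN refl] by metis
  have m: "shift_vec I a \<in> measurable ?P (PiM I N)"
    using measurable_shift_vec measurable_cong_sets[OF refl setsN] by metis
  have "(\<integral>\<^sup>+x. f (shift_vec I a x) \<partial>?P) = (\<integral>\<^sup>+x. f x \<partial>distr ?P (PiM I N) (shift_vec I a))"
    using fN by (intro nn_integral_distr[symmetric] m) auto
  also have "\<dots> = (\<integral>\<^sup>+x. f x \<partial>density ?P g)" by (simp only: 1 2)
  also have "\<dots> = (\<integral>\<^sup>+x. g x * f x \<partial>?P)" by (rule nn_integral_density) auto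
  finally show ?thesis unfolding g_def .
qed

text \<open>
  An event that does not change under shifts along the unit vector \<open>v\<close> is independent of the
  projection \<open>Z\<close> to \<open>v\<close>. With \<open>h = \<phi> 1\<^sub>B\<close>, integrate \<open>1\<^sub>A(x) h(Z x + s)\<close> over \<open>x\<close> and over
  Lebesgue measure in \<open>s\<close>. Integrating over \<open>s\<close> first gives the product of the probabilities.
  Integrating over \<open>x\<close> first and shifting by \<open>s v\<close> introduces the factor \<open>exp (s Z - s\<^sup>2 / 2)\<close>,
  and \<open>\<phi>(Z)\<close> times this factor is the normal density in \<open>s\<close> with mean \<open>Z\<close>, which integrates to
  \<open>1\<close>; what is left is the probability of the intersection.
\<close>

lemma shift_invariant_indep:
  assumes I: "finite I" and v: "(\<Sum>l\<in>I. (v l)\<^sup>2) = 1"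
    and A [measurable]: "A \<in> sets (std_normal_vec I)" and B [measurable]: "B \<in> sets borel"
    and inv: "\<And>s x. x \<in> space (std_normal_vec I) \<Longrightarrow> shift_vec I (\<lambda>l. s * v l) x \<in> A \<longleftrightarrow> x \<in> A"
  shows "emeasure (std_normal_vec I) {x \<in> space (std_normal_vec I). (\<Sum>l\<in>I. v l * x l) \<in> B \<and> x \<in> A}
    = emeasure std_normal_distribution B * emeasure (std_normal_vec I) A"
proof -
  let ?P = "std_normal_vec I"
  define Z where "Z = (\<lambda>x::nat \<Rightarrow> real. \<Sum>l\<in>I. v l * x l)"
  have Z [measurable]: "Z \<in> borel_measurable ?P" unfolding Z_def by measurable
  define h where "h = (\<lambda>z. ennreal (std_normal_density z) * indicator B z)"
  have h [measurable]: "h \<in> borel_measurable borel" unfolding h_def by measurable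
  interpret PL: pair_sigma_finite ?P lborel
    by (intro pair_sigma_finite.intro std_normal_product.sigma_finite_measure_axioms
        lborel.sigma_finite_measure_axioms
        prob_space_imp_sigma_finite prob_space_PiM std_normal.prob_space_axioms)
  have Zs: "Z (shift_vec I (\<lambda>l. s * v l) x) = Z x + s" for s x
  proof -
    have "Z (shift_vec I (\<lambda>l. s * v l) x) = (\<Sum>l\<in>I. v l * x l + s * (v l)\<^sup>2)"
      unfolding Z_def by (intro sum.cong) (auto simp: shift_vec_def algebra_simps power2_eq_square)
    then show ?thesis using v by (simp add: sum.distrib sum_distrib_left[symmetric] Z_def)
  qed
  have "emeasure std_normal_distribution B * emeasure ?P A = (\<integral>\<^sup>+x. indicator A x * emeasure
      std_normal_distribution B \<partial>?P)"
    by (simp add: nn_integral_multc mult.commute)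
  also have "\<dots> = (\<integral>\<^sup>+x. (\<integral>\<^sup>+s. indicator A x * h (Z x + s) \<partial>lborel) \<partial>?P)"
  proof (intro nn_integral_cong)
    fix x
    have "emeasure std_normal_distribution B = (\<integral>\<^sup>+s. h s \<partial>lborel)"
      unfolding h_def by (rule emeasure_density) auto
    also have "\<dots> = (\<integral>\<^sup>+s. h (Z x + s) \<partial>lborel)"
      using nn_integral_real_affine[of h 1 "Z x"] by simp
    finally show "indicator A x * emeasure std_normal_distribution B = (\<integral>\<^sup>+s. indicator A x * h (Z x + s)
        \<partial>lborel)"
      by (simp add: nn_integral_cmult)
  qed
  also have "\<dots> = (\<integral>\<^sup>+s. (\<integral>\<^sup>+x. indicator A x * h (Z x + s) \<partial>?P) \<partial>lborel)"
    by (rule PL.Fubini'[symmetric]) measurable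
  also have "\<dots> = (\<integral>\<^sup>+s. (\<integral>\<^sup>+x. ennreal (exp (s * Z x - s\<^sup>2 / 2)) * (indicator A x * h (Z x)) \<partial>?P) \<partial>lborel)"
  proof (rule nn_integral_cong)
    fix s
    define a where "a = (\<lambda>l. s * v l)"
    have "(\<integral>\<^sup>+x. indicator A x * h (Z x + s) \<partial>?P) =
        (\<integral>\<^sup>+x. indicator A (shift_vec I a x) * h (Z (shift_vec I a x)) \<partial>?P)"
      using inv unfolding a_def by (intro nn_integral_cong) (auto simp: Zs indicator_def)
    also have "\<dots> = (\<integral>\<^sup>+x. ennreal (exp ((\<Sum>l\<in>I. a l * x l) - (\<Sum>l\<in>I. (a l)\<^sup>2) / 2)) * (indicator A x * h (Z
        x)) \<partial>?P)"
      by (rule Cameron_Martin[OF I]) measurable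
    also have "(\<Sum>l\<in>I. (a l)\<^sup>2) = s\<^sup>2"
      using v unfolding a_def power_mult_distrib sum_distrib_left[symmetric] by simp
    also have "(\<lambda>x. \<Sum>l\<in>I. a l * x l) = (\<lambda>x. s * Z x)"
      by (simp add: a_def Z_def sum_distrib_left mult.assoc)
    finally show "(\<integral>\<^sup>+x. indicator A x * h (Z x + s) \<partial>?P) =
        (\<integral>\<^sup>+x. ennreal (exp (s * Z x - s\<^sup>2 / 2)) * (indicator A x * h (Z x)) \<partial>?P)" .
  qed
  also have "\<dots> = (\<integral>\<^sup>+x. (\<integral>\<^sup>+s. ennreal (exp (s * Z x - s\<^sup>2 / 2)) * (indicator A x * h (Z x)) \<partial>lborel) \<partial>?P)"
    by (rule PL.Fubini') measurable
  also have "\<dots> = (\<integral>\<^sup>+x. indicator {x \<in> space ?P. Z x \<in> B \<and> x \<in> A} x \<partial>?P)"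
  proof (intro nn_integral_cong)
    fix x assume x: "x \<in> space ?P"
    have e: "ennreal (exp (s * z - s\<^sup>2 / 2)) * ennreal (std_normal_density z) = ennreal (normal_density z
        1 s)" for s z
      by (simp add: ennreal_mult[symmetric] normal_density_def exp_add[symmetric] power2_eq_square
          field_simps)
    have "(\<integral>\<^sup>+s. ennreal (exp (s * Z x - s\<^sup>2 / 2)) * (indicator A x * h (Z x)) \<partial>lborel)
      = (\<integral>\<^sup>+s. ennreal (normal_density (Z x) 1 s) * (indicator A x * indicator B (Z x)) \<partial>lborel)"
      unfolding h_def e[of _ "Z x", symmetric] by (simp add: mult_ac)
    also have "\<dots> = (\<integral>\<^sup>+s. ennreal (normal_density (Z x) 1 s) \<partial>lborel) * (indicator A x * indicator B (Z x))"
      by (rule nn_integral_multc) measurable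
    also have "(\<integral>\<^sup>+s. ennreal (normal_density (Z x) 1 s) \<partial>lborel) = 1"
      using prob_space.emeasure_space_1[OF prob_space_normal_density[of 1 "Z x"]] by (simp add:
          emeasure_density)
    also have "1 * (indicator A x * indicator B (Z x)) = (indicator {x \<in> space ?P. Z x \<in> B \<and> x \<in> A} x ::
        ennreal)"
      using x by (auto simp: indicator_def)
    finally show "(\<integral>\<^sup>+s. ennreal (exp (s * Z x - s\<^sup>2 / 2)) * (indicator A x * h (Z x)) \<partial>lborel)
      = indicator {x \<in> space ?P. Z x \<in> B \<and> x \<in> A} x" .
  qed
  also have "\<dots> = emeasure ?P {x \<in> space ?P. Z x \<in> B \<and> x \<in> A}"
    by (rule nn_integral_indicator) measurable
  finally show ?thesis by (simp add: Z_def)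
qed

section \<open>Linear forms in independent normal variables\<close>

text \<open>
  Vectors are functions on \<open>nat\<close> of which only the coordinates \<open>1, \<dots>, m\<close> count, so that the
  dimension can grow with the level \<open>b\<close>.
\<close>

definition ip :: "nat \<Rightarrow> (nat \<Rightarrow> real) \<Rightarrow> (nat \<Rightarrow> real) \<Rightarrow> real" where
  "ip m v w = (\<Sum>l=1..m. v l * w l)"

lemma ip_self_nonneg: "0 \<le> ip m v v"
  by (simp add: ip_def sum_nonneg)

lemma ip_add_diff: "ip m (\<lambda>l. v l + w l) (\<lambda>l. v l + w l) + ip m (\<lambda>l. v l - w l) (\<lambda>l. v l - w l) = 2 * ip m
    v v + 2 * ip m w w"
  unfolding ip_def sum.distrib[symmetric] sum_distrib_left by (intro sum.cong) (auto simp: algebra_simps)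

locale gaussian_steps = prob_space M for M :: "'a measure" +
  fixes \<xi> :: "nat \<Rightarrow> 'a \<Rightarrow> real" and m :: nat
  assumes m_pos: "0 < m"
    and indep: "indep_vars (\<lambda>_. borel) \<xi> {1..m}"
    and normal: "\<And>l. l \<in> {1..m} \<Longrightarrow> distributed M lborel (\<xi> l) std_normal_density"
begin

definition lin :: "(nat \<Rightarrow> real) \<Rightarrow> 'a \<Rightarrow> real" where
  "lin v \<omega> = (\<Sum>l=1..m. v l * \<xi> l \<omega>)"

lemma steps_measurable: "l \<in> {1..m} \<Longrightarrow> \<xi> l \<in> borel_measurable M"
  using normal by (auto simp: distributed_def)

lemma lin_measurable [measurable]: "lin v \<in> borel_measurable M"
  unfolding lin_def using steps_measurable by (intro borel_measurable_sum borel_measurable_times) auto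

lemma joint_law:
  "distr M (std_normal_vec {1..m}) (\<lambda>\<omega>. \<lambda>l\<in>{1..m}. \<xi> l \<omega>) = std_normal_vec {1..m}"
proof -
  have ne: "{1..m} \<noteq> {}" using m_pos by auto
  have "distr M (std_normal_vec {1..m}) (\<lambda>\<omega>. \<lambda>l\<in>{1..m}. \<xi> l \<omega>) =
      distr M (\<Pi>\<^sub>M l\<in>{1..m}. borel) (\<lambda>\<omega>. \<lambda>l\<in>{1..m}. \<xi> l \<omega>)"
    by (intro distr_cong sets_PiM_cong) auto
  also have "\<dots> = (\<Pi>\<^sub>M l\<in>{1..m}. distr M borel (\<xi> l))"
    using indep_vars_iff_distr_eq_PiM'[OF ne steps_measurable] indep by simp
  also have "\<dots> = std_normal_vec {1..m}"
  proof (rule PiM_cong)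
    fix l assume l: "l \<in> {1..m}"
    have "distr M borel (\<xi> l) = distr M lborel (\<xi> l)" by (intro distr_cong) auto
    then show "distr M borel (\<xi> l) = std_normal_distribution"
      using normal[OF l] by (simp add: distributed_def)
  qed simp
  finally show ?thesis .
qed

text \<open>
  Orthogonality to \<open>v\<close> makes the linear forms \<open>lin (w i)\<close> invariant under shifts along \<open>v\<close>.
\<close>

lemma lin_indep_orthogonal:
  assumes v: "ip m v v = 1" and F: "finite F" and w: "\<And>i. i \<in> F \<Longrightarrow> ip m (w i) v = 0"
    and B: "B \<in> sets borel"
  shows "prob {\<omega> \<in> space M. lin v \<omega> \<in> B \<and> (\<forall>i\<in>F. lin (w i) \<omega> \<le> t i)} =
    measure std_normal_distribution B * prob {\<omega> \<in> space M. \<forall>i\<in>F. lin (w i) \<omega> \<le> t i}"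
proof -
  let ?I = "{1..m}"
  let ?P = "std_normal_vec ?I"
  define X where "X = (\<lambda>\<omega>. \<lambda>l\<in>?I. \<xi> l \<omega>)"
  define A where "A = {x \<in> space ?P. \<forall>i\<in>F. (\<Sum>l\<in>?I. w i l * x l) \<le> t i}"
  have sum_meas: "(\<lambda>x. \<Sum>l\<in>?I. u l * x l) \<in> borel_measurable ?P" for u :: "nat \<Rightarrow> real" by measurable
  have X: "X \<in> measurable M ?P"
    unfolding X_def using steps_measurable by (intro measurable_restrict) auto
  have A: "A \<in> sets ?P" unfolding A_def using F sum_meas
    by (intro sets.sets_Collect_finite_All borel_measurable_le) auto
  have inv: "shift_vec ?I (\<lambda>l. s * v l) x \<in> A \<longleftrightarrow> x \<in> A" if x: "x \<in> space ?P" for s x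
  proof -
    have "(\<Sum>l\<in>?I. w i l * shift_vec ?I (\<lambda>l. s * v l) x l) = (\<Sum>l\<in>?I. w i l * x l)" if "i \<in> F" for i
    proof -
      have "(\<Sum>l\<in>?I. w i l * shift_vec ?I (\<lambda>l. s * v l) x l) = (\<Sum>l\<in>?I. w i l * x l + s * (w i l * v l))"
        by (intro sum.cong) (auto simp: shift_vec_def algebra_simps)
      also have "\<dots> = (\<Sum>l\<in>?I. w i l * x l) + s * ip m (w i) v"
        by (simp add: sum.distrib sum_distrib_left ip_def)
      finally show ?thesis using w[OF that] by simp
    qed
    moreover have "shift_vec ?I (\<lambda>l. s * v l) x \<in> space ?P" by (simp add: space_std_normal_vec shift_vec_def)
    ultimately show ?thesis using x by (auto simp: A_def)
  qed
  have linX: "(\<Sum>l\<in>?I. u l * X \<omega> l) = lin u \<omega>" for u \<omega>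
    by (simp add: lin_def X_def)
  have C: "{x \<in> space ?P. (\<Sum>l\<in>?I. v l * x l) \<in> B \<and> x \<in> A} \<in> sets ?P"
  proof -
    have "{x \<in> space ?P. (\<Sum>l\<in>?I. v l * x l) \<in> B \<and> x \<in> A} =
      ((\<lambda>x. \<Sum>l\<in>?I. v l * x l) -` B \<inter> space ?P) \<inter> A"
      using sets.sets_into_space[OF A] by auto
    then show ?thesis using A measurable_sets[OF sum_meas B] by auto
  qed
  have sp: "X \<omega> \<in> space ?P" for \<omega> by (simp add: space_std_normal_vec X_def)
  have "emeasure M (X -` {x \<in> space ?P. (\<Sum>l\<in>?I. v l * x l) \<in> B \<and> x \<in> A} \<inter> space M) =
      emeasure std_normal_distribution B * emeasure M (X -` A \<inter> space M)"
  proof -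
    have "emeasure M (X -` {x \<in> space ?P. (\<Sum>l\<in>?I. v l * x l) \<in> B \<and> x \<in> A} \<inter> space M) =
        emeasure (distr M ?P X) {x \<in> space ?P. (\<Sum>l\<in>?I. v l * x l) \<in> B \<and> x \<in> A}"
      by (rule emeasure_distr[symmetric, OF X C])
    also have "\<dots> = emeasure std_normal_distribution B * emeasure ?P A"
      unfolding X_def joint_law using v inv
      by (intro shift_invariant_indep A B) (auto simp: ip_def power2_eq_square)
    also have "emeasure ?P A = emeasure (distr M ?P X) A" unfolding X_def joint_law ..
    also have "\<dots> = emeasure M (X -` A \<inter> space M)" by (rule emeasure_distr[OF X A])
    finally show ?thesis .
  qed
  moreover have "X -` {x \<in> space ?P. (\<Sum>l\<in>?I. v l * x l) \<in> B \<and> x \<in> A} \<inter> space M =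
      {\<omega> \<in> space M. lin v \<omega> \<in> B \<and> (\<forall>i\<in>F. lin (w i) \<omega> \<le> t i)}"
    using sp by (auto simp: A_def linX[unfolded One_nat_def])
  moreover have "X -` A \<inter> space M = {\<omega> \<in> space M. \<forall>i\<in>F. lin (w i) \<omega> \<le> t i}"
    using sp by (auto simp: A_def linX[unfolded One_nat_def])
  ultimately show ?thesis
    by (simp add: emeasure_eq_measure std_normal.emeasure_eq_measure ennreal_mult[symmetric])
qed

lemma distributed_lin:
  assumes "0 < ip m v v"
  shows "distributed M lborel (lin v) (normal_density 0 (sqrt (ip m v v)))"
proof -
  define J where "J = {l \<in> {1..m}. v l \<noteq> 0}"
  have J: "finite J" "J \<subseteq> {1..m}" by (auto simp: J_def)
  have ipJ: "ip m v v = (\<Sum>l\<in>J. (v l)\<^sup>2)"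
    unfolding ip_def power2_eq_square by (rule sum.mono_neutral_right) (auto simp: J_def)
  then have "J \<noteq> {}" using assms by auto
  have "indep_vars (\<lambda>_. borel) (\<lambda>l \<omega>. v l * \<xi> l \<omega>) J"
    by (rule indep_vars_compose2[OF indep_vars_subset[OF indep J(2)], of "\<lambda>l x. v l * x"]) auto
  moreover have "distributed M lborel (\<lambda>\<omega>. v l * \<xi> l \<omega>) (normal_density 0 \<bar>v l\<bar>)" if "l \<in> J" for l
    using normal_density_affine[OF normal, of l "v l" 0] that J by (auto simp: J_def)
  ultimately have "distributed M lborel (\<lambda>\<omega>. \<Sum>l\<in>J. v l * \<xi> l \<omega>) (normal_density (\<Sum>l\<in>J. 0) (sqrt (\<Sum>l\<in>J. \<bar>v
      l\<bar>\<^sup>2)))"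
    using J \<open>J \<noteq> {}\<close> by (intro sum_indep_normal) (auto simp: J_def)
  moreover have "(\<lambda>\<omega>. \<Sum>l\<in>J. v l * \<xi> l \<omega>) = lin v"
    unfolding lin_def by (intro ext sum.mono_neutral_left) (auto simp: J_def)
  ultimately show ?thesis by (simp add: ipJ)
qed

lemma prob_lin_ge:
  assumes "0 < ip m v v"
  shows "prob {\<omega> \<in> space M. x \<le> lin v \<omega>} = normal_tail (x / sqrt (ip m v v))"
  using prob_normal_ge[OF distributed_lin[OF assms], of x] assms by simp

lemma ip_zero_imp_lin_zero:
  assumes "ip m v v = 0"
  shows "lin v \<omega> = 0"
proof -
  have "\<forall>l\<in>{1..m}. v l * v l = 0"
    using assms unfolding ip_def by (subst (asm) sum_nonneg_eq_0_iff) auto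
  then show ?thesis by (auto simp: lin_def intro!: sum.neutral)
qed

lemma std_normal_density_le_1: "std_normal_density x \<le> 1"
  using normal_density_le[of 1 0 x] by simp

text \<open>
  A crude bound that also covers the degenerate form: \<open>\<phi>(x) / x \<le> 1 / x\<close> with
  \<open>x = \<delta> / sqrt (ip m v v)\<close>.
\<close>

lemma prob_lin_ge_le:
  assumes "0 < \<delta>"
  shows "prob {\<omega> \<in> space M. \<delta> \<le> lin v \<omega>} \<le> sqrt (ip m v v) / \<delta>"
proof (cases "ip m v v = 0")
  case True
  then show ?thesis using assms ip_zero_imp_lin_zero[OF True] by simp
next
  case False
  then have pos: "0 < ip m v v" using ip_self_nonneg[of m v] by simp
  define x where "x = \<delta> / sqrt (ip m v v)"
  have x: "0 < x" using assms pos by (simp add: x_def)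
  have "normal_tail x \<le> std_normal_density x / x" by (rule normal_tail_bounds(1)[OF x])
  also have "\<dots> \<le> 1 / x" using x std_normal_density_le_1 by (intro divide_right_mono) auto
  finally show ?thesis using prob_lin_ge[OF pos, of \<delta>] by (simp add: x_def)
qed

lemma lin_add: "lin (\<lambda>l. v l + w l) \<omega> = lin v \<omega> + lin w \<omega>"
  by (simp add: lin_def sum.distrib algebra_simps)

lemma lin_scale: "lin (\<lambda>l. c * v l) \<omega> = c * lin v \<omega>"
  by (simp add: lin_def sum_distrib_left mult_ac)

lemma lin_diff: "lin (\<lambda>l. v l - w l) \<omega> = lin v \<omega> - lin w \<omega>"
  by (simp add: lin_def sum_subtractf algebra_simps)

text \<open>
  Both forms exceed \<open>b\<close> only if their sum exceeds \<open>2 b\<close>, and the variance of the sum is \<open>4 - D\<close>,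
  where \<open>D\<close> is the squared distance of the two unit vectors. The factor \<open>1 / b\<close> of the Gaussian
  tail is kept, so that the bound is a small multiple of \<open>normal_tail b\<close> as soon as \<open>b\<^sup>2 D\<close> is
  large.
\<close>

lemma prob_both_ge_le:
  assumes v: "ip m v v = 1" and w: "ip m w w = 1" and b: "0 < b"
  shows "prob {\<omega> \<in> space M. b \<le> lin v \<omega> \<and> b \<le> lin w \<omega>}
    \<le> std_normal_density b / b * exp (- (b\<^sup>2 * ip m (\<lambda>l. v l - w l) (\<lambda>l. v l - w l) / 8))"
proof -
  define D where "D = ip m (\<lambda>l. v l - w l) (\<lambda>l. v l - w l)"
  define u where "u = (\<lambda>l. v l + w l)"
  have D0: "0 \<le> D" unfolding D_def by (rule ip_self_nonneg)
  have uD: "ip m u u = 4 - D" using ip_add_diff[of m v w] v w by (simp add: u_def D_def)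
  have linu: "lin u \<omega> = lin v \<omega> + lin w \<omega>" for \<omega> unfolding u_def by (rule lin_add)
  have rhs: "0 \<le> std_normal_density b / b * exp (- (b\<^sup>2 * D / 8))" using b by simp
  have "prob {\<omega> \<in> space M. b \<le> lin v \<omega> \<and> b \<le> lin w \<omega>} \<le> prob {\<omega> \<in> space M. 2 * b \<le> lin u \<omega>}"
    by (intro finite_measure_mono) (auto simp: linu)
  also have "\<dots> \<le> std_normal_density b / b * exp (- (b\<^sup>2 * D / 8))"
  proof (cases "ip m u u = 0")
    case True
    then have "{\<omega> \<in> space M. 2 * b \<le> lin u \<omega>} = {}" using b ip_zero_imp_lin_zero[OF True] by auto
    then show ?thesis using rhs by (simp only: measure_empty)
  next
    case False
    then have pos: "0 < 4 - D" using ip_self_nonneg[of m u] uD by simp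
    \<comment> \<open>the threshold \<open>2 b\<close> in units of the standard deviation of the sum\<close>
    define x where "x = 2 * b / sqrt (4 - D)"
    have "sqrt (4 - D) \<le> sqrt 4" using D0 by (intro real_sqrt_le_mono) simp
    then have s2: "sqrt (4 - D) \<le> 2" by simp
    have bx: "b \<le> x" using pos b s2 by (simp add: x_def le_divide_eq)
    have x2: "x\<^sup>2 = 4 * b\<^sup>2 / (4 - D)" using pos by (simp add: x_def power_mult_distrib power_divide)
    have "b\<^sup>2 * (1 + D / 4) * (4 - D) \<le> 4 * b\<^sup>2"
    proof -
      have "(1 + D / 4) * (4 - D) \<le> 4" using D0 by (simp add: algebra_simps)
      then have "b\<^sup>2 * ((1 + D / 4) * (4 - D)) \<le> b\<^sup>2 * 4" by (rule mult_left_mono) simp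
      then show ?thesis by (simp add: mult_ac)
    qed
    then have "b\<^sup>2 * (1 + D / 4) \<le> x\<^sup>2" unfolding x2 using pos by (simp add: le_divide_eq)
    then have ex: "- x\<^sup>2 / 2 \<le> - b\<^sup>2 / 2 + - (b\<^sup>2 * D / 8)" by (simp add: algebra_simps)
    have "prob {\<omega> \<in> space M. 2 * b \<le> lin u \<omega>} = normal_tail x"
      using prob_lin_ge[of u "2 * b"] pos uD by (simp add: x_def)
    also have "\<dots> \<le> std_normal_density x / x" using bx b by (intro normal_tail_bounds) auto
    also have "\<dots> \<le> std_normal_density x / b" using bx b by (intro divide_left_mono) auto
    also have "\<dots> \<le> std_normal_density b * exp (- (b\<^sup>2 * D / 8)) / b"
    proof (rule divide_right_mono)
      have "exp (- x\<^sup>2 / 2) \<le> exp (- b\<^sup>2 / 2) * exp (- (b\<^sup>2 * D / 8))"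
        unfolding exp_add[symmetric] using ex by simp
      then have "1 / sqrt (2 * pi) * exp (- x\<^sup>2 / 2) \<le> 1 / sqrt (2 * pi) * (exp (- b\<^sup>2 / 2) * exp (- (b\<^sup>2
          * D / 8)))"
        by (rule mult_left_mono) simp
      then show "std_normal_density x \<le> std_normal_density b * exp (- (b\<^sup>2 * D / 8))"
        by (simp add: std_normal_density_def mult.assoc)
    qed (use b in simp)
    finally show ?thesis by simp
  qed
  finally show ?thesis by (simp add: D_def)
qed

end

section \<open>Geometry of the contrast vectors\<close>

lemma ip_lin:
  "ip m (\<lambda>l. x l + y l) z = ip m x z + ip m y z"
  "ip m z (\<lambda>l. x l + y l) = ip m z x + ip m z y"
  "ip m (\<lambda>l. x l - y l) z = ip m x z - ip m y z"
  "ip m z (\<lambda>l. x l - y l) = ip m z x - ip m z y"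
  "ip m (\<lambda>l. c * x l) z = c * ip m x z"
  "ip m z (\<lambda>l. c * x l) = c * ip m z x"
  by (simp_all add: ip_def sum.distrib sum_subtractf sum_distrib_left algebra_simps)

lemma ip_commute: "ip m x y = ip m y x"
  by (simp add: ip_def mult.commute)

lemma ip_ge_card:
  assumes "S \<subseteq> {1..m}" "\<And>l. l \<in> S \<Longrightarrow> g \<le> (x l)\<^sup>2"
  shows "real (card S) * g \<le> ip m x x"
proof -
  have "real (card S) * g \<le> (\<Sum>l\<in>S. (x l)\<^sup>2)"
    using assms(2) by (intro sum_bounded_below)
  also have "\<dots> \<le> (\<Sum>l=1..m. (x l)\<^sup>2)" using assms(1) by (intro sum_mono2) auto
  finally show ?thesis by (simp add: ip_def power2_eq_square)
qed

text \<open>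
  The statistic \<open>Z\<^sub>0\<^sub>,\<^sub>j\<^sub>,\<^sub>k\<close> is the linear form with coefficients \<open>level1 j k\<close> on \<open>1, \<dots>, j\<close> and
  \<open>- level2 j k\<close> on \<open>j + 1, \<dots>, k\<close>.
\<close>

definition level1 :: "nat \<Rightarrow> nat \<Rightarrow> real" where
  "level1 j k = sqrt ((real k - real j) / (real j * real k))"

definition level2 :: "nat \<Rightarrow> nat \<Rightarrow> real" where
  "level2 j k = sqrt (real j / (real k * (real k - real j)))"

text \<open>
  The two levels are kept apart from the two change points, so that the change points can be
  moved while the levels stay fixed.
\<close>

definition two_level :: "real \<Rightarrow> real \<Rightarrow> nat \<Rightarrow> nat \<Rightarrow> nat \<Rightarrow> real" where
  "two_level a c j k l = (a + c) * of_bool (l \<le> j) - c * of_bool (l \<le> k)"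

definition contrast :: "nat \<Rightarrow> nat \<Rightarrow> nat \<Rightarrow> real" where
  "contrast j k = two_level (level1 j k) (level2 j k) j k"

lemma levels_sq:
  assumes "0 < j" "j < k"
  shows "(level1 j k)\<^sup>2 = 1 / real j - 1 / real k"
    and "(level2 j k)\<^sup>2 = 1 / (real k - real j) - 1 / real k"
    and "0 < level1 j k" "0 < level2 j k"
  using assms by (auto simp: level1_def level2_def divide_simps)

lemma levels_sum:
  assumes "0 < j" "j < k"
  shows "level1 j k + level2 j k = sqrt (real k / (real j * (real k - real j)))"
    and "level1 j k * real j = level2 j k * (real k - real j)"
proof -
  define s where "s = sqrt (real j * real k * (real k - real j))"
  have pos: "0 < real j" "0 < real k" "0 < real k - real j" using assms by auto
  have s: "0 < s" "s * s = real j * real k * (real k - real j)" using pos by (auto simp: s_def)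
  have 1: "level1 j k = (real k - real j) / s"
    unfolding level1_def using pos s
    by (intro real_sqrt_unique) (auto simp: power2_eq_square divide_simps)
  have 2: "level2 j k = real j / s"
    unfolding level2_def using pos s
    by (intro real_sqrt_unique) (auto simp: power2_eq_square divide_simps)
  have 3: "sqrt (real k / (real j * (real k - real j))) = real k / s"
    using pos s by (intro real_sqrt_unique) (auto simp: power2_eq_square divide_simps)
  show "level1 j k + level2 j k = sqrt (real k / (real j * (real k - real j)))"
    unfolding 1 2 3 by (simp add: add_divide_distrib[symmetric])
  show "level1 j k * real j = level2 j k * (real k - real j)" unfolding 1 2 by simp
qed

lemma two_level_cases:
  "l \<le> j \<Longrightarrow> j \<le> k \<Longrightarrow> two_level a c j k l = a"
  "j < l \<Longrightarrow> l \<le> k \<Longrightarrow> two_level a c j k l = - c"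
  "j < l \<Longrightarrow> k < l \<Longrightarrow> two_level a c j k l = 0"
  by (auto simp: two_level_def)

lemma sum_of_bool_le:
  fixes f :: "nat \<Rightarrow> real"
  assumes "j \<le> m"
  shows "(\<Sum>l=1..m. of_bool (l \<le> j) * f l :: real) = (\<Sum>l=1..j. f l)"
  using assms by (intro sum.mono_neutral_cong_right) auto

lemma ip_contrast_self:
  assumes "0 < j" "j < k" "k \<le> m"
  shows "ip m (contrast j k) (contrast j k) = 1"
proof -
  define a where "a = level1 j k"
  define c where "c = level2 j k"
  have sq: "contrast j k l * contrast j k l = of_bool (l \<le> j) * (a\<^sup>2 - c\<^sup>2) + of_bool (l \<le> k) * c\<^sup>2" for l
    using assms by (auto simp: contrast_def two_level_def a_def c_def power2_eq_square algebra_simps)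
  have "ip m (contrast j k) (contrast j k) = real j * (a\<^sup>2 - c\<^sup>2) + real k * c\<^sup>2"
    unfolding ip_def sq sum.distrib using assms by (subst sum_of_bool_le, simp)+ simp
  also have "\<dots> = 1"
    unfolding a_def c_def levels_sq[OF assms(1,2)] using assms by (simp add: divide_simps) (simp add:
        algebra_simps)
  finally show ?thesis .
qed

text \<open>
  The pairs with all three gaps \<open>j\<close>, \<open>k - j\<close>, \<open>m - k\<close> of order \<open>b\<^sup>2\<close>. If \<open>m \<le> K b\<^sup>2\<close>, both jumps
  of the contrast vector of such a pair are of order \<open>1 / b\<close>.
\<close>

definition inner_pairs :: "real \<Rightarrow> real \<Rightarrow> nat \<Rightarrow> (nat \<times> nat) set" where
  "inner_pairs \<epsilon> b m = {(j, k). \<epsilon> * b\<^sup>2 \<le> real j \<and> \<epsilon> * b\<^sup>2 \<le> real k - real j \<and> real k \<le> real m - \<epsilon> * b\<^sup>2}"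

locale scale =
  fixes \<epsilon> K b :: real and m :: nat
  assumes eps: "0 < \<epsilon>" and K: "0 < K" and b: "0 < b" and m_le: "real m \<le> K * b\<^sup>2"
begin

lemma inner_pairs_D:
  assumes "(j, k) \<in> inner_pairs \<epsilon> b m"
  shows "0 < j" "j < k" "k < m" "\<epsilon> * b\<^sup>2 \<le> real j" "\<epsilon> * b\<^sup>2 \<le> real k - real j"
    "real k \<le> K * b\<^sup>2" "\<epsilon> * b\<^sup>2 \<le> real m - real k"
proof -
  have p: "0 < \<epsilon> * b\<^sup>2" using eps b by simp
  show 1: "\<epsilon> * b\<^sup>2 \<le> real j" "\<epsilon> * b\<^sup>2 \<le> real k - real j" "\<epsilon> * b\<^sup>2 \<le> real m - real k"
    using assms by (auto simp: inner_pairs_def)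
  then have "0 < real j" "real j < real k" "real k < real m" using p by linarith+
  then show "0 < j" "j < k" "k < m" by auto
  show "real k \<le> K * b\<^sup>2" using 1 p m_le by linarith
qed

lemma levels_ge:
  assumes "(j, k) \<in> inner_pairs \<epsilon> b m"
  shows "\<epsilon> / (K\<^sup>2 * b\<^sup>2) \<le> (level1 j k)\<^sup>2" "\<epsilon> / (K\<^sup>2 * b\<^sup>2) \<le> (level2 j k)\<^sup>2"
proof -
  note D = inner_pairs_D[OF assms]
  have pos: "0 < real j" "0 < real k" "0 < real k - real j" using D by auto
  have le: "real j \<le> K * b\<^sup>2" "real k - real j \<le> K * b\<^sup>2" using D pos by linarith+
  have eq: "\<epsilon> / (K\<^sup>2 * b\<^sup>2) = \<epsilon> * b\<^sup>2 / ((K * b\<^sup>2) * (K * b\<^sup>2))"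
    using b K by (simp add: power2_eq_square)
  have p: "0 < \<epsilon> * b\<^sup>2" "0 < K * b\<^sup>2" using eps K b by auto
  have "(level1 j k)\<^sup>2 = (real k - real j) / (real j * real k)"
    using pos D by (simp add: levels_sq divide_simps)
  moreover have "\<epsilon> * b\<^sup>2 / ((K * b\<^sup>2) * (K * b\<^sup>2)) \<le> (real k - real j) / (real j * real k)"
    using D pos le p by (intro frac_le mult_mono) auto
  ultimately show "\<epsilon> / (K\<^sup>2 * b\<^sup>2) \<le> (level1 j k)\<^sup>2" using eq by simp
  have "(level2 j k)\<^sup>2 = real j / (real k * (real k - real j))"
    using pos D by (simp add: levels_sq divide_simps)
  moreover have "\<epsilon> * b\<^sup>2 / ((K * b\<^sup>2) * (K * b\<^sup>2)) \<le> real j / (real k * (real k - real j))"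
    using D pos le p by (intro frac_le mult_mono) auto
  ultimately show "\<epsilon> / (K\<^sup>2 * b\<^sup>2) \<le> (level2 j k)\<^sup>2" using eq by simp
qed

text \<open>
  On the coordinates between \<open>j\<close> and \<open>j'\<close> one vector has its positive level and the other does
  not; on those between \<open>k\<close> and \<open>k'\<close> one of the vectors vanishes and the other does not.
\<close>

lemma ip_diff_ge_aux:
  assumes p: "(j, k) \<in> inner_pairs \<epsilon> b m" and p': "(j', k') \<in> inner_pairs \<epsilon> b m"
  defines "D \<equiv> ip m (\<lambda>l. contrast j k l - contrast j' k' l) (\<lambda>l. contrast j k l - contrast j' k' l)"
  shows "j \<le> j' \<Longrightarrow> (real j' - real j) * (\<epsilon> / (K\<^sup>2 * b\<^sup>2)) \<le> D"
    and "k \<le> k' \<Longrightarrow> (real k' - real k) * (\<epsilon> / (K\<^sup>2 * b\<^sup>2)) \<le> D"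
proof -
  note d = inner_pairs_D[OF p] and d' = inner_pairs_D[OF p']
  note g = levels_ge[OF p] and g' = levels_ge[OF p']
  have pos: "0 < level1 j k" "0 < level2 j k" "0 < level1 j' k'" "0 < level2 j' k'"
    using d d' levels_sq by auto
  show "(real j' - real j) * (\<epsilon> / (K\<^sup>2 * b\<^sup>2)) \<le> D" if "j \<le> j'"
  proof -
    have "real (card {j<..j'}) * (\<epsilon> / (K\<^sup>2 * b\<^sup>2)) \<le> D"
      unfolding D_def
    proof (rule ip_ge_card)
      fix l assume l: "l \<in> {j<..j'}"
      have v': "contrast j' k' l = level1 j' k'" using l d' by (simp add: contrast_def two_level_cases)
      have v: "contrast j k l \<le> 0"
        using l pos by (cases "l \<le> k") (auto simp: contrast_def two_level_cases)
      have "(level1 j' k')\<^sup>2 \<le> (level1 j' k' - contrast j k l)\<^sup>2"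
        using v pos by (intro power_mono) auto
      then show "\<epsilon> / (K\<^sup>2 * b\<^sup>2) \<le> (contrast j k l - contrast j' k' l)\<^sup>2"
        using g' v' by (simp add: power2_commute)
    qed (use d' in auto)
    then show ?thesis using that by (simp add: of_nat_diff)
  qed
  show "(real k' - real k) * (\<epsilon> / (K\<^sup>2 * b\<^sup>2)) \<le> D" if "k \<le> k'"
  proof -
    have "real (card {k<..k'}) * (\<epsilon> / (K\<^sup>2 * b\<^sup>2)) \<le> D"
      unfolding D_def
    proof (rule ip_ge_card)
      fix l assume l: "l \<in> {k<..k'}"
      have v: "contrast j k l = 0" using l d by (simp add: contrast_def two_level_cases)
      have "\<epsilon> / (K\<^sup>2 * b\<^sup>2) \<le> (contrast j' k' l)\<^sup>2"
        using l g' d' by (cases "l \<le> j'") (auto simp: contrast_def two_level_cases)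
      then show "\<epsilon> / (K\<^sup>2 * b\<^sup>2) \<le> (contrast j k l - contrast j' k' l)\<^sup>2" by (simp add: v)
    qed (use d' in auto)
    then show ?thesis using that by (simp add: of_nat_diff)
  qed
qed

lemma ip_diff_commute: "ip m (\<lambda>l. x l - y l) (\<lambda>l. x l - y l) = ip m (\<lambda>l. y l - x l) (\<lambda>l. y l - x l)"
  unfolding ip_def by (intro sum.cong) (auto simp: algebra_simps)

lemma ip_diff_ge:
  assumes p: "(j, k) \<in> inner_pairs \<epsilon> b m" and p': "(j', k') \<in> inner_pairs \<epsilon> b m"
  shows "\<epsilon> / (2 * K\<^sup>2 * b\<^sup>2) * (\<bar>real j' - real j\<bar> + \<bar>real k' - real k\<bar>)
    \<le> ip m (\<lambda>l. contrast j k l - contrast j' k' l) (\<lambda>l. contrast j k l - contrast j' k' l)" (is "_ \<le> ?D")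
proof -
  define g where "g = \<epsilon> / (K\<^sup>2 * b\<^sup>2)"
  note comm = ip_diff_commute[of "contrast j' k'" "contrast j k"]
  have "\<bar>real j' - real j\<bar> * g \<le> ?D"
    using ip_diff_ge_aux(1)[OF p p'] ip_diff_ge_aux(1)[OF p' p] comm by (cases "j \<le> j'") (auto simp: g_def)
  moreover have "\<bar>real k' - real k\<bar> * g \<le> ?D"
    using ip_diff_ge_aux(2)[OF p p'] ip_diff_ge_aux(2)[OF p' p] comm by (cases "k \<le> k'") (auto simp: g_def)
  moreover have "g / 2 * (\<bar>real j' - real j\<bar> + \<bar>real k' - real k\<bar>)
      = (\<bar>real j' - real j\<bar> * g + \<bar>real k' - real k\<bar> * g) / 2" by (simp add: algebra_simps)
  moreover have "\<epsilon> / (2 * K\<^sup>2 * b\<^sup>2) = g / 2" by (simp add: g_def)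
  moreover have "X \<le> D \<Longrightarrow> Y \<le> D \<Longrightarrow> (X + Y) / 2 \<le> D" for X Y D :: real by simp
  ultimately show ?thesis by (simp only:)
qed

text \<open>
  Both vectors are positive on the first \<open>\<epsilon> b\<^sup>2\<close> coordinates, so no contrast is close to the
  negative of another one.
\<close>

lemma ip_sum_ge:
  assumes p: "(j, k) \<in> inner_pairs \<epsilon> b m" and p': "(j', k') \<in> inner_pairs \<epsilon> b m"
  shows "\<epsilon>\<^sup>2 / K\<^sup>2 \<le> ip m (\<lambda>l. contrast j k l + contrast j' k' l) (\<lambda>l. contrast j k l + contrast j' k' l)"
      (is "_ \<le> ?D")
proof -
  note d = inner_pairs_D[OF p] and d' = inner_pairs_D[OF p']
  note g = levels_ge[OF p]
  have pos: "0 < level1 j k" "0 < level1 j' k'" using d d' levels_sq by auto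
  have "\<epsilon>\<^sup>2 / K\<^sup>2 = (\<epsilon> * b\<^sup>2) * (\<epsilon> / (K\<^sup>2 * b\<^sup>2))" using b by (simp add: power2_eq_square)
  also have "\<dots> \<le> real (card {1..min j j'}) * (\<epsilon> / (K\<^sup>2 * b\<^sup>2))"
    using d d' eps by (intro mult_right_mono) (auto simp: min_def)
  also have "\<dots> \<le> ?D"
  proof (rule ip_ge_card)
    fix l assume l: "l \<in> {1..min j j'}"
    have v: "contrast j k l = level1 j k" "contrast j' k' l = level1 j' k'"
      using l d d' by (auto simp: contrast_def two_level_cases)
    have "(level1 j k)\<^sup>2 \<le> (level1 j k + level1 j' k')\<^sup>2" using pos by (intro power_mono) auto
    then show "\<epsilon> / (K\<^sup>2 * b\<^sup>2) \<le> (contrast j k l + contrast j' k' l)\<^sup>2" using v g by simp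
  qed (use d d' in auto)
  finally show ?thesis .
qed

end

section \<open>The contrasts near a pair as random walks\<close>

text \<open>
  The step sizes, multiplied by \<open>b\<close>, by which the linear form changes when \<open>j\<close> or \<open>k\<close> moves by
  one: the jump of the contrast vector at \<open>j\<close> is \<open>level1 + level2\<close>, its jump at \<open>k\<close> is \<open>level2\<close>.
\<close>

definition beta1 :: "real \<Rightarrow> nat \<Rightarrow> nat \<Rightarrow> real" where
  "beta1 b j k = b * (level1 j k + level2 j k)"

definition beta2 :: "real \<Rightarrow> nat \<Rightarrow> nat \<Rightarrow> real" where
  "beta2 b j k = b * level2 j k"

lemma inverse_diff_le:
  fixes x y s t :: real
  assumes "0 < s" "s \<le> x" "s / 2 \<le> y" "\<bar>x - y\<bar> \<le> t"
  shows "\<bar>1 / y - 1 / x\<bar> \<le> 2 * t / s\<^sup>2"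
proof -
  have pos: "0 < x" "0 < y" using assms by linarith+
  have "\<bar>1 / y - 1 / x\<bar> = \<bar>x - y\<bar> / (x * y)" using pos by (simp add: divide_simps abs_mult)
  also have "\<dots> \<le> t / (s * (s / 2))"
    using assms pos by (intro frac_le mult_mono) auto
  finally show ?thesis by (simp add: power2_eq_square mult.commute)
qed

lemma root_diff_sq_le:
  fixes x y g t :: real
  assumes "0 < x" "0 < y" "0 < g" "g \<le> x\<^sup>2" "\<bar>y\<^sup>2 - x\<^sup>2\<bar> \<le> t"
  shows "(y - x)\<^sup>2 \<le> t\<^sup>2 / g"
proof -
  have "(y - x)\<^sup>2 * g \<le> (y - x)\<^sup>2 * (y + x)\<^sup>2"
    using assms by (intro mult_left_mono order_trans[OF assms(4)] power_mono) auto
  also have "\<dots> = \<bar>y\<^sup>2 - x\<^sup>2\<bar>\<^sup>2" by (simp add: power2_eq_square algebra_simps)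
  also have "\<dots> \<le> t\<^sup>2" using assms(5) by (intro power_mono) auto
  finally show ?thesis using assms(3) by (simp add: le_divide_eq)
qed

context scale begin

lemma beta_bounds:
  assumes p: "(j, k) \<in> inner_pairs \<epsilon> b m"
  shows "(beta1 b j k)\<^sup>2 \<le> 2 / \<epsilon>" "(beta2 b j k)\<^sup>2 \<le> 2 / \<epsilon>"
    "sqrt \<epsilon> / K \<le> beta1 b j k" "sqrt \<epsilon> / K \<le> beta2 b j k"
proof -
  note d = inner_pairs_D[OF p]
  note lv = levels_sq[OF d(1,2)]
  have pe: "0 < \<epsilon> * b\<^sup>2" using eps b by simp
  have r: "1 / real j \<le> 1 / (\<epsilon> * b\<^sup>2)" "1 / (real k - real j) \<le> 1 / (\<epsilon> * b\<^sup>2)"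
    using d pe by (auto intro!: divide_left_mono mult_pos_pos)
  have "(level1 j k + level2 j k)\<^sup>2 = 1 / real j + 1 / (real k - real j)"
    unfolding levels_sum(1)[OF d(1,2)] using d(1,2) by (simp add: divide_simps)
  also have "\<dots> \<le> 2 * (1 / (\<epsilon> * b\<^sup>2))" using r by linarith
  finally have 1: "b\<^sup>2 * (level1 j k + level2 j k)\<^sup>2 \<le> b\<^sup>2 * (2 * (1 / (\<epsilon> * b\<^sup>2)))"
    by (rule mult_left_mono) simp
  then show B1: "(beta1 b j k)\<^sup>2 \<le> 2 / \<epsilon>" using b by (simp add: beta1_def power_mult_distrib)
  have le: "beta2 b j k \<le> beta1 b j k" "0 \<le> beta2 b j k"
    using b lv by (auto simp: beta1_def beta2_def)
  then have "(beta2 b j k)\<^sup>2 \<le> (beta1 b j k)\<^sup>2" by (intro power_mono)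
  then show "(beta2 b j k)\<^sup>2 \<le> 2 / \<epsilon>" using B1 by linarith
  have "(sqrt \<epsilon> / K)\<^sup>2 = b\<^sup>2 * (\<epsilon> / (K\<^sup>2 * b\<^sup>2))" using eps b by (simp add: power_divide)
  also have "\<dots> \<le> b\<^sup>2 * (level2 j k)\<^sup>2" using levels_ge(2)[OF p] by (rule mult_left_mono) simp
  also have "\<dots> = (beta2 b j k)\<^sup>2" by (simp add: beta2_def power_mult_distrib)
  finally show "sqrt \<epsilon> / K \<le> beta2 b j k" using le(2) by (rule power2_le_imp_le)
  then show "sqrt \<epsilon> / K \<le> beta1 b j k" using le(1) by linarith
qed

end

definition near :: "nat \<Rightarrow> nat \<Rightarrow> nat \<Rightarrow> bool" where
  "near L i j \<longleftrightarrow> i \<le> j + L \<and> j \<le> i + L"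

lemma near_abs: "near L i j \<longleftrightarrow> \<bar>real i - real j\<bar> \<le> real L"
  by (auto simp: near_def abs_le_iff)

text \<open>
  A window of fixed radius \<open>L\<close> around an inner pair, at a level \<open>b\<close> so high that after moving
  \<open>j\<close> and \<open>k\<close> by at most \<open>L\<close> the gaps \<open>j\<close> and \<open>k - j\<close> are still at least \<open>\<epsilon> b\<^sup>2 / 2\<close>, and the
  coordinates near \<open>j\<close> do not meet those near \<open>k\<close>.
\<close>

locale window = scale +
  fixes L :: nat
  assumes b_large: "1 \<le> b" "4 * real L + 2 \<le> \<epsilon> * b\<^sup>2"
begin

text \<open>
  The change of the contrast vector, multiplied by \<open>b\<close>, when the change points move and the
  levels stay fixed. It is supported between the old and the new change points.
\<close>

definition main_step :: "nat \<Rightarrow> nat \<Rightarrow> nat \<Rightarrow> nat \<Rightarrow> nat \<Rightarrow> real" where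
  "main_step j k j' k' l = b * (two_level (level1 j k) (level2 j k) j' k' l - contrast j k l)"

definition approx_const :: real where
  "approx_const = 128 * (real L)\<^sup>2 * K ^ 3 / \<epsilon> ^ 5"

definition window_const :: real where
  "window_const = 1 + 8 * real L / \<epsilon> + 4 * approx_const"

lemma window_const_ge: "0 \<le> approx_const" "4 * real L / \<epsilon> + 2 * approx_const \<le> window_const" "1 \<le>
    window_const"
proof -
  show C0: "0 \<le> approx_const" unfolding approx_const_def using eps K by simp
  then show "4 * real L / \<epsilon> + 2 * approx_const \<le> window_const" "1 \<le> window_const"
    using eps by (auto simp: window_const_def divide_simps)
qed

context
  fixes j k j' k' :: nat
  assumes p: "(j, k) \<in> inner_pairs \<epsilon> b m" and nj: "near L j' j" and nk: "near L k' k"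
begin

lemma window_pairs:
  shows "0 < j'" "j' < k'" "k' \<le> m" "j + L < k" "j' + L < k" "j + L < k'"
    "\<epsilon> * b\<^sup>2 / 2 \<le> real j'" "\<epsilon> * b\<^sup>2 / 2 \<le> real k' - real j'" "L < j" "k + L < m" "j + L + L < k"
proof -
  note d = inner_pairs_D[OF p]
  have ab: "\<bar>real j' - real j\<bar> \<le> real L" "\<bar>real k' - real k\<bar> \<le> real L" using nj nk near_abs by auto
  have "0 < real j'" "real j' < real k'" "real k' \<le> real m" "real j + real L < real k" "real j' + real L <
      real k" "real j + real L < real k'"
    "real L < real j" "real k + real L < real m" "real j + real L + real L < real k"
    using ab d b_large by linarith+
  then show "0 < j'" "j' < k'" "k' \<le> m" "j + L < k" "j' + L < k" "j + L < k'" "L < j" "k + L < m" "j + L +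
      L < k" by linarith+
  show "\<epsilon> * b\<^sup>2 / 2 \<le> real j'" "\<epsilon> * b\<^sup>2 / 2 \<le> real k' - real j'" using ab d b_large by linarith+
qed

lemma ip_main_step:
  "ip m (main_step j k j' k') (main_step j k j' k') =
    (beta1 b j k)\<^sup>2 * \<bar>real j' - real j\<bar> + (beta2 b j k)\<^sup>2 * \<bar>real k' - real k\<bar>"
proof -
  note w = window_pairs and d = inner_pairs_D[OF p]
  have sq: "(main_step j k j' k' l)\<^sup>2 =
      (beta1 b j k)\<^sup>2 * of_bool (l \<in> {min j j'<..max j j'}) + (beta2 b j k)\<^sup>2 * of_bool (l \<in> {min k
          k'<..max k k'})" for l
  proof -
    have "main_step j k j' k' l = beta1 b j k * (of_bool (l \<le> j') - of_bool (l \<le> j)) - beta2 b j k *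
        (of_bool (l \<le> k') - of_bool (l \<le> k))"
      by (simp add: main_step_def contrast_def two_level_def beta1_def beta2_def algebra_simps)
    moreover have "\<not> (l \<in> {min j j'<..max j j'} \<and> l \<in> {min k k'<..max k k'})"
      using w d by auto
    ultimately show ?thesis
      using w d by (auto simp: power2_eq_square min_def max_def split: if_splits)
  qed
  have cnt: "(\<Sum>l=1..m. of_bool (l \<in> {min a a'<..max a a'})) = \<bar>real a' - real a\<bar>" if "a \<le> m" "a' \<le> m" for a a'
  proof -
    have "(\<Sum>l=1..m. of_bool (l \<in> {min a a'<..max a a'})) = real (card ({1..m} \<inter> {l. l \<in> {min a a'<..max a
        a'}}))"
      by (simp add: sum.If_cases of_bool_def)
    also have "{1..m} \<inter> {l. l \<in> {min a a'<..max a a'}} = {min a a'<..max a a'}" using that by auto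
    finally show ?thesis by (auto simp: min_def max_def of_nat_diff)
  qed
  have "ip m (main_step j k j' k') (main_step j k j' k') = (\<Sum>l=1..m. (main_step j k j' k' l)\<^sup>2)"
    by (simp add: ip_def power2_eq_square)
  also have "\<dots> = (beta1 b j k)\<^sup>2 * \<bar>real j' - real j\<bar> + (beta2 b j k)\<^sup>2 * \<bar>real k' - real k\<bar>"
    unfolding sq sum.distrib sum_distrib_left[symmetric] using w d
    by (subst cnt, simp, simp)+ simp
  finally show ?thesis .
qed

text \<open>
  The squares of the levels are differences of reciprocals of the gaps, which change by
  \<open>O(b\<^sup>-\<^sup>4)\<close>; the levels are at least of order \<open>1 / b\<close>, so they change by \<open>O(b\<^sup>-\<^sup>3)\<close>.
\<close>

lemma levels_diff:
  shows "(level1 j' k' - level1 j k)\<^sup>2 \<le> 64 * (real L)\<^sup>2 * K\<^sup>2 / (\<epsilon> ^ 5 * b ^ 6)"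
    and "(level2 j' k' - level2 j k)\<^sup>2 \<le> 64 * (real L)\<^sup>2 * K\<^sup>2 / (\<epsilon> ^ 5 * b ^ 6)"
proof -
  note w = window_pairs and d = inner_pairs_D[OF p]
  define s where "s = \<epsilon> * b\<^sup>2"
  have s: "0 < s" using eps b by (simp add: s_def)
  define t where "t = 8 * real L / s\<^sup>2"
  note lv = levels_sq[OF d(1,2)] and lv' = levels_sq[OF w(1,2)]
  have ab: "\<bar>real j - real j'\<bar> \<le> real L" "\<bar>real k - real k'\<bar> \<le> real L" using nj nk near_abs by (auto simp:
      abs_minus_commute)
  have 1: "\<bar>1 / real j' - 1 / real j\<bar> \<le> 2 * real L / s\<^sup>2"
    using d w s ab by (intro inverse_diff_le) (auto simp: s_def)
  have 2: "\<bar>1 / real k' - 1 / real k\<bar> \<le> 2 * real L / s\<^sup>2"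
    using d w s ab by (intro inverse_diff_le) (auto simp: s_def)
  have 3: "\<bar>1 / (real k' - real j') - 1 / (real k - real j)\<bar> \<le> 2 * (2 * real L) / s\<^sup>2"
    using d w s ab by (intro inverse_diff_le) (auto simp: s_def)
  have L0: "0 \<le> real L / s\<^sup>2" by simp
  have t: "t = 8 * (real L / s\<^sup>2)" by (simp add: t_def)
  have 4: "\<bar>(level1 j' k')\<^sup>2 - (level1 j k)\<^sup>2\<bar> \<le> t" "\<bar>(level2 j' k')\<^sup>2 - (level2 j k)\<^sup>2\<bar> \<le> t"
  proof -
    have e: "2 * real L / s\<^sup>2 = 2 * (real L / s\<^sup>2)" "2 * (2 * real L) / s\<^sup>2 = 4 * (real L / s\<^sup>2)" by simp_all
    show "\<bar>(level1 j' k')\<^sup>2 - (level1 j k)\<^sup>2\<bar> \<le> t" "\<bar>(level2 j' k')\<^sup>2 - (level2 j k)\<^sup>2\<bar> \<le> t"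
      unfolding lv lv' t using 1 2 3 L0 unfolding e by linarith+
  qed
  have g: "0 < \<epsilon> / (K\<^sup>2 * b\<^sup>2)" using eps K b by simp
  have eq: "t\<^sup>2 / (\<epsilon> / (K\<^sup>2 * b\<^sup>2)) = 64 * (real L)\<^sup>2 * K\<^sup>2 / (\<epsilon> ^ 5 * b ^ 6)"
    using eps K b unfolding t_def s_def by (simp add: power_divide power_mult_distrib field_simps
        eval_nat_numeral)
  show "(level1 j' k' - level1 j k)\<^sup>2 \<le> 64 * (real L)\<^sup>2 * K\<^sup>2 / (\<epsilon> ^ 5 * b ^ 6)"
    using root_diff_sq_le[OF lv(3) lv'(3) g levels_ge(1)[OF p] 4(1)] eq by simp
  show "(level2 j' k' - level2 j k)\<^sup>2 \<le> 64 * (real L)\<^sup>2 * K\<^sup>2 / (\<epsilon> ^ 5 * b ^ 6)"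
    using root_diff_sq_le[OF lv(4) lv'(4) g levels_ge(2)[OF p] 4(2)] eq by simp
qed

text \<open>
  What \<open>main_step\<close> neglects, namely the change of the levels. Its norm is \<open>O(1 / b)\<close>: there are
  \<open>O(b\<^sup>2)\<close> coordinates, and each is \<open>O(b\<^sup>-\<^sup>2)\<close>.
\<close>

definition level_err :: "nat \<Rightarrow> real" where
  "level_err l = b * (contrast j' k' l - contrast j k l) - main_step j k j' k' l"

lemma ip_level_err: "ip m level_err level_err \<le> approx_const / b\<^sup>2"
proof -
  note w = window_pairs and d = inner_pairs_D[OF p]
  define A where "A = 64 * (real L)\<^sup>2 * K\<^sup>2 / (\<epsilon> ^ 5 * b ^ 6)"
  have A0: "0 \<le> A" unfolding A_def using eps b by simp
  have le: "(level_err l)\<^sup>2 \<le> b\<^sup>2 * (2 * A)" for l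
  proof -
    have "level_err l = b * (contrast j' k' l - two_level (level1 j k) (level2 j k) j' k' l)"
      by (simp add: level_err_def main_step_def algebra_simps)
    moreover have "(contrast j' k' l - two_level (level1 j k) (level2 j k) j' k' l)\<^sup>2 \<le> 2 * A"
    proof -
      consider "l \<le> j'" | "j' < l" "l \<le> k'" | "j' < l" "k' < l" by linarith
      then show ?thesis
      proof cases
        case 1
        then show ?thesis using levels_diff(1) w A0 by (simp add: contrast_def two_level_cases A_def)
      next
        case 2
        have "(level2 j k - level2 j' k')\<^sup>2 \<le> A"
          using levels_diff(2) by (simp add: A_def power2_commute)
        then show ?thesis using 2 w A0 by (simp add: contrast_def two_level_cases)
      next
        case 3
        then show ?thesis using w A0 by (simp add: contrast_def two_level_cases)
      qed
    qed
    ultimately show ?thesis by (simp add: power_mult_distrib mult_left_mono)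
  qed
  have "ip m level_err level_err = (\<Sum>l=1..m. (level_err l)\<^sup>2)" by (simp add: ip_def power2_eq_square)
  also have "\<dots> \<le> real m * (b\<^sup>2 * (2 * A))" using le sum_bounded_above[of "{1..m}" "\<lambda>l. (level_err l)\<^sup>2"]
      by simp
  also have "\<dots> \<le> (K * b\<^sup>2) * (b\<^sup>2 * (2 * A))" using m_le A0 by (intro mult_right_mono) auto
  also have "\<dots> = approx_const / b\<^sup>2"
    using b eps by (simp add: A_def approx_const_def field_simps eval_nat_numeral)
  finally show ?thesis .
qed

text \<open>
  This is one minus the correlation of the two statistics.
\<close>

definition half_dist :: real where
  "half_dist = ip m (\<lambda>l. contrast j' k' l - contrast j k l) (\<lambda>l. contrast j' k' l - contrast j k l) / 2"

lemma half_dist_eq: "half_dist = 1 - ip m (contrast j' k') (contrast j k)"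
proof -
  note w = window_pairs and d = inner_pairs_D[OF p]
  have "ip m (contrast j' k') (contrast j' k') = 1" "ip m (contrast j k) (contrast j k) = 1"
    using w d by (auto intro!: ip_contrast_self)
  then show ?thesis unfolding half_dist_def ip_lin by (simp add: ip_commute[of m "contrast j k" "contrast
      j' k'"])
qed

lemma half_dist_nonneg: "0 \<le> half_dist"
  by (simp add: half_dist_def ip_self_nonneg)

lemma ip_main_step_le: "ip m (main_step j k j' k') (main_step j k j' k') \<le> 4 * real L / \<epsilon>"
proof -
  have ab: "\<bar>real j' - real j\<bar> \<le> real L" "\<bar>real k' - real k\<bar> \<le> real L" using nj nk near_abs by auto
  have "ip m (main_step j k j' k') (main_step j k j' k') \<le> (2 / \<epsilon>) * real L + (2 / \<epsilon>) * real L"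
    unfolding ip_main_step using beta_bounds[OF p] ab eps by (intro add_mono mult_mono) auto
  then show ?thesis by (simp add: mult.commute)
qed

text \<open>
  The vector \<open>b (contrast j' k' - contrast j k)\<close> is the sum of \<open>main_step\<close> and \<open>level_err\<close>. In
  its squared norm, the mixed term \<open>2 d e\<close> is bounded by \<open>d\<^sup>2 / b + b e\<^sup>2\<close>, where both summands
  are \<open>O(1 / b)\<close>.
\<close>

lemma half_dist_approx:
  "\<bar>b\<^sup>2 * half_dist - ip m (main_step j k j' k') (main_step j k j' k') / 2\<bar> \<le> (4 * real L / \<epsilon> + 2 *
      approx_const) / b"
proof -
  define d where "d = main_step j k j' k'"
  define e where "e = level_err"
  have "b\<^sup>2 * (2 * half_dist) = ip m (\<lambda>l. b * (contrast j' k' l - contrast j k l)) (\<lambda>l. b * (contrast j'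
      k' l - contrast j k l))"
    by (simp only: half_dist_def ip_lin(5) ip_lin(6)) (simp add: power2_eq_square)
  also have "(\<lambda>l. b * (contrast j' k' l - contrast j k l)) = (\<lambda>l. d l + e l)"
    by (simp add: d_def e_def level_err_def)
  also have "ip m (\<lambda>l. d l + e l) (\<lambda>l. d l + e l) = ip m d d + 2 * ip m d e + ip m e e"
    unfolding ip_lin by (simp add: ip_commute)
  finally have eq: "b\<^sup>2 * (2 * half_dist) = ip m d d + 2 * ip m d e + ip m e e" .
  have amgm: "\<bar>2 * ip m d e\<bar> \<le> ip m d d / b + b * ip m e e"
  proof -
    have "0 \<le> ip m (\<lambda>l. (1 / b) * d l + e l) (\<lambda>l. (1 / b) * d l + e l)"
      "0 \<le> ip m (\<lambda>l. (1 / b) * d l - e l) (\<lambda>l. (1 / b) * d l - e l)"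
      by (rule ip_self_nonneg)+
    then have "0 \<le> ip m d d / b / b + 2 * (ip m d e / b) + ip m e e" "0 \<le> ip m d d / b / b - 2 * (ip m d e
        / b) + ip m e e"
      unfolding ip_lin by (simp_all add: ip_commute[of m e d])
    then have "b * 0 \<le> b * (ip m d d / b / b + 2 * (ip m d e / b) + ip m e e)" "b * 0 \<le> b * (ip m d d / b
        / b - 2 * (ip m d e / b) + ip m e e)"
      using b by (auto intro!: mult_left_mono)
    moreover have "b * (ip m d d / b / b + 2 * (ip m d e / b) + ip m e e) = ip m d d / b + 2 * ip m d e +
        b * ip m e e"
      "b * (ip m d d / b / b - 2 * (ip m d e / b) + ip m e e) = ip m d d / b - 2 * ip m d e + b * ip m e e"
      using b by (auto simp: algebra_simps)
    ultimately show ?thesis by (simp add: abs_le_iff)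
  qed
  have e0: "0 \<le> ip m e e" by (rule ip_self_nonneg)
  have ee: "ip m e e \<le> approx_const / b\<^sup>2" unfolding e_def by (rule ip_level_err)
  have C0: "0 \<le> approx_const" unfolding approx_const_def using eps K by simp
  have "b * ip m e e \<le> b * (approx_const / b\<^sup>2)" using ee b by (intro mult_left_mono) auto
  also have "\<dots> = approx_const / b" using b by (simp add: power2_eq_square)
  finally have be: "b * ip m e e \<le> approx_const / b" .
  have eb: "ip m e e \<le> b * ip m e e" using e0 b_large mult_right_mono[of 1 b "ip m e e"] by simp
  have dd: "ip m d d / b \<le> 4 * real L / \<epsilon> / b"
    unfolding d_def using ip_main_step_le b by (intro divide_right_mono) auto
  have "\<bar>b\<^sup>2 * (2 * half_dist) - ip m d d\<bar> \<le> 4 * real L / \<epsilon> / b + approx_const / b + approx_const / b"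
    unfolding eq using amgm be eb dd e0 by linarith
  moreover have "0 \<le> 4 * real L / \<epsilon> / b + approx_const / b + approx_const / b" using C0 eps b by simp
  moreover have "(4 * real L / \<epsilon> + 2 * approx_const) / b = 4 * real L / \<epsilon> / b + approx_const / b +
      approx_const / b"
    by (simp add: add_divide_distrib)
  ultimately show ?thesis unfolding d_def by linarith
qed

lemma half_dist_le: "b * half_dist \<le> window_const / b"
proof -
  have 1: "(4 * real L / \<epsilon> + 2 * approx_const) / b \<le> 4 * real L / \<epsilon> + 2 * approx_const"
  proof -
    have "X / b \<le> X" if "0 \<le> X" for X :: real
      using b_large(1) b that by (simp add: divide_le_eq mult_le_cancel_left1)
    then show ?thesis using window_const_ge(1) eps by simp
  qed
  have "b\<^sup>2 * half_dist \<le> window_const"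
  proof -
    have "0 \<le> 4 * real L / \<epsilon>" "8 * real L / \<epsilon> = 2 * (4 * real L / \<epsilon>)" using eps by auto
    then show ?thesis
      using half_dist_approx ip_main_step_le 1 window_const_ge(1) unfolding window_const_def abs_le_iff
      by linarith
  qed
  then show ?thesis using b by (simp add: field_simps power2_eq_square)
qed

text \<open>
  The part of the neighbouring statistic that is independent of the statistic at \<open>(j, k)\<close>,
  multiplied by \<open>b\<close>, differs from \<open>main_step\<close> by this vector. Its norm is \<open>O(1 / b)\<close>, too: it is
  the sum of \<open>level_err\<close> and \<open>b * half_dist\<close> times the unit vector \<open>contrast j k\<close>, and
  \<open>b\<^sup>2 * half_dist\<close> is bounded.
\<close>

definition resid_err :: "nat \<Rightarrow> real" where
  "resid_err l = b * (contrast j' k' l - ip m (contrast j' k') (contrast j k) * contrast j k l) -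
      main_step j k j' k' l"

lemma ip_resid_err: "sqrt (ip m resid_err resid_err) \<le> 2 * window_const / b"
proof -
  note w = window_pairs and d = inner_pairs_D[OF p]
  define h where "h = b * half_dist"
  define e where "e = level_err"
  define v where "v = contrast j k"
  have vv: "ip m v v = 1" unfolding v_def using w d by (auto intro!: ip_contrast_self)
  have e0: "0 \<le> ip m e e" by (rule ip_self_nonneg)
  have "resid_err = (\<lambda>l. e l + h * v l)"
    by (intro ext) (simp add: resid_err_def e_def level_err_def h_def v_def half_dist_eq algebra_simps)
  then have "ip m resid_err resid_err = ip m e e + 2 * h * ip m e v + h\<^sup>2"
    by (simp add: ip_lin ip_commute[of m v e] vv power2_eq_square algebra_simps)
  moreover have "2 * h * ip m e v \<le> ip m e e + h\<^sup>2"
  proof -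
    have "0 \<le> ip m (\<lambda>l. e l - h * v l) (\<lambda>l. e l - h * v l)" by (rule ip_self_nonneg)
    then show ?thesis by (simp add: ip_lin ip_commute[of m v e] vv power2_eq_square algebra_simps)
  qed
  moreover have "ip m e e \<le> (window_const / b)\<^sup>2"
  proof -
    have "approx_const \<le> window_const" using window_const_ge eps by (simp add: window_const_def)
    also have "\<dots> \<le> window_const\<^sup>2" using window_const_ge(3) by (simp add: power2_eq_square
        mult_le_cancel_left1)
    finally have "approx_const / b\<^sup>2 \<le> window_const\<^sup>2 / b\<^sup>2" using b by (intro divide_right_mono) auto
    then show ?thesis using ip_level_err by (simp add: e_def power_divide)
  qed
  moreover have "h\<^sup>2 \<le> (window_const / b)\<^sup>2"
    using half_dist_le half_dist_nonneg b unfolding h_def by (intro power_mono) auto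
  ultimately have "ip m resid_err resid_err \<le> (2 * window_const / b)\<^sup>2"
    by (simp add: power2_eq_square)
  then show ?thesis using window_const_ge(3) b by (intro real_le_lsqrt ip_self_nonneg) auto
qed

end

end

section \<open>The four walks around a pair\<close>

context gaussian_steps begin

definition block_event :: "real \<Rightarrow> real \<Rightarrow> (nat \<Rightarrow> nat) \<Rightarrow> nat \<Rightarrow> real \<Rightarrow> 'a set" where
  "block_event \<beta> s f L \<delta> = {\<omega> \<in> space M. \<forall>n\<in>{1..L}. (\<Sum>t<n. s * \<beta> * \<xi> (f t) \<omega> - \<beta>\<^sup>2 / 2) \<le> \<delta>}"

lemma prob_block_event:
  assumes "0 < \<beta>" "\<bar>s\<bar> = 1" "inj_on f {..<L}" "f ` {..<L} \<subseteq> {1..m}"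
  shows "prob (block_event \<beta> s f L \<delta>) = stay_below \<beta> L \<delta>"
proof -
  have "prob_space M" by (rule prob_space_axioms)
  define Y where "Y = (\<lambda>t \<omega>. s * \<beta> * \<xi> (f t) \<omega> - \<beta>\<^sup>2 / 2)"
  have "disjoint_family_on (\<lambda>t. {f t}) {..<L}"
    using assms(3) by (auto simp: disjoint_family_on_def inj_on_def)
  then have "indep_vars (\<lambda>t. \<Pi>\<^sub>M i\<in>{f t}. borel) (\<lambda>t \<omega>. restrict (\<lambda>i. \<xi> i \<omega>) {f t}) {..<L}"
    using assms(4) by (intro indep_vars_restrict[OF indep]) auto
  then have "indep_vars (\<lambda>_. borel) (\<lambda>t \<omega>. s * \<beta> * (restrict (\<lambda>i. \<xi> i \<omega>) {f t}) (f t) - \<beta>\<^sup>2 / 2) {..<L}"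
    by (rule indep_vars_compose2[of _ _ _ "\<lambda>t x. s * \<beta> * x (f t) - \<beta>\<^sup>2 / 2"]) measurable
  then have ind: "indep_vars (\<lambda>_. borel) Y {..<L}"
    by (simp add: Y_def)
  have law: "distr M borel (Y t) = gauss_step \<beta>" if t: "t < L" for t
  proof -
    have "f t \<in> {1..m}" using assms(4) t by auto
    from normal_density_affine[OF normal[OF this], of "s * \<beta>" "- (\<beta>\<^sup>2 / 2)"]
    have "distributed M lborel (\<lambda>\<omega>. - (\<beta>\<^sup>2 / 2) + s * \<beta> * \<xi> (f t) \<omega>) (normal_density (- (\<beta>\<^sup>2 / 2)) \<bar>s * \<beta>\<bar>)"
      using assms(1,2) by auto
    moreover have "\<bar>s * \<beta>\<bar> = \<beta>" using assms(1,2) by (simp add: abs_mult)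
    moreover have "(\<lambda>\<omega>. - (\<beta>\<^sup>2 / 2) + s * \<beta> * \<xi> (f t) \<omega>) = Y t" by (simp add: Y_def fun_eq_iff)
    ultimately have "distr M lborel (Y t) = gauss_step \<beta>"
      by (simp add: distributed_def gauss_step_def)
    moreover have "distr M borel (Y t) = distr M lborel (Y t)" by (intro distr_cong) auto
    ultimately show ?thesis by simp
  qed
  interpret gauss_walk \<beta> by unfold_locales fact
  show ?thesis
    using walk_law_transfer[OF _ ind law, of \<delta>] \<open>prob_space M\<close>
    by (simp add: block_event_def stay_below_def Y_def)
qed

text \<open>
  Walks whose steps use disjoint sets of coordinates are independent.
\<close>

lemma prob_blocks:
  assumes "finite Q" "Q \<noteq> {}" and \<beta>: "\<And>q. q \<in> Q \<Longrightarrow> 0 < \<beta> q" and s: "\<And>q. q \<in> Q \<Longrightarrow> \<bar>s q\<bar> = 1"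
    and inj: "inj_on (\<lambda>(q, t). f q t) (Q \<times> {..<L})" and ran: "\<And>q t. q \<in> Q \<Longrightarrow> t < L \<Longrightarrow> f q t \<in> {1..m}"
  shows "prob (\<Inter>q\<in>Q. block_event (\<beta> q) (s q) (f q) L \<delta>) = (\<Prod>q\<in>Q. stay_below (\<beta> q) L \<delta>)"
proof -
  define J where "J = (\<lambda>q. f q ` {..<L})"
  define C where "C = (\<lambda>q. {x \<in> space (\<Pi>\<^sub>M i\<in>J q. (borel :: real measure)).
    \<forall>n\<in>{1..L}. (\<Sum>t<n. s q * \<beta> q * x (f q t) - (\<beta> q)\<^sup>2 / 2) \<le> \<delta>})"
  have Jm: "J q \<subseteq> {1..m}" if "q \<in> Q" for q using ran that by (auto simp: J_def)
  have disj: "disjoint_family_on J Q"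
  proof (unfold disjoint_family_on_def, intro ballI impI)
    fix q q' assume q: "q \<in> Q" "q' \<in> Q" "q \<noteq> q'"
    have "f q t \<noteq> f q' t'" if "t < L" "t' < L" for t t'
      using inj_onD[OF inj, of "(q, t)" "(q', t')"] q that by auto
    then show "J q \<inter> J q' = {}" by (auto simp: J_def)
  qed
  have ind: "indep_vars (\<lambda>q. \<Pi>\<^sub>M i\<in>J q. borel) (\<lambda>q \<omega>. restrict (\<lambda>i. \<xi> i \<omega>) (J q)) Q"
    by (rule indep_vars_restrict[OF indep Jm disj])
  have C: "C q \<in> sets (\<Pi>\<^sub>M i\<in>J q. borel)" for q
    unfolding C_def
  proof (intro sets.sets_Collect_finite_All)
    fix n assume n: "n \<in> {1..L}"
    have "(\<lambda>x. \<Sum>t<n. s q * \<beta> q * x (f q t) - (\<beta> q)\<^sup>2 / 2) \<in> borel_measurable (\<Pi>\<^sub>M i\<in>J q. borel)"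
      using n by (intro borel_measurable_sum borel_measurable_diff borel_measurable_times
          measurable_component_singleton borel_measurable_const) (auto simp: J_def)
    then show "{x \<in> space (\<Pi>\<^sub>M i\<in>J q. borel). (\<Sum>t<n. s q * \<beta> q * x (f q t) - (\<beta> q)\<^sup>2 / 2) \<le> \<delta>} \<in> sets (\<Pi>\<^sub>M
        i\<in>J q. borel)"
      by (intro borel_measurable_le) auto
  qed auto
  have pre: "(\<lambda>\<omega>. restrict (\<lambda>i. \<xi> i \<omega>) (J q)) -` C q \<inter> space M = block_event (\<beta> q) (s q) (f q) L \<delta>" for q
  proof -
    have "(\<Sum>t<n. s q * \<beta> q * restrict (\<lambda>i. \<xi> i \<omega>) (J q) (f q t) - (\<beta> q)\<^sup>2 / 2) =
        (\<Sum>t<n. s q * \<beta> q * \<xi> (f q t) \<omega> - (\<beta> q)\<^sup>2 / 2)" if "n \<in> {1..L}" for n \<omega>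
      using that by (intro sum.cong) (auto simp: J_def)
    then show ?thesis by (auto simp: C_def block_event_def space_PiM)
  qed
  have "prob (\<Inter>q\<in>Q. block_event (\<beta> q) (s q) (f q) L \<delta>) = (\<Prod>q\<in>Q. prob (block_event (\<beta> q) (s q) (f q) L \<delta>))"
    using indep_varsD_finite[OF ind assms(2,1) C] by (simp add: pre)
  also have "\<dots> = (\<Prod>q\<in>Q. stay_below (\<beta> q) L \<delta>)"
  proof (intro prod.cong refl prob_block_event)
    fix q assume q: "q \<in> Q"
    show "inj_on (f q) {..<L}"
    proof (rule inj_onI)
      fix t t' assume "t \<in> {..<L}" "t' \<in> {..<L}" "f q t = f q t'"
      then show "t = t'" using inj_onD[OF inj, of "(q, t)" "(q, t')"] q by auto
    qed
  qed (use \<beta> s ran in auto)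
  finally show ?thesis .
qed

definition psum :: "nat \<Rightarrow> 'a \<Rightarrow> real" where
  "psum j \<omega> = (\<Sum>l=1..j. \<xi> l \<omega>)"

lemma lin_two_level:
  assumes "j \<le> m" "k \<le> m"
  shows "lin (two_level a c j k) \<omega> = (a + c) * psum j \<omega> - c * psum k \<omega>"
proof -
  have "lin (two_level a c j k) \<omega> =
      (\<Sum>l=1..m. (a + c) * (of_bool (l \<le> j) * \<xi> l \<omega>) - c * (of_bool (l \<le> k) * \<xi> l \<omega>))"
    unfolding lin_def two_level_def by (intro sum.cong) (auto simp: algebra_simps)
  also have "\<dots> = (a + c) * psum j \<omega> - c * psum k \<omega>"
    unfolding sum_subtractf sum_distrib_left[symmetric] using assms
    by (subst sum_of_bool_le, simp)+ (simp add: psum_def)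
  finally show ?thesis .
qed

lemma psum_add: "psum (j + n) \<omega> - psum j \<omega> = (\<Sum>t<n. \<xi> (j + 1 + t) \<omega>)"
  by (induction n) (auto simp: psum_def)

lemma psum_sub: "n \<le> j \<Longrightarrow> psum j \<omega> - psum (j - n) \<omega> = (\<Sum>t<n. \<xi> (j - t) \<omega>)"
proof (induction n)
  case (Suc n)
  then have "j - n = Suc (j - Suc n)" by simp
  then have "psum (j - n) \<omega> = psum (j - Suc n) \<omega> + \<xi> (j - n) \<omega>" by (simp add: psum_def)
  then show ?case using Suc by simp
qed simp

end

locale gaussian_window = gaussian_steps M \<xi> m + window \<epsilon> K b m L
  for M :: "'a measure" and \<xi> m \<epsilon> K b L
begin

lemma lin_main_step:
  assumes "j \<le> m" "k \<le> m" "j' \<le> m" "k' \<le> m"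
  shows "lin (main_step j k j' k') \<omega> =
    beta1 b j k * (psum j' \<omega> - psum j \<omega>) - beta2 b j k * (psum k' \<omega> - psum k \<omega>)"
proof -
  have "lin (main_step j k j' k') \<omega> = b * (lin (two_level (level1 j k) (level2 j k) j' k') \<omega> - lin
      (contrast j k) \<omega>)"
    unfolding main_step_def lin_scale lin_diff ..
  then show ?thesis
    unfolding contrast_def using assms by (simp add: lin_two_level beta1_def beta2_def algebra_simps)
qed

text \<open>
  The main part of \<open>b\<close> times the increment of the field from \<open>(j, k)\<close> to \<open>(j', k')\<close>, with half
  its variance subtracted. It is a sum of a walk in \<open>j'\<close> and a walk in \<open>k'\<close>.
\<close>

definition walks :: "nat \<Rightarrow> nat \<Rightarrow> nat \<Rightarrow> nat \<Rightarrow> 'a \<Rightarrow> real" where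
  "walks j k j' k' \<omega> = lin (main_step j k j' k') \<omega> - ip m (main_step j k j' k') (main_step j k j' k') / 2"

text \<open>
  Only neighbours in the two coordinate directions are listed. Since \<open>walks\<close> is additive, the
  other neighbours follow whenever \<open>\<delta> \<le> 0\<close>.
\<close>

definition local_event :: "nat \<Rightarrow> nat \<Rightarrow> real \<Rightarrow> 'a set" where
  "local_event j k \<delta> = {\<omega> \<in> space M. (\<forall>j'. near L j' j \<and> j' \<noteq> j \<longrightarrow> walks j k j' k \<omega> \<le> \<delta>) \<and>
      (\<forall>k'. near L k' k \<and> k' \<noteq> k \<longrightarrow> walks j k j k' \<omega> \<le> \<delta>)}"

lemma near_refl [simp]: "near L j j"
  by (simp add: near_def)

lemma walks_axes:
  assumes p: "(j, k) \<in> inner_pairs \<epsilon> b m" and n: "n \<le> L"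
  shows "walks j k (j + n) k \<omega> = (\<Sum>t<n. 1 * beta1 b j k * \<xi> (j + 1 + t) \<omega> - (beta1 b j k)\<^sup>2 / 2)"
    and "walks j k (j - n) k \<omega> = (\<Sum>t<n. - 1 * beta1 b j k * \<xi> (j - t) \<omega> - (beta1 b j k)\<^sup>2 / 2)"
    and "walks j k j (k + n) \<omega> = (\<Sum>t<n. - 1 * beta2 b j k * \<xi> (k + 1 + t) \<omega> - (beta2 b j k)\<^sup>2 / 2)"
    and "walks j k j (k - n) \<omega> = (\<Sum>t<n. 1 * beta2 b j k * \<xi> (k - t) \<omega> - (beta2 b j k)\<^sup>2 / 2)"
proof -
  note d = inner_pairs_D[OF p] and w = window_pairs[OF p near_refl near_refl]
  have le: "j \<le> m" "k \<le> m" "j + n \<le> m" "k + n \<le> m" "n \<le> j" "n \<le> k" "j - n \<le> m" "k - n \<le> m" using d w n by auto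
  have nr: "near L (j + n) j" "near L (j - n) j" "near L (k + n) k" "near L (k - n) k" using n by (auto
      simp: near_def)
  show "walks j k (j + n) k \<omega> = (\<Sum>t<n. 1 * beta1 b j k * \<xi> (j + 1 + t) \<omega> - (beta1 b j k)\<^sup>2 / 2)"
    unfolding walks_def ip_main_step[OF p nr(1) near_refl] using le
    by (simp add: lin_main_step psum_add sum_subtractf sum_distrib_left)
  show "walks j k j (k + n) \<omega> = (\<Sum>t<n. - 1 * beta2 b j k * \<xi> (k + 1 + t) \<omega> - (beta2 b j k)\<^sup>2 / 2)"
    unfolding walks_def ip_main_step[OF p near_refl nr(3)] using le
    by (simp add: lin_main_step psum_add sum_subtractf sum_distrib_left sum_negf)
  have "psum (j - n) \<omega> - psum j \<omega> = - (\<Sum>t<n. \<xi> (j - t) \<omega>)" "psum (k - n) \<omega> - psum k \<omega> = - (\<Sum>t<n. \<xi> (k - t) \<omega>)"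
    using psum_sub[of n j \<omega>] psum_sub[of n k \<omega>] le by linarith+
  note ps = this
  show "walks j k (j - n) k \<omega> = (\<Sum>t<n. - 1 * beta1 b j k * \<xi> (j - t) \<omega> - (beta1 b j k)\<^sup>2 / 2)"
    unfolding walks_def ip_main_step[OF p nr(2) near_refl] using le
    by (simp add: lin_main_step ps sum_subtractf sum_distrib_left sum_negf of_nat_diff)
  show "walks j k j (k - n) \<omega> = (\<Sum>t<n. 1 * beta2 b j k * \<xi> (k - t) \<omega> - (beta2 b j k)\<^sup>2 / 2)"
    unfolding walks_def ip_main_step[OF p near_refl nr(4)] using le
    by (simp add: lin_main_step ps sum_subtractf sum_distrib_left sum_negf of_nat_diff)
qed

text \<open>
  To the right and to the left of \<open>j\<close>, and to the right and to the left of \<open>k\<close>, one sees four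
  walks with steps of variance \<open>\<beta>\<^sup>2\<close> and mean \<open>- \<beta>\<^sup>2 / 2\<close>; they use disjoint blocks of
  variables.
\<close>

lemma prob_local_event:
  assumes p: "(j, k) \<in> inner_pairs \<epsilon> b m"
  shows "prob (local_event j k \<delta>) = (stay_below (beta1 b j k) L \<delta>)\<^sup>2 * (stay_below (beta2 b j k) L \<delta>)\<^sup>2"
proof -
  note d = inner_pairs_D[OF p] and w = window_pairs[OF p near_refl near_refl]
  define \<beta> where "\<beta> = (\<lambda>q::nat. if q < 2 then beta1 b j k else beta2 b j k)"
  define s where "s = (\<lambda>q::nat. if q = 0 \<or> q = 3 then 1 else - 1 :: real)"
  define f where "f = (\<lambda>q::nat. \<lambda>t. if q = 0 then j + 1 + t else if q = 1 then j - t else if q = 2 then k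
      + 1 + t else k - t)"
  define B where "B = (\<lambda>q. block_event (\<beta> q) (s q) (f q) L \<delta>)"
  have q4: "{..<4::nat} = {0, 1, 2, 3}" by auto
  have bpos: "0 < \<beta> q" for q
    using b d levels_sq[OF d(1,2)] by (simp add: \<beta>_def beta1_def beta2_def)
  have "prob (\<Inter>q\<in>{..<4}. B q) = (\<Prod>q\<in>{..<4}. stay_below (\<beta> q) L \<delta>)"
    unfolding B_def
  proof (rule prob_blocks)
    show "inj_on (\<lambda>(q, t). f q t) ({..<4} \<times> {..<L})"
      using w d by (auto simp: inj_on_def f_def q4)
    show "f q t \<in> {1..m}" if "t < L" for q t
      using w d that by (auto simp: f_def)
  qed (auto simp: bpos s_def q4)
  also have "\<dots> = (stay_below (beta1 b j k) L \<delta>)\<^sup>2 * (stay_below (beta2 b j k) L \<delta>)\<^sup>2"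
    unfolding q4 by (simp add: \<beta>_def power2_eq_square)
  also have "(\<Inter>q\<in>{..<4}. B q) = local_event j k \<delta>"
  proof -
    have 0: "B 0 = {\<omega> \<in> space M. \<forall>n\<in>{1..L}. walks j k (j + n) k \<omega> \<le> \<delta>}"
      unfolding B_def block_event_def by (auto simp: walks_axes[OF p] \<beta>_def s_def f_def)
    have 1: "B 1 = {\<omega> \<in> space M. \<forall>n\<in>{1..L}. walks j k (j - n) k \<omega> \<le> \<delta>}"
      unfolding B_def block_event_def by (auto simp: walks_axes[OF p] \<beta>_def s_def f_def)
    have 2: "B 2 = {\<omega> \<in> space M. \<forall>n\<in>{1..L}. walks j k j (k + n) \<omega> \<le> \<delta>}"
      unfolding B_def block_event_def by (auto simp: walks_axes[OF p] \<beta>_def s_def f_def)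
    have 3: "B 3 = {\<omega> \<in> space M. \<forall>n\<in>{1..L}. walks j k j (k - n) \<omega> \<le> \<delta>}"
      unfolding B_def block_event_def by (auto simp: walks_axes[OF p] \<beta>_def s_def f_def)
    have nb: "(\<forall>a'. near L a' a \<and> a' \<noteq> a \<longrightarrow> P a') \<longleftrightarrow> (\<forall>n\<in>{1..L}. P (a + n)) \<and> (\<forall>n\<in>{1..L}. P (a - n))"
      if "L < a" for P a
    proof
      assume *: "\<forall>a'. near L a' a \<and> a' \<noteq> a \<longrightarrow> P a'"
      show "(\<forall>n\<in>{1..L}. P (a + n)) \<and> (\<forall>n\<in>{1..L}. P (a - n))"
      proof (intro conjI ballI)
        fix n assume n: "n \<in> {1..L}"
        show "P (a + n)" by (rule *[rule_format]) (use n in \<open>auto simp: near_def\<close>)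
        show "P (a - n)" by (rule *[rule_format]) (use n that in \<open>auto simp: near_def\<close>)
      qed
    next
      assume *: "(\<forall>n\<in>{1..L}. P (a + n)) \<and> (\<forall>n\<in>{1..L}. P (a - n))"
      show "\<forall>a'. near L a' a \<and> a' \<noteq> a \<longrightarrow> P a'"
      proof (intro allI impI)
        fix a' assume a': "near L a' a \<and> a' \<noteq> a"
        show "P a'"
        proof (cases "a < a'")
          case True
          then have "a' - a \<in> {1..L}" "a' = a + (a' - a)" using a' by (auto simp: near_def)
          then show ?thesis using * by metis
        next
          case False
          then have "a - a' \<in> {1..L}" "a' = a - (a - a')" using a' by (auto simp: near_def)
          then show ?thesis using * by metis
        qed
      qed
    qed
    have "L < k" using w by simp
    show ?thesis
      unfolding q4 local_event_def nb[OF w(9)] nb[OF \<open>L < k\<close>]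
      using 0 1 2 3 by auto
  qed
  finally show ?thesis .
qed

end

section \<open>Local maxima near a single pair\<close>

context gaussian_window begin

definition near_pairs :: "nat \<Rightarrow> nat \<Rightarrow> (nat \<times> nat) set" where
  "near_pairs j k = {(j', k'). near L j' j \<and> near L k' k} - {(j, k)}"

lemma near_pairs_card: "finite (near_pairs j k)" "card (near_pairs j k) \<le> (2 * L + 1)\<^sup>2"
proof -
  have sub: "near_pairs j k \<subseteq> {j - L..j + L} \<times> {k - L..k + L}"
    by (auto simp: near_pairs_def near_def)
  then show "finite (near_pairs j k)" by (rule finite_subset) simp
  have "card (near_pairs j k) \<le> card ({j - L..j + L} \<times> {k - L..k + L})"
    using sub by (intro card_mono) auto
  also have "\<dots> \<le> (2 * L + 1) * (2 * L + 1)" unfolding card_cartesian_product by (intro mult_mono) auto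
  finally show "card (near_pairs j k) \<le> (2 * L + 1)\<^sup>2" by (simp add: power2_eq_square)
qed

lemma near_pairs_D: "(j', k') \<in> near_pairs j k \<Longrightarrow> near L j' j \<and> near L k' k \<and> (j' \<noteq> j \<or> k' \<noteq> k)"
  by (auto simp: near_pairs_def)

definition bad_bound :: "real \<Rightarrow> real" where
  "bad_bound \<delta> = (2 * real L + 1)\<^sup>2 * (4 * window_const / (b * \<delta>))"

definition bad_event :: "nat \<Rightarrow> nat \<Rightarrow> real \<Rightarrow> real \<Rightarrow> 'a set" where
  "bad_event j k s \<delta> = (\<Union>(j', k')\<in>near_pairs j k. {\<omega> \<in> space M. \<delta> / 2 \<le> s * lin (resid_err j k j' k') \<omega>})"

lemma bad_event_sets: "bad_event j k s \<delta> \<in> sets M"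
  unfolding bad_event_def using near_pairs_card(1)
  by (intro sets.finite_UN) (auto simp: case_prod_beta)

lemma prob_bad_event:
  assumes p: "(j, k) \<in> inner_pairs \<epsilon> b m" and "0 < \<delta>" and s: "\<bar>s\<bar> = 1"
  shows "prob (bad_event j k s \<delta>) \<le> bad_bound \<delta>"
proof -
  define c where "c = 4 * window_const / (b * \<delta>)"
  have c0: "0 \<le> c" unfolding c_def using window_const_ge b assms by simp
  have one: "prob {\<omega> \<in> space M. \<delta> / 2 \<le> s * lin (resid_err j k j' k') \<omega>} \<le> c" if "(j', k') \<in> near_pairs j
      k" for j' k'
  proof -
    note nr = near_pairs_D[OF that]
    have "ip m (\<lambda>l. s * resid_err j k j' k' l) (\<lambda>l. s * resid_err j k j' k' l) = s\<^sup>2 * ip m (resid_err j k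
        j' k') (resid_err j k j' k')"
      unfolding ip_lin by (simp add: power2_eq_square)
    also have "s\<^sup>2 = 1" using s by (metis abs_1 power2_eq_iff_nonneg power2_abs one_power2)
    finally have n: "ip m (\<lambda>l. s * resid_err j k j' k' l) (\<lambda>l. s * resid_err j k j' k' l) = ip m
        (resid_err j k j' k') (resid_err j k j' k')"
      by simp
    have "prob {\<omega> \<in> space M. \<delta> / 2 \<le> lin (\<lambda>l. s * resid_err j k j' k' l) \<omega>} \<le>
        sqrt (ip m (resid_err j k j' k') (resid_err j k j' k')) / (\<delta> / 2)"
      unfolding n[symmetric] using assms(2) by (intro prob_lin_ge_le) auto
    also have "\<dots> \<le> (2 * window_const / b) / (\<delta> / 2)"
      using ip_resid_err[OF p] nr assms(2) by (intro divide_right_mono) auto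
    also have "\<dots> = c" by (simp add: c_def)
    finally show ?thesis by (simp add: lin_scale)
  qed
  have "prob (bad_event j k s \<delta>) \<le> (\<Sum>q\<in>near_pairs j k. prob (case q of (j', k') \<Rightarrow> {\<omega> \<in> space M. \<delta> / 2 \<le> s
      * lin (resid_err j k j' k') \<omega>}))"
    unfolding bad_event_def using near_pairs_card(1)
    by (intro finite_measure_subadditive_finite) (auto simp: case_prod_beta)
  also have "\<dots> \<le> real (card (near_pairs j k)) * c"
    using one by (intro sum_bounded_above) auto
  also have "\<dots> \<le> (2 * real L + 1)\<^sup>2 * c"
  proof -
    have "real (card (near_pairs j k)) \<le> real ((2 * L + 1)\<^sup>2)" using near_pairs_card(2) by (simp only:
        of_nat_le_iff)
    then show ?thesis using c0 by (intro mult_right_mono) (auto simp: add_ac)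
  qed
  finally show ?thesis by (simp add: bad_bound_def c_def)
qed

text \<open>
  The regression residual of the statistic at \<open>(j', k')\<close> given the one at \<open>(j, k)\<close>; it is
  orthogonal to \<open>contrast j k\<close>.
\<close>

definition resid :: "nat \<Rightarrow> nat \<Rightarrow> nat \<Rightarrow> nat \<Rightarrow> nat \<Rightarrow> real" where
  "resid j k j' k' l = contrast j' k' l - ip m (contrast j' k') (contrast j k) * contrast j k l"

lemma lin_resid:
  "b * lin (resid j k j' k') \<omega> = lin (main_step j k j' k') \<omega> + lin (resid_err j k j' k') \<omega>" 
  if "(j, k) \<in> inner_pairs \<epsilon> b m" "near L j' j" "near L k' k"
proof -
  have "resid_err j k j' k' = (\<lambda>l. b * resid j k j' k' l - main_step j k j' k' l)"
    by (intro ext) (simp add: resid_err_def[OF that] resid_def)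
  then show ?thesis by (simp add: lin_diff lin_scale)
qed

lemma lin_contrast_resid:
  assumes "(j, k) \<in> inner_pairs \<epsilon> b m" "near L j' j" "near L k' k"
  shows "lin (contrast j' k') \<omega> = lin (resid j k j' k') \<omega> + (1 - half_dist j k j' k') * lin (contrast j k) \<omega>"
proof -
  have "lin (resid j k j' k') \<omega> = lin (contrast j' k') \<omega> - ip m (contrast j' k') (contrast j k) * lin
      (contrast j k) \<omega>"
    unfolding resid_def lin_diff lin_scale ..
  then show ?thesis by (simp add: half_dist_eq[OF assms])
qed

lemma ip_resid_contrast:
  assumes "(j, k) \<in> inner_pairs \<epsilon> b m"
  shows "ip m (resid j k j' k') (contrast j k) = 0"
proof -
  note d = inner_pairs_D[OF assms]
  have "ip m (contrast j k) (contrast j k) = 1" using d by (intro ip_contrast_self) auto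
  then show ?thesis unfolding resid_def ip_lin by simp
qed

lemma prob_contrast_resid:
  assumes "(j, k) \<in> inner_pairs \<epsilon> b m"
  shows "prob {\<omega> \<in> space M. b \<le> lin (contrast j k) \<omega> \<and> (\<forall>(j', k')\<in>near_pairs j k. lin (resid j k j' k') \<omega>
      \<le> t j' k')} =
    normal_tail b * prob {\<omega> \<in> space M. \<forall>(j', k')\<in>near_pairs j k. lin (resid j k j' k') \<omega> \<le> t j' k'}"
proof -
  note d = inner_pairs_D[OF assms]
  have "ip m (contrast j k) (contrast j k) = 1" using d by (intro ip_contrast_self) auto
  from lin_indep_orthogonal[OF this near_pairs_card(1), of j k "\<lambda>(j', k'). resid j k j' k'" "{b..}" "\<lambda>(j',
      k'). t j' k'"]
  show ?thesis using ip_resid_contrast[OF assms] by (simp add: normal_tail_def case_prod_beta)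
qed

lemma resid_event_sets:
  "{\<omega> \<in> space M. \<forall>(j', k')\<in>near_pairs j k. lin (resid j k j' k') \<omega> \<le> t j' k'} \<in> sets M"
  using near_pairs_card(1)
  by (intro sets.sets_Collect_finite_All) (auto simp: case_prod_beta intro!: borel_measurable_le
      lin_measurable)

lemma local_event_sets: "local_event j k \<delta> \<in> sets M"
proof -
  have w: "walks j k j' k' \<in> borel_measurable M" for j' k'
    unfolding walks_def[abs_def] by measurable
  have f: "finite {a'. near L a' a}" for a :: nat
    by (rule finite_subset[of _ "{..a + L}"]) (auto simp: near_def)
  have "local_event j k \<delta> = {\<omega> \<in> space M. \<forall>j'\<in>{j'. near L j' j} - {j}. walks j k j' k \<omega> \<le> \<delta>} \<inter>
      {\<omega> \<in> space M. \<forall>k'\<in>{k'. near L k' k} - {k}. walks j k j k' \<omega> \<le> \<delta>}"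
    by (auto simp: local_event_def)
  also have "\<dots> \<in> sets M"
    using f w by (intro sets.Int sets.sets_Collect_finite_All) (auto intro!: borel_measurable_le)
  finally show ?thesis .
qed

text \<open>
  Let \<open>Z\<close> be the statistic at \<open>(j, k)\<close>. A neighbour is at most \<open>Z\<close> iff its residual is at most
  \<open>half_dist * Z\<close>. Unless \<open>Z \<ge> b + 1\<close>, this forces the residual below \<open>half_dist * (b + 1)\<close>, an
  event that is independent of \<open>Z\<close>. After multiplication by \<open>b\<close> the bound becomes half the
  variance of the main step, up to \<open>O(1 / b)\<close>, and outside an event of probability at most
  \<open>bad_bound \<delta>\<close> the residual may be replaced by the main step.
\<close>

lemma prob_local_max_le:
  assumes p: "(j, k) \<in> inner_pairs \<epsilon> b m" and \<delta>: "0 < \<delta>" "4 * window_const \<le> b * \<delta>"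
  shows "prob {\<omega> \<in> space M. b \<le> lin (contrast j k) \<omega> \<and> (\<forall>(j', k')\<in>near_pairs j k. lin (contrast j' k') \<omega> \<le>
      lin (contrast j k) \<omega>)}
    \<le> normal_tail b * (prob (local_event j k \<delta>) + bad_bound \<delta>) + normal_tail (b + 1)"
proof -
  note d = inner_pairs_D[OF p]
  have vv: "ip m (contrast j k) (contrast j k) = 1" using d by (intro ip_contrast_self) auto
  define Z where "Z = lin (contrast j k)"
  define t where "t = (\<lambda>j' k'. half_dist j k j' k' * (b + 1))"
  define R where "R = {\<omega> \<in> space M. \<forall>(j', k')\<in>near_pairs j k. lin (resid j k j' k') \<omega> \<le> t j' k'}"
  have wb: "window_const / b \<le> \<delta> / 4" using \<delta> b by (simp add: divide_simps mult.commute)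
  have Rsets: "R \<in> sets M" unfolding R_def by (rule resid_event_sets)
  have RZ: "{\<omega> \<in> space M. b \<le> Z \<omega> \<and> (\<forall>(j', k')\<in>near_pairs j k. lin (resid j k j' k') \<omega> \<le> t j' k')} \<in> sets M"
  proof -
    have "{\<omega> \<in> space M. b \<le> Z \<omega> \<and> (\<forall>(j', k')\<in>near_pairs j k. lin (resid j k j' k') \<omega> \<le> t j' k')} = {\<omega> \<in>
        space M. b \<le> Z \<omega>} \<inter> R"
      by (auto simp: R_def)
    then show ?thesis using Rsets unfolding Z_def by auto
  qed
  have "prob {\<omega> \<in> space M. b \<le> Z \<omega> \<and> (\<forall>(j', k')\<in>near_pairs j k. lin (contrast j' k') \<omega> \<le> Z \<omega>)}
    \<le> prob ({\<omega> \<in> space M. b \<le> Z \<omega> \<and> (\<forall>(j', k')\<in>near_pairs j k. lin (resid j k j' k') \<omega> \<le> t j' k')} \<union> {\<omega> \<in>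
        space M. b + 1 \<le> Z \<omega>})"
  proof (intro finite_measure_mono subsetI)
    fix \<omega> assume w: "\<omega> \<in> {\<omega> \<in> space M. b \<le> Z \<omega> \<and> (\<forall>(j', k')\<in>near_pairs j k. lin (contrast j' k') \<omega> \<le> Z \<omega>)}"
    show "\<omega> \<in> {\<omega> \<in> space M. b \<le> Z \<omega> \<and> (\<forall>(j', k')\<in>near_pairs j k. lin (resid j k j' k') \<omega> \<le> t j' k')} \<union> {\<omega>
        \<in> space M. b + 1 \<le> Z \<omega>}"
    proof (cases "b + 1 \<le> Z \<omega>")
      case False
      have "lin (resid j k j' k') \<omega> \<le> t j' k'" if q: "(j', k') \<in> near_pairs j k" for j' k'
      proof -
        note nr = near_pairs_D[OF q]
        have "lin (contrast j' k') \<omega> \<le> Z \<omega>" using w q by auto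
        then have "lin (resid j k j' k') \<omega> \<le> half_dist j k j' k' * Z \<omega>"
          using lin_contrast_resid[OF p, of j' k' \<omega>] nr by (simp add: Z_def algebra_simps)
        also have "\<dots> \<le> half_dist j k j' k' * (b + 1)"
          using False half_dist_nonneg[OF p] nr by (intro mult_left_mono) auto
        finally show ?thesis by (simp add: t_def)
      qed
      then show ?thesis using w by auto
    qed (use w in auto)
  qed (use RZ in \<open>auto simp: Z_def\<close>)
  also have "\<dots> \<le> prob {\<omega> \<in> space M. b \<le> Z \<omega> \<and> (\<forall>(j', k')\<in>near_pairs j k. lin (resid j k j' k') \<omega> \<le> t j'
      k')} + prob {\<omega> \<in> space M. b + 1 \<le> Z \<omega>}"
    using RZ by (intro measure_Un_le) (auto simp: Z_def)
  also have "\<dots> = normal_tail b * prob R + normal_tail (b + 1)"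
    using prob_contrast_resid[OF p, of t] prob_lin_ge[of "contrast j k" "b + 1"] vv by (simp add: Z_def R_def)
  also have "prob R \<le> prob (local_event j k \<delta> \<union> bad_event j k (- 1) \<delta>)"
  proof (intro finite_measure_mono subsetI)
    fix \<omega> assume w: "\<omega> \<in> R"
    show "\<omega> \<in> local_event j k \<delta> \<union> bad_event j k (- 1) \<delta>"
    proof (cases "\<omega> \<in> bad_event j k (- 1) \<delta>")
      case False
      have *: "walks j k j' k' \<omega> \<le> \<delta>" if q: "(j', k') \<in> near_pairs j k" for j' k'
      proof -
        have nr: "near L j' j" "near L k' k" using near_pairs_D[OF q] by auto
        have "\<not> \<delta> / 2 \<le> - 1 * lin (resid_err j k j' k') \<omega>"
          using False q w by (auto simp: bad_event_def R_def)
        then have 1: "- lin (resid_err j k j' k') \<omega> < \<delta> / 2" by simp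
        have "lin (resid j k j' k') \<omega> \<le> half_dist j k j' k' * (b + 1)" using w q by (auto simp: R_def t_def)
        then have "b * lin (resid j k j' k') \<omega> \<le> b * (half_dist j k j' k' * (b + 1))" using b by (intro
            mult_left_mono) auto
        also have "\<dots> = b\<^sup>2 * half_dist j k j' k' + b * half_dist j k j' k'" by (simp add: power2_eq_square
            algebra_simps)
        finally have 2: "lin (main_step j k j' k') \<omega> + lin (resid_err j k j' k') \<omega> \<le> b\<^sup>2 * half_dist j k
            j' k' + b * half_dist j k j' k'"
          using lin_resid[OF p nr] by simp
        have 3: "b * half_dist j k j' k' \<le> window_const / b" by (rule half_dist_le[OF p nr])
        have "(4 * real L / \<epsilon> + 2 * approx_const) / b \<le> window_const / b"
          using window_const_ge b by (intro divide_right_mono) auto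
        then have 4: "b\<^sup>2 * half_dist j k j' k' - ip m (main_step j k j' k') (main_step j k j' k') / 2 \<le>
            window_const / b"
          using half_dist_approx[OF p nr] by linarith
        show ?thesis unfolding walks_def using 1 2 3 4 wb by linarith
      qed
      have "\<forall>j'. near L j' j \<and> j' \<noteq> j \<longrightarrow> walks j k j' k \<omega> \<le> \<delta>" "\<forall>k'. near L k' k \<and> k' \<noteq> k \<longrightarrow> walks j k j k'
          \<omega> \<le> \<delta>"
        using * by (auto simp: near_pairs_def)
      then show ?thesis using w by (auto simp: local_event_def R_def)
    qed simp
  qed (use local_event_sets bad_event_sets in auto)
  also have "\<dots> \<le> prob (local_event j k \<delta>) + prob (bad_event j k (- 1) \<delta>)"
    using local_event_sets bad_event_sets by (intro measure_Un_le) auto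
  also have "\<dots> \<le> prob (local_event j k \<delta>) + bad_bound \<delta>"
    using prob_bad_event[OF p \<delta>(1), of "- 1"] by simp
  finally show ?thesis unfolding Z_def by (simp add: mult_left_mono)
qed

text \<open>
  For \<open>Z \<ge> b\<close> it suffices that the residuals lie strictly below \<open>half_dist * b\<close>, as
  \<open>half_dist \<ge> 0\<close>.
\<close>

lemma prob_local_max_ge:
  assumes p: "(j, k) \<in> inner_pairs \<epsilon> b m" and \<delta>: "0 < \<delta>" "4 * window_const < b * \<delta>"
  shows "normal_tail b * (prob (local_event j k (- \<delta>)) - bad_bound \<delta>) \<le>
    prob {\<omega> \<in> space M. b \<le> lin (contrast j k) \<omega> \<and> (\<forall>(j', k')\<in>near_pairs j k. lin (contrast j' k') \<omega> < lin
        (contrast j k) \<omega>)}"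
proof -
  define Z where "Z = lin (contrast j k)"
  \<comment> \<open>the slack that makes the inequalities between \<open>Z\<close> and its neighbours strict\<close>
  define c where "c = \<delta> / 4 - window_const / b"
  have c: "0 < c" unfolding c_def using \<delta> b by (simp add: divide_simps mult.commute)
  define t where "t = (\<lambda>j' k'. half_dist j k j' k' * b - c / b)"
  define R where "R = {\<omega> \<in> space M. \<forall>(j', k')\<in>near_pairs j k. lin (resid j k j' k') \<omega> \<le> t j' k'}"
  have Rsets: "R \<in> sets M" unfolding R_def by (rule resid_event_sets)
  have "prob (local_event j k (- \<delta>)) \<le> prob (R \<union> bad_event j k 1 \<delta>)"
  proof (intro finite_measure_mono subsetI)
    fix \<omega> assume w: "\<omega> \<in> local_event j k (- \<delta>)"
    show "\<omega> \<in> R \<union> bad_event j k 1 \<delta>"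
    proof (cases "\<omega> \<in> bad_event j k 1 \<delta>")
      case False
      have "lin (resid j k j' k') \<omega> \<le> t j' k'" if q: "(j', k') \<in> near_pairs j k" for j' k'
      proof -
        have nr: "near L j' j" "near L k' k" and ne: "j' \<noteq> j \<or> k' \<noteq> k" using near_pairs_D[OF q] by auto
        note d = inner_pairs_D[OF p] and wp = window_pairs[OF p nr]
        have le: "j \<le> m" "k \<le> m" "j' \<le> m" "k' \<le> m" using d wp by auto
        have add: "walks j k j' k' \<omega> = walks j k j' k \<omega> + walks j k j k' \<omega>"
          unfolding walks_def ip_main_step[OF p nr] ip_main_step[OF p nr(1) near_refl] ip_main_step[OF p
              near_refl nr(2)]
          using le by (simp add: lin_main_step algebra_simps add_divide_distrib)
        have zero: "walks j k j k \<omega> = 0"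
          unfolding walks_def ip_main_step[OF p near_refl near_refl] using le by (simp add: lin_main_step)
        have a: "j' \<noteq> j \<Longrightarrow> walks j k j' k \<omega> \<le> - \<delta>" and b': "k' \<noteq> k \<Longrightarrow> walks j k j k' \<omega> \<le> - \<delta>"
          using w nr by (auto simp: local_event_def)
        have W: "walks j k j' k' \<omega> \<le> - \<delta>"
          using add zero a b' ne \<delta>(1) by (cases "j' = j"; cases "k' = k") auto
        have 1: "lin (resid_err j k j' k') \<omega> < \<delta> / 2"
          using False q w by (auto simp: bad_event_def local_event_def)
        have "(4 * real L / \<epsilon> + 2 * approx_const) / b \<le> window_const / b"
          using window_const_ge b by (intro divide_right_mono) auto
        then have 4: "ip m (main_step j k j' k') (main_step j k j' k') / 2 \<le> b\<^sup>2 * half_dist j k j' k' +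
            window_const / b"
          using half_dist_approx[OF p nr] by linarith
        have "b * lin (resid j k j' k') \<omega> \<le> b\<^sup>2 * half_dist j k j' k' - c"
          unfolding lin_resid[OF p nr] c_def using W 1 4 \<delta>(1) unfolding walks_def by linarith
        also have "\<dots> = b * t j' k'" using b by (simp add: t_def power2_eq_square algebra_simps)
        finally show ?thesis using b by simp
      qed
      then show ?thesis using w by (auto simp: local_event_def R_def)
    qed simp
  qed (use Rsets bad_event_sets in auto)
  also have "\<dots> \<le> prob R + prob (bad_event j k 1 \<delta>)"
    using Rsets bad_event_sets by (intro measure_Un_le) auto
  also have "\<dots> \<le> prob R + bad_bound \<delta>"
    using prob_bad_event[OF p \<delta>(1), of 1] by simp
  finally have "normal_tail b * (prob (local_event j k (- \<delta>)) - bad_bound \<delta>) \<le> normal_tail b * prob R"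
    by (intro mult_left_mono) auto
  also have "\<dots> = prob {\<omega> \<in> space M. b \<le> Z \<omega> \<and> (\<forall>(j', k')\<in>near_pairs j k. lin (resid j k j' k') \<omega> \<le> t j' k')}"
    using prob_contrast_resid[OF p, of t] by (simp add: Z_def R_def)
  also have "\<dots> \<le> prob {\<omega> \<in> space M. b \<le> Z \<omega> \<and> (\<forall>(j', k')\<in>near_pairs j k. lin (contrast j' k') \<omega> < Z \<omega>)}"
  proof (intro finite_measure_mono subsetI)
    fix \<omega> assume w: "\<omega> \<in> {\<omega> \<in> space M. b \<le> Z \<omega> \<and> (\<forall>(j', k')\<in>near_pairs j k. lin (resid j k j' k') \<omega> \<le> t j'
        k')}"
    have "lin (contrast j' k') \<omega> < Z \<omega>" if q: "(j', k') \<in> near_pairs j k" for j' k'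
    proof -
      have nr: "near L j' j" "near L k' k" using near_pairs_D[OF q] by auto
      have "lin (resid j k j' k') \<omega> \<le> half_dist j k j' k' * b - c / b" using w q by (auto simp: t_def)
      moreover have "half_dist j k j' k' * b \<le> half_dist j k j' k' * Z \<omega>"
        using w half_dist_nonneg[OF p nr] by (intro mult_left_mono) auto
      moreover have "0 < c / b" using c b by simp
      ultimately show ?thesis
        using lin_contrast_resid[OF p nr, of \<omega>] by (simp add: Z_def algebra_simps)
    qed
    then show "\<omega> \<in> {\<omega> \<in> space M. b \<le> Z \<omega> \<and> (\<forall>(j', k')\<in>near_pairs j k. lin (contrast j' k') \<omega> < Z \<omega>)}"
      using w by auto
  next
    have "{\<omega> \<in> space M. b \<le> Z \<omega> \<and> (\<forall>(j', k')\<in>near_pairs j k. lin (contrast j' k') \<omega> < Z \<omega>)} =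
        {\<omega> \<in> space M. b \<le> Z \<omega>} \<inter> {\<omega> \<in> space M. \<forall>(j', k')\<in>near_pairs j k. lin (contrast j' k') \<omega> < Z \<omega>}" by
            auto
    also have "\<dots> \<in> sets M"
      unfolding Z_def using near_pairs_card(1)
      by (intro sets.Int sets.sets_Collect_finite_All) (auto simp: case_prod_beta intro!:
          borel_measurable_less borel_measurable_le lin_measurable)
    finally show "{\<omega> \<in> space M. b \<le> Z \<omega> \<and> (\<forall>(j', k')\<in>near_pairs j k. lin (contrast j' k') \<omega> < Z \<omega>)} \<in> sets
        M" .
  qed
  finally show ?thesis by (simp add: Z_def)
qed

end

section \<open>Exceedance probability as a sum over local maxima\<close>

lemma sum_power_dist_le:
  fixes r :: real and j :: nat
  assumes r: "0 \<le> r" "r < 1" and B: "finite B"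
  shows "(\<Sum>i\<in>B. r ^ (i - j + (j - i))) \<le> 2 / (1 - r)"
proof -
  have half: "(\<Sum>i\<in>A. r ^ h i) \<le> 1 / (1 - r)" if "finite A" "inj_on h A" for A :: "nat set" and h
  proof -
    have "(\<Sum>i\<in>A. r ^ h i) = (\<Sum>n\<in>h ` A. r ^ n)" using that by (simp add: sum.reindex)
    also have "\<dots> \<le> (\<Sum>n. r ^ n)" using that r by (intro sum_le_suminf) (auto simp: summable_geometric)
    also have "\<dots> = 1 / (1 - r)" using r by (simp add: suminf_geometric)
    finally show ?thesis .
  qed
  have "(\<Sum>i\<in>B. r ^ (i - j + (j - i))) = (\<Sum>i\<in>B \<inter> {..j}. r ^ (i - j + (j - i))) + (\<Sum>i\<in>B - {..j}. r ^ (i - j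
      + (j - i)))"
    using B by (rule sum.Int_Diff)
  also have "\<dots> \<le> 1 / (1 - r) + 1 / (1 - r)"
    using B by (intro add_mono half) (auto simp: inj_on_def)
  finally show ?thesis by simp
qed

text \<open>
  One half of the exponent gives the factor \<open>exp (- \<kappa> L / 2)\<close>, the other half a product of two
  geometric series.
\<close>

lemma sum_exp_far_le:
  fixes \<kappa> :: real
  assumes "0 < \<kappa>" "finite A" and far: "\<And>j' k'. (j', k') \<in> A \<Longrightarrow> real L \<le> \<bar>real j' - real j\<bar> + \<bar>real k' -
      real k\<bar>"
  shows "(\<Sum>(j', k')\<in>A. exp (- (\<kappa> * (\<bar>real j' - real j\<bar> + \<bar>real k' - real k\<bar>))))
    \<le> exp (- (\<kappa> / 2 * real L)) * (2 / (1 - exp (- \<kappa> / 2)))\<^sup>2"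
proof -
  define r where "r = exp (- \<kappa> / 2)"
  have r: "0 \<le> r" "r < 1" using assms by (auto simp: r_def)
  have pw: "exp (- (\<kappa> / 2 * \<bar>real i' - real i\<bar>)) = r ^ (i' - i + (i - i'))" for i i' :: nat
  proof -
    have "\<bar>real i' - real i\<bar> = real (i' - i + (i - i'))" by (cases "i \<le> i'") (auto simp: of_nat_diff)
    then show ?thesis unfolding r_def exp_of_nat_mult[symmetric] by (simp add: mult.commute)
  qed
  have "(\<Sum>(j', k')\<in>A. exp (- (\<kappa> * (\<bar>real j' - real j\<bar> + \<bar>real k' - real k\<bar>))))
    \<le> (\<Sum>(j', k')\<in>A. exp (- (\<kappa> / 2 * real L)) * (r ^ (j' - j + (j - j')) * r ^ (k' - k + (k - k'))))"
  proof (intro sum_mono, clarify)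
    fix j' k' assume q: "(j', k') \<in> A"
    have "\<kappa> / 2 * real L \<le> \<kappa> / 2 * (\<bar>real j' - real j\<bar> + \<bar>real k' - real k\<bar>)"
      using far[OF q] assms(1) by (intro mult_left_mono) auto
    then have "- (\<kappa> * (\<bar>real j' - real j\<bar> + \<bar>real k' - real k\<bar>)) \<le>
        - (\<kappa> / 2 * real L) + (- (\<kappa> / 2 * \<bar>real j' - real j\<bar>) + - (\<kappa> / 2 * \<bar>real k' - real k\<bar>))"
      by (simp add: algebra_simps)
    then have "exp (- (\<kappa> * (\<bar>real j' - real j\<bar> + \<bar>real k' - real k\<bar>))) \<le>
        exp (- (\<kappa> / 2 * real L)) * (exp (- (\<kappa> / 2 * \<bar>real j' - real j\<bar>)) * exp (- (\<kappa> / 2 * \<bar>real k' - real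
            k\<bar>)))"
      unfolding exp_add[symmetric] by simp
    then show "exp (- (\<kappa> * (\<bar>real j' - real j\<bar> + \<bar>real k' - real k\<bar>))) \<le>
        exp (- (\<kappa> / 2 * real L)) * (r ^ (j' - j + (j - j')) * r ^ (k' - k + (k - k')))"
      by (simp only: pw)
  qed
  also have "\<dots> = exp (- (\<kappa> / 2 * real L)) * (\<Sum>(j', k')\<in>A. r ^ (j' - j + (j - j')) * r ^ (k' - k + (k - k')))"
    by (simp add: sum_distrib_left case_prod_beta)
  also have "\<dots> \<le> exp (- (\<kappa> / 2 * real L)) * (2 / (1 - r))\<^sup>2"
  proof (rule mult_left_mono)
    have "(\<Sum>(j', k')\<in>A. r ^ (j' - j + (j - j')) * r ^ (k' - k + (k - k')))
      \<le> (\<Sum>(j', k')\<in>fst ` A \<times> snd ` A. r ^ (j' - j + (j - j')) * r ^ (k' - k + (k - k')))"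
      using assms(2) r by (intro sum_mono2 subset_fst_snd) auto
    also have "\<dots> = (\<Sum>j'\<in>fst ` A. r ^ (j' - j + (j - j'))) * (\<Sum>k'\<in>snd ` A. r ^ (k' - k + (k - k')))"
      by (simp add: sum_product sum.cartesian_product)
    also have "\<dots> \<le> 2 / (1 - r) * (2 / (1 - r))"
      using r assms(2) by (intro mult_mono sum_power_dist_le) (auto intro!: sum_nonneg)
    finally show "(\<Sum>(j', k')\<in>A. r ^ (j' - j + (j - j')) * r ^ (k' - k + (k - k'))) \<le> (2 / (1 - r))\<^sup>2"
      by (simp add: power2_eq_square)
  qed simp
  finally show ?thesis by (simp add: r_def)
qed

definition all_pairs :: "nat \<Rightarrow> (nat \<times> nat) set" where
  "all_pairs m = {(j, k). 0 < j \<and> j < k \<and> k \<le> m}"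

lemma finite_all_pairs [simp]: "finite (all_pairs m)"
  by (rule finite_subset[of _ "{..m} \<times> {..m}"]) (auto simp: all_pairs_def)

lemma (in scale) inner_subset: "inner_pairs \<epsilon> b m \<subseteq> all_pairs m"
  using inner_pairs_D by (auto simp: all_pairs_def) (metis less_imp_le)+

text \<open>
  The rate at which the probability of a joint exceedance decays with the distance of the two
  pairs.
\<close>

definition (in scale) kappa :: real where "kappa = \<epsilon> / (16 * K\<^sup>2)"

text \<open>
  An upper bound for the sum of \<open>exp (- \<kappa> d)\<close> over the pairs at distance \<open>d \<ge> L\<close> from a given
  one.
\<close>

definition far_bound :: "real \<Rightarrow> nat \<Rightarrow> real" where
  "far_bound \<kappa> L = exp (- (\<kappa> / 2 * real L)) * (2 / (1 - exp (- \<kappa> / 2)))\<^sup>2"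

context gaussian_window begin

abbreviation Z :: "nat \<times> nat \<Rightarrow> 'a \<Rightarrow> real" where
  "Z p \<equiv> lin (contrast (fst p) (snd p))"

lemma finite_inner [simp]: "finite (inner_pairs \<epsilon> b m)"
  using inner_subset finite_all_pairs by (rule finite_subset)

lemma ip_contrast_1: "p \<in> all_pairs m \<Longrightarrow> ip m (contrast (fst p) (snd p)) (contrast (fst p) (snd p)) = 1"
  by (auto simp: all_pairs_def intro!: ip_contrast_self)

lemma prob_far_pair_le:
  assumes p: "p \<in> inner_pairs \<epsilon> b m" and q: "q \<in> inner_pairs \<epsilon> b m"
  shows "prob {\<omega> \<in> space M. b \<le> Z p \<omega> \<and> b \<le> Z q \<omega>} \<le> std_normal_density b / b *
    exp (- (kappa * (\<bar>real (fst q) - real (fst p)\<bar> + \<bar>real (snd q) - real (snd p)\<bar>)))"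
proof -
  obtain j k j' k' where pq: "p = (j, k)" "q = (j', k')" by (metis surj_pair)
  have 1: "ip m (contrast j k) (contrast j k) = 1" "ip m (contrast j' k') (contrast j' k') = 1"
    using ip_contrast_1[of p] ip_contrast_1[of q] p q inner_subset by (auto simp: pq)
  define D where "D = ip m (\<lambda>l. contrast j k l - contrast j' k' l) (\<lambda>l. contrast j k l - contrast j' k' l)"
  define s where "s = \<bar>real j' - real j\<bar> + \<bar>real k' - real k\<bar>"
  have "\<epsilon> / (2 * K\<^sup>2 * b\<^sup>2) * s \<le> D"
    unfolding D_def s_def using ip_diff_ge p q by (simp add: pq)
  then have "b\<^sup>2 * (\<epsilon> / (2 * K\<^sup>2 * b\<^sup>2) * s) / 8 \<le> b\<^sup>2 * D / 8"
    by (intro divide_right_mono mult_left_mono) auto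
  moreover have "b\<^sup>2 * (\<epsilon> / (2 * K\<^sup>2 * b\<^sup>2) * s) / 8 = kappa * s"
    using b by (simp add: kappa_def)
  ultimately have "exp (- (b\<^sup>2 * D / 8)) \<le> exp (- (kappa * s))" by simp
  then have "std_normal_density b / b * exp (- (b\<^sup>2 * D / 8)) \<le> std_normal_density b / b * exp (- (kappa *
      s))"
    using b by (intro mult_left_mono) auto
  then show ?thesis
    using prob_both_ge_le[OF 1 b] unfolding D_def[symmetric] pq by (simp add: s_def)
qed

lemma prob_opposite_pair_le:
  assumes p: "p \<in> inner_pairs \<epsilon> b m" and q: "q \<in> inner_pairs \<epsilon> b m"
  shows "prob {\<omega> \<in> space M. b \<le> Z p \<omega> \<and> b \<le> - Z q \<omega>} \<le> std_normal_density b / b * exp (- (b\<^sup>2 * (\<epsilon>\<^sup>2 /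
      K\<^sup>2) / 8))"
proof -
  obtain j k j' k' where pq: "p = (j, k)" "q = (j', k')" by (metis surj_pair)
  have "ip m (\<lambda>l. - 1 * contrast j' k' l) (\<lambda>l. - 1 * contrast j' k' l) = ip m (contrast j' k') (contrast
      j' k')"
    by (simp only: ip_lin(5) ip_lin(6))
  then have 1: "ip m (contrast j k) (contrast j k) = 1" "ip m (\<lambda>l. - 1 * contrast j' k' l) (\<lambda>l. - 1 *
      contrast j' k' l) = 1"
    using ip_contrast_1[of p] ip_contrast_1[of q] p q inner_subset by (auto simp: pq)
  define D where "D = ip m (\<lambda>l. contrast j k l + contrast j' k' l) (\<lambda>l. contrast j k l + contrast j' k' l)"
  have "\<epsilon>\<^sup>2 / K\<^sup>2 \<le> D" unfolding D_def using ip_sum_ge p q by (simp add: pq)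
  then have "b\<^sup>2 * (\<epsilon>\<^sup>2 / K\<^sup>2) / 8 \<le> b\<^sup>2 * D / 8"
    by (intro divide_right_mono mult_left_mono) auto
  then have "exp (- (b\<^sup>2 * D / 8)) \<le> exp (- (b\<^sup>2 * (\<epsilon>\<^sup>2 / K\<^sup>2) / 8))"
    by simp
  then have "std_normal_density b / b * exp (- (b\<^sup>2 * D / 8)) \<le> std_normal_density b / b * exp (- (b\<^sup>2 *
      (\<epsilon>\<^sup>2 / K\<^sup>2) / 8))"
    using b by (intro mult_left_mono) auto
  moreover have "lin (\<lambda>l. - 1 * contrast j' k' l) \<omega> = - lin (contrast j' k') \<omega>" for \<omega>
    unfolding lin_scale by simp
  ultimately show ?thesis
    using prob_both_ge_le[OF 1 b] unfolding D_def pq by simp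
qed

text \<open>
  The sign \<open>s\<close> distinguishes exceedances of \<open>Z\<close> from those of \<open>- Z\<close>.
\<close>

definition strict_max_event :: "real \<Rightarrow> nat \<times> nat \<Rightarrow> 'a set" where
  "strict_max_event s p = {\<omega> \<in> space M. b \<le> s * Z p \<omega> \<and> (\<forall>q\<in>inner_pairs \<epsilon> b m - {p}. \<bar>Z q \<omega>\<bar> < s * Z p \<omega>)}"

lemma strict_max_event_sets: "strict_max_event s p \<in> sets M"
proof -
  have "strict_max_event s p = {\<omega> \<in> space M. b \<le> s * Z p \<omega>} \<inter>
      {\<omega> \<in> space M. \<forall>q\<in>inner_pairs \<epsilon> b m - {p}. \<bar>Z q \<omega>\<bar> < s * Z p \<omega>}"
    by (auto simp: strict_max_event_def)
  also have "\<dots> \<in> sets M"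
    by (intro sets.Int sets.sets_Collect_finite_All borel_measurable_less borel_measurable_le
        borel_measurable_abs borel_measurable_times borel_measurable_const lin_measurable) auto
  finally show ?thesis .
qed

definition local_prob :: "nat \<times> nat \<Rightarrow> real \<Rightarrow> real" where
  "local_prob p \<delta> = (stay_below (beta1 b (fst p) (snd p)) L \<delta>)\<^sup>2 * (stay_below (beta2 b (fst p) (snd p)) L
      \<delta>)\<^sup>2"

text \<open>
  A strict local maximum above \<open>b\<close> is a strict global one unless a pair outside the window also
  exceeds \<open>b\<close> or some pair falls below \<open>- b\<close>. The former has small probability because joint
  exceedances decay geometrically with the distance, the latter because no two contrasts are
  nearly opposite.
\<close>

lemma prob_strict_max_ge:
  assumes p: "p \<in> inner_pairs \<epsilon> b m" and \<delta>: "0 < \<delta>" "4 * window_const < b * \<delta>"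
  shows "normal_tail b * (local_prob p (- \<delta>) - bad_bound \<delta>)
      - std_normal_density b / b * (far_bound kappa L + real (card (inner_pairs \<epsilon> b m)) * exp (- (b\<^sup>2 *
          (\<epsilon>\<^sup>2 / K\<^sup>2) / 8)))
    \<le> prob (strict_max_event 1 p)"
proof -
  let ?I = "inner_pairs \<epsilon> b m"
  obtain j k where pjk: "p = (j, k)" by (cases p)
  define N where "N = near_pairs j k"
  define F where "F = ?I - N - {p}"
  define c where "c = std_normal_density b / b"
  have c0: "0 \<le> c" using b by (simp add: c_def)
  define A where "A = {\<omega> \<in> space M. b \<le> lin (contrast j k) \<omega> \<and> (\<forall>(j', k')\<in>N. lin (contrast j' k') \<omega> < lin
      (contrast j k) \<omega>)}"
  define U where "U = (\<Union>q\<in>F. {\<omega> \<in> space M. b \<le> Z p \<omega> \<and> b \<le> Z q \<omega>})"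
  define V where "V = (\<Union>q\<in>?I. {\<omega> \<in> space M. b \<le> Z p \<omega> \<and> b \<le> - Z q \<omega>})"
  have FI: "F \<subseteq> ?I" "finite F" by (auto simp: F_def)
  have two: "{\<omega> \<in> space M. b \<le> Z p \<omega> \<and> b \<le> s * Z q \<omega>} \<in> sets M" for q s by measurable
  have Usets: "U \<in> sets M" and Vsets: "V \<in> sets M"
    unfolding U_def V_def using FI two[of 1] two[of "- 1"] by (auto intro!: sets.finite_UN)
  have "normal_tail b * (prob (local_event j k (- \<delta>)) - bad_bound \<delta>) \<le> prob A"
    unfolding A_def N_def using p \<delta> by (intro prob_local_max_ge) (auto simp: pjk)
  then have 1: "normal_tail b * (local_prob p (- \<delta>) - bad_bound \<delta>) \<le> prob A"
    using prob_local_event[of j k "- \<delta>"] p by (simp add: pjk local_prob_def)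
  have "prob A \<le> prob (strict_max_event 1 p \<union> U \<union> V)"
  proof (intro finite_measure_mono subsetI)
    fix \<omega> assume w: "\<omega> \<in> A"
    show "\<omega> \<in> strict_max_event 1 p \<union> U \<union> V"
    proof (rule ccontr)
      assume no: "\<omega> \<notin> strict_max_event 1 p \<union> U \<union> V"
      have wM: "\<omega> \<in> space M" and wp: "b \<le> Z p \<omega>" using w by (auto simp: A_def pjk)
      obtain q where q: "q \<in> ?I" "q \<noteq> p" "Z p \<omega> \<le> \<bar>Z q \<omega>\<bar>"
        using no wM wp by (auto simp: strict_max_event_def not_less)
      have "\<not> b \<le> - Z q \<omega>" using no wM wp q by (auto simp: V_def)
      then have Zq: "b \<le> Z q \<omega>" "Z p \<omega> \<le> Z q \<omega>" using q(3) wp b by (auto simp: abs_if split: if_splits)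
      then have "q \<notin> F" using no wM wp by (auto simp: U_def)
      then have "q \<in> N" using q by (auto simp: F_def)
      then have "Z q \<omega> < Z p \<omega>" using w by (auto simp: A_def pjk)
      then show False using Zq by simp
    qed
  qed (use strict_max_event_sets Usets Vsets in auto)
  also have "\<dots> \<le> prob (strict_max_event 1 p) + prob U + prob V"
    using strict_max_event_sets Usets Vsets
    by (intro order_trans[OF measure_Un_le] add_right_mono measure_Un_le) auto
  finally have 2: "prob A \<le> prob (strict_max_event 1 p) + prob U + prob V" .
  have "prob U \<le> (\<Sum>q\<in>F. prob {\<omega> \<in> space M. b \<le> Z p \<omega> \<and> b \<le> Z q \<omega>})"
    unfolding U_def using FI two[of 1] by (intro finite_measure_subadditive_finite) auto
  also have "\<dots> \<le> (\<Sum>q\<in>F. c * exp (- (kappa * (\<bar>real (fst q) - real j\<bar> + \<bar>real (snd q) - real k\<bar>))))"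
  proof (intro sum_mono)
    fix q assume "q \<in> F"
    then show "prob {\<omega> \<in> space M. b \<le> Z p \<omega> \<and> b \<le> Z q \<omega>}
        \<le> c * exp (- (kappa * (\<bar>real (fst q) - real j\<bar> + \<bar>real (snd q) - real k\<bar>)))"
      using prob_far_pair_le[OF p, of q] FI unfolding c_def by (auto simp: pjk)
  qed
  also have "\<dots> = c * (\<Sum>(j', k')\<in>F. exp (- (kappa * (\<bar>real j' - real j\<bar> + \<bar>real k' - real k\<bar>))))"
    by (simp add: sum_distrib_left case_prod_beta)
  also have "\<dots> \<le> c * far_bound kappa L"
  proof (intro mult_left_mono c0)
    show "(\<Sum>(j', k')\<in>F. exp (- (kappa * (\<bar>real j' - real j\<bar> + \<bar>real k' - real k\<bar>)))) \<le> far_bound kappa L"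
      unfolding far_bound_def
    proof (rule sum_exp_far_le)
      show "0 < kappa" using eps K by (simp add: kappa_def)
      fix j' k' assume "(j', k') \<in> F"
      then have "\<not> (near L j' j \<and> near L k' k)" by (auto simp: F_def N_def near_pairs_def pjk)
      then show "real L \<le> \<bar>real j' - real j\<bar> + \<bar>real k' - real k\<bar>" by (auto simp: near_abs)
    qed (use FI in auto)
  qed
  finally have 3: "prob U \<le> c * far_bound kappa L" .
  have "prob V \<le> (\<Sum>q\<in>?I. prob {\<omega> \<in> space M. b \<le> Z p \<omega> \<and> b \<le> - Z q \<omega>})"
    unfolding V_def using two[of "- 1"] by (intro finite_measure_subadditive_finite) auto
  also have "\<dots> \<le> real (card ?I) * (c * exp (- (b\<^sup>2 * (\<epsilon>\<^sup>2 / K\<^sup>2) / 8)))"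
    unfolding c_def using prob_opposite_pair_le[OF p] by (intro sum_bounded_above) auto
  finally have 4: "prob V \<le> c * (real (card ?I) * exp (- (b\<^sup>2 * (\<epsilon>\<^sup>2 / K\<^sup>2) / 8)))" by (simp add: mult_ac)
  show ?thesis
    using 1 2 3 4 unfolding c_def[symmetric] distrib_left by linarith
qed

definition weak_max_event :: "real \<Rightarrow> nat \<times> nat \<Rightarrow> 'a set" where
  "weak_max_event s p = {\<omega> \<in> space M. b \<le> s * Z p \<omega> \<and> (\<forall>q\<in>near_pairs (fst p) (snd p). s * Z q \<omega> \<le> s * Z p \<omega>)}"

lemma weak_max_event_sets: "weak_max_event s p \<in> sets M"
proof -
  have "weak_max_event s p = {\<omega> \<in> space M. b \<le> s * Z p \<omega>} \<inter>
      {\<omega> \<in> space M. \<forall>q\<in>near_pairs (fst p) (snd p). s * Z q \<omega> \<le> s * Z p \<omega>}"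
    by (auto simp: weak_max_event_def)
  also have "\<dots> \<in> sets M" using near_pairs_card(1)
    by (intro sets.Int sets.sets_Collect_finite_All borel_measurable_less borel_measurable_le
        borel_measurable_abs borel_measurable_times borel_measurable_const lin_measurable) auto
  finally show ?thesis .
qed

lemma prob_weak_max_le:
  assumes p: "p \<in> inner_pairs \<epsilon> b m" and \<delta>: "0 < \<delta>" "4 * window_const \<le> b * \<delta>"
  shows "prob (weak_max_event 1 p) \<le> normal_tail b * (local_prob p \<delta> + bad_bound \<delta>) + normal_tail (b + 1)"
proof -
  obtain j k where pjk: "p = (j, k)" by (cases p)
  then have p': "(j, k) \<in> inner_pairs \<epsilon> b m" using p by simp
  have "weak_max_event 1 p = {\<omega> \<in> space M. b \<le> lin (contrast j k) \<omega> \<and> (\<forall>(j', k')\<in>near_pairs j k. lin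
      (contrast j' k') \<omega> \<le> lin (contrast j k) \<omega>)}"
    by (auto simp: weak_max_event_def pjk case_prod_beta)
  then show ?thesis
    using prob_local_max_le[OF p' \<delta>] prob_local_event[OF p', of \<delta>] by (simp add: local_prob_def pjk)
qed

text \<open>
  Exceedances of \<open>- Z\<close> are treated by changing the sign of all variables.
\<close>

lemma gaussian_window_uminus: "gaussian_window M (\<lambda>l \<omega>. - \<xi> l \<omega>) m \<epsilon> K b L"
proof -
  have "gaussian_steps M (\<lambda>l \<omega>. - \<xi> l \<omega>) m"
  proof
    show "0 < m" by (rule m_pos)
    show "indep_vars (\<lambda>_. borel) (\<lambda>l \<omega>. - \<xi> l \<omega>) {1..m}"
      by (rule indep_vars_compose2[OF indep, of "\<lambda>_ x. - x"]) auto
    fix l assume "l \<in> {1..m}"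
    from normal_density_affine[OF normal[OF this], of "- 1" 0]
    show "distributed M lborel (\<lambda>\<omega>. - \<xi> l \<omega>) std_normal_density" by simp
  qed
  then show ?thesis by (intro gaussian_window.intro window_axioms)
qed

lemma both_signs:
  assumes p: "p \<in> inner_pairs \<epsilon> b m" and \<delta>: "0 < \<delta>" "4 * window_const < b * \<delta>" and s: "s = 1 \<or> s = - 1"
  shows "normal_tail b * (local_prob p (- \<delta>) - bad_bound \<delta>)
      - std_normal_density b / b * (far_bound kappa L + real (card (inner_pairs \<epsilon> b m)) * exp (- (b\<^sup>2 *
          (\<epsilon>\<^sup>2 / K\<^sup>2) / 8)))
    \<le> prob (strict_max_event s p)" (is "?A \<le> _")
    and "prob (weak_max_event s p) \<le> normal_tail b * (local_prob p \<delta> + bad_bound \<delta>) + normal_tail (b + 1)"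
        (is "_ \<le> ?B")
proof -
  interpret neg: gaussian_window M "\<lambda>l \<omega>. - \<xi> l \<omega>" m \<epsilon> K b L by (rule gaussian_window_uminus)
  have lin: "neg.lin v \<omega> = - lin v \<omega>" for v \<omega> by (simp add: neg.lin_def lin_def sum_negf)
  have st: "neg.strict_max_event 1 p = strict_max_event (- 1) p"
    by (simp add: neg.strict_max_event_def strict_max_event_def lin)
  have wk: "neg.weak_max_event 1 p = weak_max_event (- 1) p"
    by (simp add: neg.weak_max_event_def weak_max_event_def lin near_pairs_def neg.near_pairs_def)
  show "?A \<le> prob (strict_max_event s p)"
    using prob_strict_max_ge[OF p \<delta>] neg.prob_strict_max_ge[OF p \<delta>] s unfolding st by auto
  show "prob (weak_max_event s p) \<le> ?B"
    using prob_weak_max_le[OF p \<delta>(1)] neg.prob_weak_max_le[OF p \<delta>(1)] \<delta>(2) s unfolding wk by auto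
qed

definition exceed_event :: "'a set" where
  "exceed_event = {\<omega> \<in> space M. \<exists>p\<in>all_pairs m. b \<le> \<bar>Z p \<omega>\<bar>}"

lemma exceed_event_sets: "exceed_event \<in> sets M"
proof -
  have "exceed_event = (\<Union>p\<in>all_pairs m. {\<omega> \<in> space M. b \<le> \<bar>Z p \<omega>\<bar>})" by (auto simp: exceed_event_def)
  also have "\<dots> \<in> sets M" by (intro sets.finite_UN) auto
  finally show ?thesis .
qed

lemma near_pairs_all:
  assumes "p \<in> inner_pairs \<epsilon> b m"
  shows "near_pairs (fst p) (snd p) \<subseteq> all_pairs m"
proof
  fix q assume q: "q \<in> near_pairs (fst p) (snd p)"
  obtain j k j' k' where pq: "p = (j, k)" "q = (j', k')" by (metis surj_pair)
  then have p: "(j, k) \<in> inner_pairs \<epsilon> b m" and n: "near L j' j" "near L k' k"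
    using assms q near_pairs_D by auto
  show "q \<in> all_pairs m" using window_pairs[OF p n] by (auto simp: all_pairs_def pq)
qed

text \<open>
  If the maximum of \<open>\<bar>Z\<bar>\<close> is at least \<open>b\<close>, the maximizing pair is either not an inner pair, for
  which the union bound is used, or it is an inner pair at which \<open>Z\<close> or \<open>- Z\<close> has a local
  maximum.
\<close>

lemma prob_exceed_le:
  assumes \<delta>: "0 < \<delta>" "4 * window_const < b * \<delta>"
  shows "prob exceed_event \<le> 2 * real (card (all_pairs m - inner_pairs \<epsilon> b m)) * normal_tail b +
    2 * (\<Sum>p\<in>inner_pairs \<epsilon> b m. normal_tail b * (local_prob p \<delta> + bad_bound \<delta>) + normal_tail (b + 1))"
proof -
  let ?I = "inner_pairs \<epsilon> b m" and ?O = "all_pairs m - inner_pairs \<epsilon> b m"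
  let ?S = "{1, - 1 :: real}"
  define H where "H = (\<lambda>(p, s). {\<omega> \<in> space M. b \<le> s * Z p \<omega>})"
  define G where "G = (\<lambda>(p, s). weak_max_event s p)"
  have HS: "H x \<in> sets M" for x unfolding H_def by (cases x) simp
  have GS: "G x \<in> sets M" for x unfolding G_def by (cases x) (simp add: weak_max_event_sets)
  have "prob exceed_event \<le> prob ((\<Union>x\<in>?O \<times> ?S. H x) \<union> (\<Union>x\<in>?I \<times> ?S. G x))"
  proof (intro finite_measure_mono subsetI)
    fix \<omega> assume w: "\<omega> \<in> exceed_event"
    then have wM: "\<omega> \<in> space M" and ex: "\<exists>p\<in>all_pairs m. b \<le> \<bar>Z p \<omega>\<bar>" by (auto simp: exceed_event_def)
    have ne: "(\<lambda>p. \<bar>Z p \<omega>\<bar>) ` all_pairs m \<noteq> {}" using ex by auto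
    obtain p where p: "p \<in> all_pairs m" and pmax: "\<And>q. q \<in> all_pairs m \<Longrightarrow> \<bar>Z q \<omega>\<bar> \<le> \<bar>Z p \<omega>\<bar>"
    proof -
      have "Max ((\<lambda>p. \<bar>Z p \<omega>\<bar>) ` all_pairs m) \<in> (\<lambda>p. \<bar>Z p \<omega>\<bar>) ` all_pairs m"
        using ne by (intro Max_in) auto
      then obtain p where "p \<in> all_pairs m" "Max ((\<lambda>p. \<bar>Z p \<omega>\<bar>) ` all_pairs m) = \<bar>Z p \<omega>\<bar>" by blast
      moreover have "\<bar>Z q \<omega>\<bar> \<le> Max ((\<lambda>p. \<bar>Z p \<omega>\<bar>) ` all_pairs m)" if "q \<in> all_pairs m" for q
        using that by (intro Max_ge) auto
      ultimately show thesis using that by metis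
    qed
    have pb: "b \<le> \<bar>Z p \<omega>\<bar>" using ex pmax by (meson order_trans)
    define s where "s = (if 0 \<le> Z p \<omega> then 1 else - 1 :: real)"
    have sZ: "\<bar>Z p \<omega>\<bar> = s * Z p \<omega>" and sS: "s \<in> ?S" by (auto simp: s_def)
    show "\<omega> \<in> (\<Union>x\<in>?O \<times> ?S. H x) \<union> (\<Union>x\<in>?I \<times> ?S. G x)"
    proof (cases "p \<in> ?I")
      case False
      then have "\<omega> \<in> H (p, s)" "(p, s) \<in> ?O \<times> ?S" using wM pb p sZ sS by (auto simp: H_def)
      then show ?thesis by blast
    next
      case True
      have "s * Z q \<omega> \<le> s * Z p \<omega>" if "q \<in> near_pairs (fst p) (snd p)" for q
      proof -
        have "q \<in> all_pairs m" using near_pairs_all[OF True] that by auto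
        then have "\<bar>Z q \<omega>\<bar> \<le> s * Z p \<omega>" using pmax sZ by simp
        moreover have "s * Z q \<omega> \<le> \<bar>Z q \<omega>\<bar>" by (auto simp: s_def)
        ultimately show ?thesis by linarith
      qed
      then have "\<omega> \<in> G (p, s)" "(p, s) \<in> ?I \<times> ?S" using wM pb True sZ sS by (auto simp: G_def
          weak_max_event_def)
      then show ?thesis by blast
    qed
  qed (use HS GS in \<open>auto intro!: sets.Un sets.finite_UN\<close>)
  also have "\<dots> \<le> prob (\<Union>x\<in>?O \<times> ?S. H x) + prob (\<Union>x\<in>?I \<times> ?S. G x)"
    using HS GS by (intro measure_Un_le sets.finite_UN) auto
  also have "prob (\<Union>x\<in>?O \<times> ?S. H x) \<le> (\<Sum>x\<in>?O \<times> ?S. prob (H x))"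
    using HS by (intro finite_measure_subadditive_finite) auto
  also have "\<dots> \<le> real (card (?O \<times> ?S)) * normal_tail b"
  proof (rule sum_bounded_above)
    fix x assume x: "x \<in> ?O \<times> ?S"
    then obtain p s where ps: "x = (p, s)" "p \<in> all_pairs m" "s = 1 \<or> s = - 1" by auto
    have "prob {\<omega> \<in> space M. b \<le> lin (\<lambda>l. s * contrast (fst p) (snd p) l) \<omega>} = normal_tail b"
    proof -
      have "ip m (\<lambda>l. s * contrast (fst p) (snd p) l) (\<lambda>l. s * contrast (fst p) (snd p) l) = 1"
        using ps ip_contrast_1[OF ps(2)] by (auto simp: ip_lin)
      then show ?thesis using prob_lin_ge[of "\<lambda>l. s * contrast (fst p) (snd p) l" b] by simp
    qed
    then show "prob (H x) \<le> normal_tail b" by (simp add: H_def ps lin_scale)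
  qed
  also have "prob (\<Union>x\<in>?I \<times> ?S. G x) \<le> (\<Sum>x\<in>?I \<times> ?S. prob (G x))"
    using GS by (intro finite_measure_subadditive_finite) auto
  also have "\<dots> = (\<Sum>p\<in>?I. \<Sum>s\<in>?S. prob (weak_max_event s p))"
    unfolding sum.cartesian_product G_def by (simp add: case_prod_beta)
  also have "\<dots> \<le> (\<Sum>p\<in>?I. 2 * (normal_tail b * (local_prob p \<delta> + bad_bound \<delta>) + normal_tail (b + 1)))"
  proof (intro sum_mono)
    fix p assume "p \<in> ?I"
    from both_signs(2)[OF this \<delta>, of 1] both_signs(2)[OF this \<delta>, of "- 1"]
    show "(\<Sum>s\<in>?S. prob (weak_max_event s p)) \<le> 2 * (normal_tail b * (local_prob p \<delta> + bad_bound \<delta>) +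
        normal_tail (b + 1))"
      by simp
  qed
  also have "\<dots> = 2 * (\<Sum>p\<in>?I. normal_tail b * (local_prob p \<delta> + bad_bound \<delta>) + normal_tail (b + 1))"
    by (simp add: sum_distrib_left)
  finally show ?thesis by (simp add: card_cartesian_product mult.commute)
qed

text \<open>
  There is at most one strict global maximum, so the probabilities of the pairs being that
  maximum add up.
\<close>

lemma prob_exceed_ge:
  assumes \<delta>: "0 < \<delta>" "4 * window_const < b * \<delta>"
  shows "2 * (\<Sum>p\<in>inner_pairs \<epsilon> b m. normal_tail b * (local_prob p (- \<delta>) - bad_bound \<delta>)
      - std_normal_density b / b * (far_bound kappa L + real (card (inner_pairs \<epsilon> b m)) * exp (- (b\<^sup>2 *
          (\<epsilon>\<^sup>2 / K\<^sup>2) / 8))))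
    \<le> prob exceed_event"
proof -
  let ?I = "inner_pairs \<epsilon> b m"
  let ?S = "{1, - 1 :: real}"
  define E where "E = (\<lambda>(p, s). strict_max_event s p)"
  have ES: "E x \<in> sets M" for x unfolding E_def by (cases x) (simp add: strict_max_event_sets)
  have disj: "disjoint_family_on E (?I \<times> ?S)"
  proof (unfold disjoint_family_on_def, intro ballI impI)
    fix x y assume xy: "x \<in> ?I \<times> ?S" "y \<in> ?I \<times> ?S" "x \<noteq> y"
    obtain p s q t where st: "x = (p, s)" "y = (q, t)" by (metis surj_pair)
    then have e: "x = (p, s)" "y = (q, t)" "p \<in> ?I" "q \<in> ?I" "s \<in> ?S" "t \<in> ?S" using xy by auto
    have "False" if w: "\<omega> \<in> E x" "\<omega> \<in> E y" for \<omega>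
    proof -
      have 1: "b \<le> s * Z p \<omega>" "q \<noteq> p \<Longrightarrow> \<bar>Z q \<omega>\<bar> < s * Z p \<omega>" using w e by (auto simp: E_def
          strict_max_event_def)
      have 2: "b \<le> t * Z q \<omega>" "p \<noteq> q \<Longrightarrow> \<bar>Z p \<omega>\<bar> < t * Z q \<omega>" using w e by (auto simp: E_def
          strict_max_event_def)
      have "s * Z p \<omega> \<le> \<bar>Z p \<omega>\<bar>" "t * Z q \<omega> \<le> \<bar>Z q \<omega>\<bar>" using e by auto
      then have "p = q" using 1 2 by (cases "p = q") auto
      moreover have "s \<noteq> t \<Longrightarrow> t = - s" using e by auto
      ultimately show False using 1 2 xy e b by (cases "s = t") auto
    qed
    then show "E x \<inter> E y = {}" by auto
  qed
  have "2 * (\<Sum>p\<in>?I. normal_tail b * (local_prob p (- \<delta>) - bad_bound \<delta>)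
      - std_normal_density b / b * (far_bound kappa L + real (card (inner_pairs \<epsilon> b m)) * exp (- (b\<^sup>2 *
          (\<epsilon>\<^sup>2 / K\<^sup>2) / 8))))
    \<le> (\<Sum>p\<in>?I. \<Sum>s\<in>?S. prob (strict_max_event s p))"
    unfolding sum_distrib_left
  proof (intro sum_mono)
    fix p assume p: "p \<in> ?I"
    have two: "X \<le> u \<Longrightarrow> X \<le> v \<Longrightarrow> 2 * X \<le> u + v" for X u v :: real by simp
    have sS: "(\<Sum>s\<in>?S. prob (strict_max_event s p)) = prob (strict_max_event 1 p) + prob (strict_max_event
        (- 1) p)"
      by simp
    show "2 * (normal_tail b * (local_prob p (- \<delta>) - bad_bound \<delta>)
      - std_normal_density b / b * (far_bound kappa L + real (card (inner_pairs \<epsilon> b m)) * exp (- (b\<^sup>2 *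
          (\<epsilon>\<^sup>2 / K\<^sup>2) / 8))))
      \<le> (\<Sum>s\<in>?S. prob (strict_max_event s p))"
      unfolding sS by (rule two; rule both_signs(1)[OF p \<delta>]; simp)
  qed
  also have "\<dots> = (\<Sum>x\<in>?I \<times> ?S. prob (E x))"
    unfolding sum.cartesian_product E_def by (simp add: case_prod_beta)
  also have "\<dots> = prob (\<Union>x\<in>?I \<times> ?S. E x)"
    using ES disj by (intro finite_measure_finite_Union[symmetric]) auto
  also have "\<dots> \<le> prob exceed_event"
  proof (intro finite_measure_mono exceed_event_sets subsetI)
    fix \<omega> assume "\<omega> \<in> (\<Union>x\<in>?I \<times> ?S. E x)"
    then obtain x where x: "x \<in> ?I \<times> ?S" "\<omega> \<in> E x" by blast
    obtain p s where ps: "x = (p, s)" by (metis surj_pair)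
    have "p \<in> ?I" "s \<in> ?S" "\<omega> \<in> space M" "b \<le> s * Z p \<omega>"
      using x by (auto simp: E_def strict_max_event_def ps)
    moreover from this have "s * Z p \<omega> \<le> \<bar>Z p \<omega>\<bar>" by auto
    ultimately show "\<omega> \<in> exceed_event" using inner_subset by (force simp: exceed_event_def)
  qed
  finally show ?thesis .
qed

end

section \<open>Number of pairs and size of the sum\<close>

text \<open>
  The limiting probability that an exceedance at the pair \<open>p\<close> is a local maximum: each of the
  four walks around \<open>p\<close> has to stay negative.
\<close>

definition clump :: "real \<Rightarrow> nat \<times> nat \<Rightarrow> real" where
  "clump b p = (stay_neg (beta1 b (fst p) (snd p)))\<^sup>2 * (stay_neg (beta2 b (fst p) (snd p)))\<^sup>2"

definition pair_sum :: "real \<Rightarrow> nat \<Rightarrow> real" where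
  "pair_sum b m = (\<Sum>p\<in>all_pairs m. clump b p)"

lemma beta12_pos:
  assumes "0 < b" "p \<in> all_pairs m"
  shows "0 < beta1 b (fst p) (snd p)" "0 < beta2 b (fst p) (snd p)"
proof -
  have jk: "0 < fst p" "fst p < snd p" using assms by (auto simp: all_pairs_def)
  show "0 < beta1 b (fst p) (snd p)" "0 < beta2 b (fst p) (snd p)"
    using levels_sq(3,4)[OF jk] assms(1) by (auto simp: beta1_def beta2_def)
qed

lemma clump_bounds:
  assumes "0 < b" "p \<in> all_pairs m"
  shows "0 \<le> clump b p" "clump b p \<le> 1"
proof -
  show "0 \<le> clump b p" by (simp add: clump_def)
  show "clump b p \<le> 1"
    unfolding clump_def using stay_neg_le_1[OF beta12_pos(1)[OF assms]] stay_neg_le_1[OF beta12_pos(2)[OF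
        assms]]
    by (intro mult_le_one power_le_one stay_neg_nonneg) auto
qed

text \<open>
  The index of the summand is \<open>k - j\<close>. This exchanges the two segments and thereby turns the
  arguments of \<open>nu\<close> into the step sizes \<open>beta2\<close> and \<open>beta1\<close>, whose product is \<open>b\<^sup>2 / (k - j)\<close>.
\<close>

lemma summand_eq_clump:
  assumes b: "0 < b" and jk: "0 < j" "j < k"
  shows "1 / (real (k - j))\<^sup>2 * nu (b * sqrt ((real k - real (k - j)) / (real (k - j) * real k)))
      * nu (b * sqrt (real k / (real (k - j) * (real k - real (k - j))))) = 4 / b ^ 4 * clump b (j, k)"
proof -
  have r: "real (k - j) = real k - real j" using jk by (simp add: of_nat_diff)
  have a2: "b * sqrt ((real k - real (k - j)) / (real (k - j) * real k)) = beta2 b j k"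
    unfolding r by (simp add: beta2_def level2_def mult.commute)
  have a1: "b * sqrt (real k / (real (k - j) * (real k - real (k - j)))) = beta1 b j k"
    unfolding r beta1_def levels_sum(1)[OF jk] by (simp add: mult.commute)
  have pos: "0 < beta1 b j k" "0 < beta2 b j k"
    using beta12_pos[OF b, of "(j, k)" k] jk by (auto simp: all_pairs_def)
  have "(beta1 b j k)\<^sup>2 = b\<^sup>2 * (real k / (real j * (real k - real j)))"
    using jk unfolding beta1_def levels_sum(1)[OF jk] by (simp add: power_mult_distrib)
  moreover have "(beta2 b j k)\<^sup>2 = b\<^sup>2 * (real j / (real k * (real k - real j)))"
    using jk unfolding beta2_def level2_def by (simp add: power_mult_distrib)
  ultimately have "(beta1 b j k)\<^sup>2 * (beta2 b j k)\<^sup>2 = b ^ 4 * (real k / (real j * (real k - real j)) *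
      (real j / (real k * (real k - real j))))"
    by (simp only:) (simp add: eval_nat_numeral)
  also have "real k / (real j * (real k - real j)) * (real j / (real k * (real k - real j))) = 1 / (real k
      - real j)\<^sup>2"
    using jk by (simp add: power2_eq_square)
  finally have "(beta1 b j k)\<^sup>2 * (beta2 b j k)\<^sup>2 * (real k - real j)\<^sup>2 = b ^ 4" using jk by simp
  then have "1 / (real k - real j)\<^sup>2 * (2 / (beta2 b j k)\<^sup>2) * (2 / (beta1 b j k)\<^sup>2) = 4 / b ^ 4"
    by (simp add: field_simps)
  then have "1 / (real k - real j)\<^sup>2 * (2 / (beta2 b j k)\<^sup>2) * (2 / (beta1 b j k)\<^sup>2) * clump b (j, k) = 4
      / b ^ 4 * clump b (j, k)"
    by simp
  note eq = this
  have "1 / (real k - real j)\<^sup>2 * nu (beta2 b j k) * nu (beta1 b j k) =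
      1 / (real k - real j)\<^sup>2 * (2 / (beta2 b j k)\<^sup>2) * (2 / (beta1 b j k)\<^sup>2) * clump b (j, k)"
    unfolding nu_eq_stay_neg[OF pos(1)] nu_eq_stay_neg[OF pos(2)] by (simp add: clump_def mult_ac)
  then show ?thesis unfolding a1 a2 unfolding r by (simp only: eq)
qed

lemma double_sum_eq_pair_sum:
  assumes b: "0 < b"
  shows "(\<Sum>k\<in>{1<..m}. \<Sum>j\<in>{0<..<k}. 1 / (real j)\<^sup>2 * nu (b * sqrt ((real k - real j) / (real j * real k)))
      * nu (b * sqrt (real k / (real j * (real k - real j))))) = 4 / b ^ 4 * pair_sum b m"
proof -
  have "(\<Sum>k\<in>{1<..m}. \<Sum>j\<in>{0<..<k}. 1 / (real j)\<^sup>2 * nu (b * sqrt ((real k - real j) / (real j * real k)))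
      * nu (b * sqrt (real k / (real j * (real k - real j))))) = (\<Sum>k\<in>{1<..m}. \<Sum>j\<in>{0<..<k}. 4 / b ^ 4 *
          clump b (j, k))"
  proof (rule sum.cong[OF refl])
    fix k
    show "(\<Sum>j\<in>{0<..<k}. 1 / (real j)\<^sup>2 * nu (b * sqrt ((real k - real j) / (real j * real k)))
      * nu (b * sqrt (real k / (real j * (real k - real j))))) = (\<Sum>j\<in>{0<..<k}. 4 / b ^ 4 * clump b (j, k))"
      by (rule sum.reindex_bij_witness[of _ "\<lambda>j. k - j" "\<lambda>j. k - j"])
         (use summand_eq_clump[OF b, of "k - j" k for j] in auto)
  qed
  also have "\<dots> = (\<Sum>(k, j)\<in>Sigma {1<..m} (\<lambda>k. {0<..<k}). 4 / b ^ 4 * clump b (j, k))"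
    by (simp add: sum.Sigma)
  also have "\<dots> = (\<Sum>p\<in>all_pairs m. 4 / b ^ 4 * clump b p)"
    by (rule sum.reindex_bij_witness[of _ "\<lambda>(j, k). (k, j)" "\<lambda>(k, j). (j, k)"]) (auto simp: all_pairs_def)
  finally show ?thesis by (simp add: pair_sum_def sum_distrib_left)
qed

lemma card_nat_less_real: "real (card {i::nat. 0 < i \<and> real i < x}) \<le> x" if "0 \<le> x"
proof -
  have "{i::nat. 0 < i \<and> real i < x} \<subseteq> {1..nat \<lfloor>x\<rfloor>}"
    by (auto simp: le_nat_floor)
  then have "card {i::nat. 0 < i \<and> real i < x} \<le> card {1..nat \<lfloor>x\<rfloor>}" by (intro card_mono) auto
  then have "real (card {i::nat. 0 < i \<and> real i < x}) \<le> real (nat \<lfloor>x\<rfloor>)" by simp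
  also have "\<dots> \<le> x" using that by (rule of_nat_floor)
  finally show ?thesis .
qed

text \<open>
  If one of the gaps is below \<open>\<epsilon> b\<^sup>2\<close>, that gap has at most \<open>\<epsilon> b\<^sup>2\<close> positive values, and \<open>m - k\<close>
  may also be \<open>0\<close>; one further number up to \<open>m\<close> determines the pair.
\<close>

lemma (in scale) card_outer:
  assumes "1 \<le> \<epsilon> * b\<^sup>2"
  shows "real (card (all_pairs m - inner_pairs \<epsilon> b m)) \<le> 4 * \<epsilon> * K * b ^ 4"
proof -
  define x where "x = \<epsilon> * b\<^sup>2"
  define A where "A = {i::nat. 0 < i \<and> real i < x}"
  have finA: "finite A" unfolding A_def
    by (rule finite_subset[of _ "{..nat \<lceil>x\<rceil>}"]) (auto simp: le_nat_iff, linarith)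
  have cA: "real (card A) \<le> x" unfolding A_def using assms by (intro card_nat_less_real) (simp add: x_def)
  have sub: "all_pairs m - inner_pairs \<epsilon> b m \<subseteq> A \<times> {1..m} \<union> (\<lambda>(i, k). (k - i, k)) ` (A \<times> {1..m}) \<union>
      (\<lambda>(j, i). (j, m - i)) ` ({1..m} \<times> insert 0 A)"
  proof
    fix p assume p: "p \<in> all_pairs m - inner_pairs \<epsilon> b m"
    obtain j k where jk: "p = (j, k)" by (cases p)
    have d: "0 < j" "j < k" "k \<le> m" using p by (auto simp: jk all_pairs_def)
    consider "real j < x" | "real k - real j < x" | "real m - x < real k"
      using p by (auto simp: jk inner_pairs_def x_def not_le)
    then show "p \<in> A \<times> {1..m} \<union> (\<lambda>(i, k). (k - i, k)) ` (A \<times> {1..m}) \<union> (\<lambda>(j, i). (j, m - i)) ` ({1..m} \<times>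
        insert 0 A)"
    proof cases
      case 1
      then show ?thesis using d by (auto simp: jk A_def)
    next
      case 2
      then have "k - j \<in> A" using d by (simp add: A_def of_nat_diff)
      moreover have "p = (\<lambda>(i, k). (k - i, k)) (k - j, k)" using d by (simp add: jk)
      ultimately show ?thesis using d by (intro UnI1 UnI2 image_eqI[of _ _ "(k - j, k)"]) auto
    next
      case 3
      then have "m - k \<in> insert 0 A" using d by (auto simp add: A_def of_nat_diff)
      moreover have "p = (\<lambda>(j, i). (j, m - i)) (j, m - k)" using d by (simp add: jk)
      ultimately show ?thesis using d by (intro UnI2 image_eqI[of _ _ "(j, m - k)"]) auto
    qed
  qed
  have "card (all_pairs m - inner_pairs \<epsilon> b m) \<le> card (A \<times> {1..m} \<union> (\<lambda>(i, k). (k - i, k)) ` (A \<times> {1..m}) \<union>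
      (\<lambda>(j, i). (j, m - i)) ` ({1..m} \<times> insert 0 A))"
    using sub finA by (intro card_mono) auto
  also have "\<dots> \<le> card (A \<times> {1..m}) + card ((\<lambda>(i, k). (k - i, k)) ` (A \<times> {1..m})) + card ((\<lambda>(j, i). (j, m -
      i)) ` ({1..m} \<times> insert 0 A))"
    by (intro order_trans[OF card_Un_le] add_right_mono card_Un_le)
  also have "\<dots> \<le> card (A \<times> {1..m}) + card (A \<times> {1..m}) + card ({1..m} \<times> insert 0 A)"
    using finA by (intro add_mono card_image_le) auto
  also have "\<dots> = (3 * card A + 1) * m"
    using finA by (simp add: card_cartesian_product A_def algebra_simps)
  finally have "real (card (all_pairs m - inner_pairs \<epsilon> b m)) \<le> (3 * real (card A) + 1) * real m"
    by (metis (mono_tags, opaque_lifting) of_nat_1 of_nat_add of_nat_le_iff of_nat_mult of_nat_numeral)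
  also have "\<dots> \<le> (4 * x) * (K * b\<^sup>2)"
    using cA m_le assms by (intro mult_mono) (auto simp: x_def)
  also have "\<dots> = 4 * \<epsilon> * K * b ^ 4" by (simp add: x_def eval_nat_numeral)
  finally show ?thesis .
qed

lemma card_all_pairs_le: "real (card (all_pairs m)) \<le> (real m)\<^sup>2"
proof -
  have "card (all_pairs m) \<le> card ({1..m} \<times> {1..m})"
    by (intro card_mono) (auto simp: all_pairs_def)
  then have "card (all_pairs m) \<le> m * m" by (simp add: card_cartesian_product)
  then show ?thesis by (metis of_nat_le_iff of_nat_mult power2_eq_square)
qed

lemma card_all_pairs_ge:
  assumes "2 \<le> m"
  shows "(real m)\<^sup>2 / 8 \<le> real (card (all_pairs m))"
proof -
  define h where "h = m div 2"
  have "card ({1..h} \<times> {h<..m}) \<le> card (all_pairs m)"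
    by (intro card_mono finite_all_pairs) (auto simp: all_pairs_def)
  then have "h * (m - h) \<le> card (all_pairs m)" by (simp add: card_cartesian_product)
  then have 1: "real h * real (m - h) \<le> real (card (all_pairs m))" by (metis of_nat_le_iff of_nat_mult)
  have h: "real m / 4 \<le> real h" "real m / 2 \<le> real (m - h)"
  proof -
    have "m \<le> 4 * h" "m \<le> 2 * (m - h)" using assms by (auto simp: h_def)
    then have "real m \<le> real (4 * h)" "real m \<le> real (2 * (m - h))" by (simp_all only: of_nat_le_iff)
    then show "real m / 4 \<le> real h" "real m / 2 \<le> real (m - h)" by simp_all
  qed
  have "(real m)\<^sup>2 / 8 = real m / 4 * (real m / 2)" by (simp add: power2_eq_square)
  also have "\<dots> \<le> real h * real (m - h)" using h by (intro mult_mono) auto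
  finally show ?thesis using 1 by linarith
qed

text \<open>
  A positive proportion of the order \<open>b\<^sup>4\<close> many pairs are inner pairs for a suitable \<open>\<epsilon>\<close>, and
  for them the step sizes are bounded away from \<open>0\<close>.
\<close>

lemma pair_sum_ge:
  assumes "0 < K" "0 < c"
  obtains d b\<^sub>0 where "0 < d" "0 < b\<^sub>0"
    "\<And>b m. b\<^sub>0 \<le> b \<Longrightarrow> c * b\<^sup>2 \<le> real m \<Longrightarrow> real m \<le> K * b\<^sup>2 \<Longrightarrow> d * b ^ 4 \<le> pair_sum b m"
proof -
  \<comment> \<open>then \<open>4 \<epsilon> K b\<^sup>4\<close>, the bound for the pairs that are left out, is half of the lower bound \<open>c\<^sup>2 b\<^sup>4 / 8\<close> for all\<close>
  define \<epsilon> where "\<epsilon> = c\<^sup>2 / (64 * K)"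
  have e: "0 < \<epsilon>" using assms by (simp add: \<epsilon>_def)
  define \<beta> where "\<beta> = sqrt \<epsilon> / K"
  have be: "0 < \<beta>" using e assms by (simp add: \<beta>_def)
  define d where "d = c\<^sup>2 / 16 * (stay_neg \<beta>) ^ 4"
  define b\<^sub>0 where "b\<^sub>0 = 1 + 1 / \<epsilon> + 2 / c"
  have d: "0 < d" using assms stay_neg_pos[OF be] by (simp add: d_def)
  have b0: "0 < b\<^sub>0" "1 \<le> b\<^sub>0" "1 / \<epsilon> \<le> b\<^sub>0" "2 / c \<le> b\<^sub>0" using e assms by (auto simp: b\<^sub>0_def intro!:
      add_pos_pos add_nonneg_nonneg)
  have "d * b ^ 4 \<le> pair_sum b m" if bge: "b\<^sub>0 \<le> b" and m1: "c * b\<^sup>2 \<le> real m" and m2: "real m \<le> K * b\<^sup>2"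
      for b m
  proof -
    have bp: "0 < b" "1 \<le> b" using bge b0 by auto
    interpret scale \<epsilon> K b m by unfold_locales (use e assms bp m2 in auto)
    have bb: "b \<le> b\<^sup>2" using bp by (simp add: power2_eq_square)
    have "1 / \<epsilon> \<le> b\<^sup>2" "2 / c \<le> b\<^sup>2" using bge b0 bb by linarith+
    then have eb: "1 \<le> \<epsilon> * b\<^sup>2" and cb: "2 \<le> c * b\<^sup>2" using e assms by (auto simp: divide_le_eq mult.commute)
    have "2 \<le> m" using cb m1 by linarith
    then have "(real m)\<^sup>2 / 8 \<le> real (card (all_pairs m))" by (rule card_all_pairs_ge)
    moreover have "(c * b\<^sup>2)\<^sup>2 \<le> (real m)\<^sup>2" using m1 assms by (intro power_mono) auto
    moreover have "real (card (all_pairs m)) = real (card (inner_pairs \<epsilon> b m)) + real (card (all_pairs m -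
        inner_pairs \<epsilon> b m))"
      using inner_subset by (metis card_Diff_subset card_mono finite_all_pairs finite_subset
          le_add_diff_inverse of_nat_add)
    moreover have "4 * \<epsilon> * K * b ^ 4 = c\<^sup>2 / 16 * b ^ 4" using assms by (simp add: \<epsilon>_def)
    moreover have "(c * b\<^sup>2)\<^sup>2 = c\<^sup>2 * b ^ 4" by (simp add: power_mult_distrib)
    ultimately have "c\<^sup>2 / 16 * b ^ 4 \<le> real (card (inner_pairs \<epsilon> b m))"
      using card_outer[OF eb] by linarith
    then have "c\<^sup>2 / 16 * b ^ 4 * (stay_neg \<beta>) ^ 4 \<le> real (card (inner_pairs \<epsilon> b m)) * (stay_neg \<beta>) ^ 4"
      by (intro mult_right_mono) auto
    also have "\<dots> \<le> (\<Sum>p\<in>inner_pairs \<epsilon> b m. clump b p)"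
    proof (rule sum_bounded_below)
      fix p assume "p \<in> inner_pairs \<epsilon> b m"
      then have "\<beta> \<le> beta1 b (fst p) (snd p)" "\<beta> \<le> beta2 b (fst p) (snd p)"
        using beta_bounds(3,4)[of "fst p" "snd p"] by (auto simp: \<beta>_def)
      then have "stay_neg \<beta> ^ 2 * stay_neg \<beta> ^ 2 \<le> clump b p"
        unfolding clump_def by (intro mult_mono power_mono stay_neg_mono be stay_neg_nonneg) auto
      then show "stay_neg \<beta> ^ 4 \<le> clump b p" by (simp add: power_add[symmetric])
    qed
    also have "\<dots> \<le> pair_sum b m"
      unfolding pair_sum_def using inner_subset clump_bounds(1)[OF bp(1)] by (intro sum_mono2) auto
    finally show ?thesis by (simp add: d_def mult_ac)
  qed
  then show thesis using that d b0(1) by blast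
qed

lemma stay_below_unit: "0 < \<beta> \<Longrightarrow> 0 \<le> stay_below \<beta> L \<delta> \<and> stay_below \<beta> L \<delta> \<le> 1"
proof -
  assume "0 < \<beta>"
  then interpret gauss_walk \<beta> by unfold_locales
  show ?thesis unfolding stay_below_def by simp
qed

lemma prod_squares_le:
  fixes x y s t \<eta> :: real
  assumes "0 \<le> x" "x \<le> 1" "0 \<le> y" "y \<le> 1" "0 \<le> s" "s \<le> 1" "0 \<le> t" "t \<le> 1" "0 \<le> \<eta>" "x \<le> s + \<eta>" "y \<le> t + \<eta>"
  shows "x\<^sup>2 * y\<^sup>2 \<le> s\<^sup>2 * t\<^sup>2 + 4 * \<eta>"
proof -
  have sq: "u\<^sup>2 \<le> v\<^sup>2 + 2 * \<eta>" if "0 \<le> u" "u \<le> 1" "0 \<le> v" "v \<le> 1" "u \<le> v + \<eta>" for u v :: real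
  proof (cases "u \<le> v")
    case True
    then have "u\<^sup>2 \<le> v\<^sup>2" using that by (intro power_mono) auto
    then show ?thesis using assms(9) by simp
  next
    case False
    have "u\<^sup>2 - v\<^sup>2 = (u - v) * (u + v)" by (simp add: power2_eq_square algebra_simps)
    also have "\<dots> \<le> \<eta> * 2" using False that by (intro mult_mono) auto
    finally show ?thesis by simp
  qed
  have "x\<^sup>2 * y\<^sup>2 \<le> (s\<^sup>2 + 2 * \<eta>) * y\<^sup>2" using sq[of x s] assms by (intro mult_right_mono) auto
  also have "\<dots> \<le> s\<^sup>2 * y\<^sup>2 + 2 * \<eta>"
    using assms by (simp add: distrib_right mult_left_le power_le_one)
  also have "s\<^sup>2 * y\<^sup>2 \<le> s\<^sup>2 * (t\<^sup>2 + 2 * \<eta>)" using sq[of y t] assms by (intro mult_left_mono) auto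
  also have "\<dots> \<le> s\<^sup>2 * t\<^sup>2 + 2 * \<eta>"
  proof -
    have "s\<^sup>2 * (2 * \<eta>) \<le> 1 * (2 * \<eta>)" using assms by (intro mult_right_mono power_le_one) auto
    then show ?thesis by (simp add: distrib_left)
  qed
  finally show ?thesis by simp
qed

text \<open>
  Between \<open>b\<close> and \<open>b + 1\<close> the density drops by the factor \<open>exp (- b - 1 / 2)\<close>, so an exceedance
  of \<open>b\<close> by more than \<open>1\<close> is negligible.
\<close>

lemma normal_tail_shift:
  assumes "1 \<le> b"
  shows "normal_tail (b + 1) \<le> 2 * exp (- b) * normal_tail b" "std_normal_density b / b \<le> 2 * normal_tail b"
proof -
  have "1 + 1 / b\<^sup>2 \<le> 2" using assms by simp
  then have "(1 + 1 / b\<^sup>2) * normal_tail b \<le> 2 * normal_tail b" by (intro mult_right_mono) auto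
  then show 1: "std_normal_density b / b \<le> 2 * normal_tail b" using normal_tail_bounds(2)[of b] assms by
      linarith
  have "normal_tail (b + 1) \<le> std_normal_density (b + 1) / (b + 1)" using assms by (intro
      normal_tail_bounds) auto
  also have "\<dots> \<le> (std_normal_density b * exp (- b)) / b"
  proof (rule frac_le)
    have "exp (- (b + 1)\<^sup>2 / 2) \<le> exp (- b\<^sup>2 / 2) * exp (- b)"
      unfolding exp_add[symmetric] by (simp add: power2_eq_square field_simps)
    then have "1 / sqrt (2 * pi) * exp (- (b + 1)\<^sup>2 / 2) \<le> 1 / sqrt (2 * pi) * (exp (- b\<^sup>2 / 2) * exp (- b))"
      by (rule mult_left_mono) simp
    then show "std_normal_density (b + 1) \<le> std_normal_density b * exp (- b)"
      by (simp add: std_normal_density_def mult.assoc)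
  qed (use assms in auto)
  also have "\<dots> = exp (- b) * (std_normal_density b / b)" by simp
  also have "\<dots> \<le> exp (- b) * (2 * normal_tail b)" using 1 by (intro mult_left_mono) auto
  finally show "normal_tail (b + 1) \<le> 2 * exp (- b) * normal_tail b" by simp
qed

section \<open>The asymptotic equivalence\<close>

text \<open>
  The error is measured against \<open>b\<^sup>4 * normal_tail b\<close>, the order of the union bound. First \<open>\<epsilon>\<close>
  is chosen so small that pairs outside \<open>inner_pairs\<close> do not matter, then the radius \<open>L\<close> and the
  level \<open>\<delta>\<close> so that local and global quantities of the limiting walks agree up to \<open>\<eta>\<close>, and
  finally \<open>b\<close> large enough for the remaining errors to be at most \<open>\<eta>\<close> relative to
  \<open>normal_tail b\<close> for each pair.
\<close>

lemma exceed_prob_approx: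
  assumes K: "0 < K" and e: "0 < e"
  obtains b\<^sub>0 :: real where "0 < b\<^sub>0"
    "\<And>b (M :: 'a measure) \<xi> m. b\<^sub>0 \<le> b \<Longrightarrow> gaussian_steps M \<xi> m \<Longrightarrow> real m \<le> K * b\<^sup>2 \<Longrightarrow>
      \<bar>measure M {\<omega> \<in> space M. \<exists>(j, k)\<in>all_pairs m. b \<le> \<bar>\<Sum>l=1..m. contrast j k l * \<xi> l \<omega>\<bar>}
        - 2 * normal_tail b * pair_sum b m\<bar> \<le> e * b ^ 4 * normal_tail b"
proof -
  \<comment> \<open>pairs outside \<open>inner_pairs\<close> number at most \<open>4 \<epsilon> K b\<^sup>4 = e b\<^sup>4 / 4\<close>; the inner ones number at most \<open>K\<^sup>2 b\<^sup>4\<close>\<close>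
  define \<epsilon> where "\<epsilon> = e / (16 * K)"
  define \<eta> where "\<eta> = e / (48 * K\<^sup>2)"
  have eps: "0 < \<epsilon>" and eta: "0 < \<eta>" using K e by (auto simp: \<epsilon>_def \<eta>_def)
  define \<kappa> where "\<kappa> = \<epsilon> / (16 * K\<^sup>2)"
  have kap: "0 < \<kappa>" using eps K by (simp add: \<kappa>_def)
  have "(far_bound \<kappa> \<longlongrightarrow> 0) sequentially"
    unfolding far_bound_def[abs_def] using kap by real_asymp
  then have "eventually (\<lambda>L. far_bound \<kappa> L < \<eta>) sequentially"
    using eta by (rule order_tendstoD)
  then obtain L\<^sub>0 where L0: "\<And>L. L\<^sub>0 \<le> L \<Longrightarrow> far_bound \<kappa> L < \<eta>" by (auto simp: eventually_sequentially)
  have be: "0 < sqrt \<epsilon> / K" using eps K by simp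
  obtain L \<delta> where L: "L\<^sub>0 \<le> L" and \<delta>: "0 < \<delta>"
    and up: "\<And>\<beta>. sqrt \<epsilon> / K \<le> \<beta> \<Longrightarrow> stay_below \<beta> L \<delta> \<le> stay_neg \<beta> + \<eta>"
    and lo: "\<And>\<beta>. sqrt \<epsilon> / K \<le> \<beta> \<Longrightarrow> stay_neg \<beta> - \<eta> \<le> stay_below \<beta> L (- \<delta>)"
    using stay_below_bounds[OF be eta, of L\<^sub>0] by metis
  define wc where "wc = 1 + 8 * real L / \<epsilon> + 4 * (128 * (real L)\<^sup>2 * K ^ 3 / \<epsilon> ^ 5)"
  define c where "c = \<epsilon>\<^sup>2 / K\<^sup>2 / 8"
  have c: "0 < c" using eps K by (simp add: c_def)
  have "eventually (\<lambda>b::real. 1 \<le> b) at_top" by (rule eventually_ge_at_top)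
  moreover have "eventually (\<lambda>b. 4 * real L + 2 \<le> \<epsilon> * b\<^sup>2) at_top"
    using eps by real_asymp
  moreover have "eventually (\<lambda>b. 4 * wc < b * \<delta>) at_top"
    using \<delta> by real_asymp
  moreover have "eventually (\<lambda>b. (2 * real L + 1)\<^sup>2 * (4 * wc / (b * \<delta>)) < \<eta>) at_top"
  proof -
    have "((\<lambda>b. (2 * real L + 1)\<^sup>2 * (4 * wc / (b * \<delta>))) \<longlongrightarrow> 0) at_top" using \<delta> by real_asymp
    then show ?thesis using eta by (rule order_tendstoD)
  qed
  moreover have "eventually (\<lambda>b::real. 2 * exp (- b) < \<eta>) at_top"
  proof -
    have "((\<lambda>b::real. 2 * exp (- b)) \<longlongrightarrow> 0) at_top" by real_asymp
    then show ?thesis using eta by (rule order_tendstoD)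
  qed
  moreover have "eventually (\<lambda>b. K\<^sup>2 * b ^ 4 * exp (- (b\<^sup>2 * c)) < \<eta>) at_top"
  proof -
    have "((\<lambda>b. K\<^sup>2 * b ^ 4 * exp (- (b\<^sup>2 * c))) \<longlongrightarrow> 0) at_top" using c by real_asymp
    then show ?thesis using eta by (rule order_tendstoD)
  qed
  ultimately have "eventually (\<lambda>b. 1 \<le> b \<and> 4 * real L + 2 \<le> \<epsilon> * b\<^sup>2 \<and> 4 * wc < b * \<delta> \<and>
      (2 * real L + 1)\<^sup>2 * (4 * wc / (b * \<delta>)) < \<eta> \<and> 2 * exp (- b) < \<eta> \<and> K\<^sup>2 * b ^ 4 * exp (- (b\<^sup>2 * c)) <
          \<eta>) at_top"
    by (auto simp: eventually_conj_iff)
  then obtain b\<^sub>1 where b1: "\<And>b. b\<^sub>1 \<le> b \<Longrightarrow> 1 \<le> b \<and> 4 * real L + 2 \<le> \<epsilon> * b\<^sup>2 \<and> 4 * wc < b * \<delta> \<and>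
      (2 * real L + 1)\<^sup>2 * (4 * wc / (b * \<delta>)) < \<eta> \<and> 2 * exp (- b) < \<eta> \<and> K\<^sup>2 * b ^ 4 * exp (- (b\<^sup>2 * c)) < \<eta>"
    unfolding eventually_at_top_linorder by blast
  have main: "\<bar>measure M {\<omega> \<in> space M. \<exists>(j, k)\<in>all_pairs m. B \<le> \<bar>\<Sum>l=1..m. contrast j k l * \<xi> l \<omega>\<bar>}
      - 2 * normal_tail B * pair_sum B m\<bar> \<le> e * B ^ 4 * normal_tail B"
    if Bge: "b\<^sub>1 \<le> B" and gs: "gaussian_steps M \<xi> m" and mK: "real m \<le> K * B\<^sup>2" for B and M :: "'a
        measure" and \<xi> m
  proof -
    have B: "1 \<le> B" "4 * real L + 2 \<le> \<epsilon> * B\<^sup>2" "4 * wc < B * \<delta>"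
      "(2 * real L + 1)\<^sup>2 * (4 * wc / (B * \<delta>)) < \<eta>" "2 * exp (- B) < \<eta>" "K\<^sup>2 * B ^ 4 * exp (- (B\<^sup>2 * c)) < \<eta>"
      using b1[OF Bge] by auto
    interpret gaussian_steps M \<xi> m by (rule gs)
    interpret gaussian_window M \<xi> m \<epsilon> K B L
      by unfold_locales (use eps K B mK in auto)
    define I where "I = inner_pairs \<epsilon> B m"
    define Q where "Q = normal_tail B"
    have Q0: "0 \<le> Q" by (simp add: Q_def)
    have Iall: "I \<subseteq> all_pairs m" unfolding I_def by (rule inner_subset)
    have wcw: "window_const = wc" by (simp add: window_const_def approx_const_def wc_def)
    have bad: "bad_bound \<delta> \<le> \<eta>" using B(4) by (simp add: bad_bound_def wcw)
    have wcd: "4 * window_const < B * \<delta>" using B(3) by (simp add: wcw)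
    have mK2: "(real m)\<^sup>2 \<le> K\<^sup>2 * B ^ 4"
    proof -
      have "(real m)\<^sup>2 \<le> (K * B\<^sup>2)\<^sup>2" using mK by (intro power_mono) auto
      then show ?thesis by (simp add: power_mult_distrib)
    qed
    have cI: "real (card I) \<le> K\<^sup>2 * B ^ 4"
    proof -
      have "real (card I) \<le> real (card (all_pairs m))" using Iall by (simp add: card_mono)
      then show ?thesis using card_all_pairs_le[of m] mK2 by linarith
    qed
    have cO: "real (card (all_pairs m - I)) \<le> e / 4 * B ^ 4"
    proof -
      have "1 \<le> \<epsilon> * B\<^sup>2" using B(2) by simp
      then show ?thesis unfolding I_def using card_outer K by (simp add: \<epsilon>_def)
    qed
    have split: "pair_sum B m = (\<Sum>p\<in>I. clump B p) + (\<Sum>p\<in>all_pairs m - I. clump B p)"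
      unfolding pair_sum_def using Iall by (simp add: sum.subset_diff add.commute)
    have outer: "0 \<le> (\<Sum>p\<in>all_pairs m - I. clump B p)" "(\<Sum>p\<in>all_pairs m - I. clump B p) \<le> e / 4 * B ^ 4"
    proof -
      show "0 \<le> (\<Sum>p\<in>all_pairs m - I. clump B p)"
        using clump_bounds(1)[of B _ m] B by (intro sum_nonneg) auto
      have "(\<Sum>p\<in>all_pairs m - I. clump B p) \<le> real (card (all_pairs m - I)) * 1"
        using clump_bounds(2)[of B _ m] B by (intro sum_bounded_above) auto
      then show "(\<Sum>p\<in>all_pairs m - I. clump B p) \<le> e / 4 * B ^ 4" using cO by linarith
    qed
    have loc: "local_prob p \<delta> \<le> clump B p + 4 * \<eta>" "clump B p \<le> local_prob p (- \<delta>) + 4 * \<eta>" if p: "p \<in> I"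
        for p
    proof -
      have p': "(fst p, snd p) \<in> inner_pairs \<epsilon> B m" using p by (simp add: I_def)
      note bb = beta_bounds(3,4)[OF p']
      have bp: "0 < beta1 B (fst p) (snd p)" "0 < beta2 B (fst p) (snd p)" using bb be by linarith+
      show "local_prob p \<delta> \<le> clump B p + 4 * \<eta>"
        unfolding local_prob_def clump_def
        using up[OF bb(1)] up[OF bb(2)] eta stay_below_unit[OF bp(1)] stay_below_unit[OF bp(2)]
          stay_neg_le_1[OF bp(1)] stay_neg_le_1[OF bp(2)] stay_neg_nonneg
        by (intro prod_squares_le) auto
      show "clump B p \<le> local_prob p (- \<delta>) + 4 * \<eta>"
        unfolding local_prob_def clump_def
        using lo[OF bb(1)] lo[OF bb(2)] eta stay_below_unit[OF bp(1)] stay_below_unit[OF bp(2)]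
          stay_neg_le_1[OF bp(1)] stay_neg_le_1[OF bp(2)] stay_neg_nonneg
        by (intro prod_squares_le) auto
    qed
    have shift: "normal_tail (B + 1) \<le> \<eta> * Q" "std_normal_density B / B \<le> 2 * Q"
    proof -
      have "2 * exp (- B) * normal_tail B \<le> \<eta> * normal_tail B" using B(5) by (intro mult_right_mono) auto
      then show "normal_tail (B + 1) \<le> \<eta> * Q" using normal_tail_shift(1)[OF B(1)] by (simp add: Q_def)
      show "std_normal_density B / B \<le> 2 * Q" unfolding Q_def by (rule normal_tail_shift(2)[OF B(1)])
    qed
    define rest where "rest = far_bound kappa L + real (card I) * exp (- (B\<^sup>2 * (\<epsilon>\<^sup>2 / K\<^sup>2) / 8))"
    have rest0: "0 \<le> rest" by (simp add: rest_def far_bound_def)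
    have rest: "rest \<le> 2 * \<eta>"
    proof -
      have "far_bound kappa L \<le> \<eta>" using L0[OF L] by (simp add: kappa_def \<kappa>_def)
      moreover have c_eq: "B\<^sup>2 * (\<epsilon>\<^sup>2 / K\<^sup>2) / 8 = B\<^sup>2 * c" by (simp add: c_def)
      moreover have "real (card I) * exp (- (B\<^sup>2 * c)) \<le> K\<^sup>2 * B ^ 4 * exp (- (B\<^sup>2 * c))"
        using cI by (intro mult_right_mono) auto
      ultimately show ?thesis using B(6) unfolding rest_def c_eq by linarith
    qed
    have ex: "{\<omega> \<in> space M. \<exists>(j, k)\<in>all_pairs m. B \<le> \<bar>\<Sum>l=1..m. contrast j k l * \<xi> l \<omega>\<bar>} = exceed_event"
      by (auto simp: exceed_event_def lin_def case_prod_beta)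
    have Ieta: "real (card I) * \<eta> \<le> e / 48 * B ^ 4"
    proof -
      have "real (card I) * \<eta> \<le> K\<^sup>2 * B ^ 4 * \<eta>" using cI eta by (intro mult_right_mono) auto
      also have "\<dots> = e / 48 * B ^ 4" using K by (simp add: \<eta>_def)
      finally show ?thesis .
    qed
    define S where "S = (\<Sum>p\<in>I. clump B p)"
    have upper: "prob exceed_event \<le> 2 * Q * pair_sum B m + e * B ^ 4 * Q"
    proof -
      have "(\<Sum>p\<in>I. Q * (local_prob p \<delta> + bad_bound \<delta>) + normal_tail (B + 1)) \<le> (\<Sum>p\<in>I. Q * clump B p + Q *
          (6 * \<eta>))"
      proof (intro sum_mono)
        fix p assume p: "p \<in> I"
        have "Q * (local_prob p \<delta> + bad_bound \<delta>) \<le> Q * (clump B p + 4 * \<eta> + \<eta>)"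
          using loc(1)[OF p] bad Q0 by (intro mult_left_mono add_mono) auto
        then show "Q * (local_prob p \<delta> + bad_bound \<delta>) + normal_tail (B + 1) \<le> Q * clump B p + Q * (6 * \<eta>)"
          using shift(1) by (simp add: algebra_simps)
      qed
      also have "\<dots> = Q * S + Q * (6 * (real (card I) * \<eta>))"
        by (simp add: sum.distrib sum_distrib_left S_def)
      also have "\<dots> \<le> Q * S + Q * (6 * (e / 48 * B ^ 4))"
        using Ieta Q0 by (intro add_left_mono mult_left_mono) auto
      finally have 1: "(\<Sum>p\<in>I. Q * (local_prob p \<delta> + bad_bound \<delta>) + normal_tail (B + 1)) \<le> Q * S + Q * (e /
          8 * B ^ 4)"
        by simp
      have 2: "2 * real (card (all_pairs m - I)) * Q \<le> 2 * (e / 4 * B ^ 4) * Q"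
        using cO Q0 by (intro mult_right_mono mult_left_mono) auto
      have 3: "Q * S \<le> Q * pair_sum B m" unfolding S_def split using outer Q0 by (intro mult_left_mono) auto
      have "0 \<le> e * B ^ 4 * Q" using e Q0 B by simp
      moreover have "Q * (e / 8 * B ^ 4) = e * B ^ 4 * Q / 8" "2 * (e / 4 * B ^ 4) * Q = e * B ^ 4 * Q /
          2" by simp_all
      ultimately show ?thesis
        using prob_exceed_le[OF \<delta> wcd] 1 2 3 unfolding I_def[symmetric] Q_def[symmetric] by linarith
    qed
    have lower: "2 * Q * pair_sum B m - e * B ^ 4 * Q \<le> prob exceed_event"
    proof -
      have "(\<Sum>p\<in>I. Q * clump B p - Q * (9 * \<eta>)) \<le> (\<Sum>p\<in>I. Q * (local_prob p (- \<delta>) - bad_bound \<delta>) -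
          std_normal_density B / B * rest)"
      proof (intro sum_mono)
        fix p assume p: "p \<in> I"
        have "Q * (clump B p - 4 * \<eta> - \<eta>) \<le> Q * (local_prob p (- \<delta>) - bad_bound \<delta>)"
          using loc(2)[OF p] bad Q0 by (intro mult_left_mono) auto
        moreover have "std_normal_density B / B * rest \<le> 2 * Q * (2 * \<eta>)"
          using shift(2) rest rest0 Q0 by (intro mult_mono) auto
        ultimately show "Q * clump B p - Q * (9 * \<eta>) \<le> Q * (local_prob p (- \<delta>) - bad_bound \<delta>) -
            std_normal_density B / B * rest"
          by (simp add: algebra_simps)
      qed
      moreover have "(\<Sum>p\<in>I. Q * clump B p - Q * (9 * \<eta>)) = Q * S - Q * (9 * (real (card I) * \<eta>))"
        by (simp add: sum_subtractf sum_distrib_left S_def)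
      moreover have "Q * (9 * (real (card I) * \<eta>)) \<le> Q * (9 * (e / 48 * B ^ 4))"
        using Ieta Q0 by (intro mult_left_mono) auto
      ultimately have 1: "Q * S - Q * (9 * (e / 48 * B ^ 4)) \<le> (\<Sum>p\<in>I. Q * (local_prob p (- \<delta>) - bad_bound
          \<delta>) - std_normal_density B / B * rest)"
        by linarith
      have "Q * (pair_sum B m - e / 4 * B ^ 4) \<le> Q * S" unfolding S_def split using outer Q0 by (intro
          mult_left_mono) auto
      then have 2: "Q * pair_sum B m - e * B ^ 4 * Q / 4 \<le> Q * S" by (simp add: algebra_simps)
      have "0 \<le> e * B ^ 4 * Q" using e Q0 B by simp
      moreover have "Q * (9 * (e / 48 * B ^ 4)) = e * B ^ 4 * Q * 9 / 48" by simp
      ultimately show ?thesis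
        using prob_exceed_ge[OF \<delta> wcd] 1 2 unfolding I_def[symmetric] Q_def[symmetric] rest_def[symmetric]
            by linarith
    qed
    show ?thesis unfolding ex Q_def[symmetric] abs_le_iff using upper lower by linarith
  qed
  define b\<^sub>0 where "b\<^sub>0 = max 1 b\<^sub>1"
  show thesis
  proof (rule that[of b\<^sub>0])
    show "0 < b\<^sub>0" by (simp add: b\<^sub>0_def)
    fix B and M :: "'a measure" and \<xi> m
    assume "b\<^sub>0 \<le> B" "gaussian_steps M \<xi> m" "real m \<le> K * B\<^sup>2"
    then show "\<bar>measure M {\<omega> \<in> space M. \<exists>(j, k)\<in>all_pairs m. B \<le> \<bar>\<Sum>l=1..m. contrast j k l * \<xi> l \<omega>\<bar>}
        - 2 * normal_tail B * pair_sum B m\<bar> \<le> e * B ^ 4 * normal_tail B"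
      by (intro main) (auto simp: b\<^sub>0_def)
  qed
qed

text \<open>
  The coefficients of a contrast add up to \<open>0\<close>, so the mean cancels.
\<close>

lemma Z_stat_eq_contrast:
  assumes jk: "0 < j" "j < k" "k \<le> m"
  shows "Z_stat Y 0 j k \<omega> = (\<Sum>l=1..m. contrast j k l * (Y l \<omega> - \<mu>))"
proof -
  define a where "a = level1 j k"
  define c where "c = level2 j k"
  define T where "T = (\<lambda>i. \<Sum>l=1..i. Y l \<omega>)"
  have pos: "0 < real j" "0 < real k" "0 < real k - real j" using jk by auto
  have "(\<Sum>l=1..m. contrast j k l * (Y l \<omega> - \<mu>)) =
      (\<Sum>l=1..m. (a + c) * (of_bool (l \<le> j) * (Y l \<omega> - \<mu>)) - c * (of_bool (l \<le> k) * (Y l \<omega> - \<mu>)))"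
    unfolding contrast_def two_level_def a_def c_def by (intro sum.cong) (auto simp: algebra_simps)
  also have "\<dots> = (a + c) * (\<Sum>l=1..j. Y l \<omega> - \<mu>) - c * (\<Sum>l=1..k. Y l \<omega> - \<mu>)"
    unfolding sum_subtractf[of _ _ "{1..m}"] sum_distrib_left[symmetric] using jk
    by (subst sum_of_bool_le, simp)+ simp
  also have "\<dots> = (a + c) * (T j - real j * \<mu>) - c * (T k - real k * \<mu>)"
    by (simp add: T_def sum_subtractf)
  also have "\<dots> = (a + c) * (T j - real j * T k / real k)"
  proof -
    have ck: "c * real k = (a + c) * real j" using levels_sum(2)[OF jk(1,2)] by (simp add: a_def c_def
        algebra_simps)
    then have "c = (a + c) * real j / real k" using pos by (simp add: eq_divide_eq)
    then have cT: "c * T k = (a + c) * real j / real k * T k" by simp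
    have "(a + c) * (T j - real j * \<mu>) - c * (T k - real k * \<mu>) =
        (a + c) * T j - c * T k + \<mu> * (c * real k - (a + c) * real j)" by (simp add: algebra_simps)
    then show ?thesis unfolding cT ck by (simp add: algebra_simps)
  qed
  also have "a + c = 1 / sqrt (real j * (1 - real j / real k))"
  proof -
    have "real k / (real j * (real k - real j)) = 1 / (real j * (1 - real j / real k))"
      using pos by (simp add: field_simps)
    then show ?thesis unfolding a_def c_def levels_sum(1)[OF jk(1,2)] by (simp add: real_sqrt_divide)
  qed
  finally show ?thesis
    by (simp add: Z_stat_def partial_sum_def T_def)
qed

lemma gaussian_steps_centered:
  assumes "prob_space M" "0 < m" "prob_space.indep_vars M (\<lambda>_. borel) Y {1..m}"
    "\<And>l. l \<in> {1..m} \<Longrightarrow> distributed M lborel (Y l) (normal_density \<mu> 1)"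
  shows "gaussian_steps M (\<lambda>l \<omega>. Y l \<omega> - \<mu>) m"
proof -
  interpret prob_space M by fact
  show ?thesis
  proof
    show "0 < m" by fact
    show "indep_vars (\<lambda>_. borel) (\<lambda>l \<omega>. Y l \<omega> - \<mu>) {1..m}"
      by (rule indep_vars_compose2[OF assms(3), of "\<lambda>_ x. x - \<mu>"]) auto
    fix l assume "l \<in> {1..m}"
    from normal_density_affine[OF assms(4)[OF this], of 1 "- \<mu>"]
    show "distributed M lborel (\<lambda>\<omega>. Y l \<omega> - \<mu>) std_normal_density" by simp
  qed
qed

lemma Max_Z_stat_ge_iff:
  assumes "2 \<le> m"
  shows "b \<le> Max {\<bar>Z_stat Y 0 j k \<omega>\<bar> | j k. 0 < j \<and> j < k \<and> k \<le> m} \<longleftrightarrow>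
    (\<exists>(j, k)\<in>all_pairs m. b \<le> \<bar>\<Sum>l=1..m. contrast j k l * (Y l \<omega> - \<mu>)\<bar>)"
proof -
  have eq: "{\<bar>Z_stat Y 0 j k \<omega>\<bar> | j k. 0 < j \<and> j < k \<and> k \<le> m} =
      (\<lambda>(j, k). \<bar>\<Sum>l=1..m. contrast j k l * (Y l \<omega> - \<mu>)\<bar>) ` all_pairs m" (is "?S = ?f ` _")
  proof (intro set_eqI iffI)
    fix z assume "z \<in> ?S"
    then obtain j k where "z = \<bar>Z_stat Y 0 j k \<omega>\<bar>" "0 < j" "j < k" "k \<le> m" by blast
    then show "z \<in> ?f ` all_pairs m"
      using Z_stat_eq_contrast[of j k m Y \<omega> \<mu>] by (intro image_eqI[of _ _ "(j, k)"]) (auto simp: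
          all_pairs_def)
  next
    fix z assume "z \<in> ?f ` all_pairs m"
    then obtain j k where "z = \<bar>\<Sum>l=1..m. contrast j k l * (Y l \<omega> - \<mu>)\<bar>" "0 < j" "j < k" "k \<le> m"
      by (auto simp: all_pairs_def)
    moreover from this have "z = \<bar>Z_stat Y 0 j k \<omega>\<bar>" using Z_stat_eq_contrast[of j k m Y \<omega> \<mu>] by simp
    ultimately show "z \<in> ?S" by blast
  qed
  have "(1, 2) \<in> all_pairs m" using assms by (simp add: all_pairs_def)
  then have ne: "?f ` all_pairs m \<noteq> {}" by blast
  show ?thesis unfolding eq using Max_ge_iff[OF _ ne] by (simp add: case_prod_beta)
qed

theorem theorem2p2:
  fixes M :: "real \<Rightarrow> 'a measure"
    and X :: "real \<Rightarrow> nat \<Rightarrow> 'a \<Rightarrow> real"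
    and m :: "real \<Rightarrow> nat"
    and \<mu> :: real
  assumes "\<And>b. prob_space (M b)"
    and "\<And>b. m b > 0"
    and "\<And>b. prob_space.indep_vars (M b) (\<lambda>_. borel) (X b) {1..m b}"
    and "\<And>b l. l \<in> {1..m b} \<Longrightarrow> distributed (M b) lborel (X b l) (normal_density \<mu> 1)"
    and "(\<lambda>b. real (m b)) \<in> \<Theta>[at_top](\<lambda>b. b\<^sup>2)"
  shows "(\<lambda>b. measure (M b) {\<omega> \<in> space (M b).
              Max {\<bar>Z_stat (X b) 0 j k \<omega>\<bar> | j k. 0 < j \<and> j < k \<and> k \<le> m b} \<ge> b})
         \<sim>[at_top]
         (\<lambda>b. 1 / 2 * b ^ 3 * std_normal_density b *
              (\<Sum>k\<in>{1<..m b}. \<Sum>j\<in>{0<..<k}.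
                 1 / (real j)\<^sup>2
                 * nu (b * sqrt ((real k - real j) / (real j * real k)))
                 * nu (b * sqrt (real k / (real j * (real k - real j))))))"
proof -
  define P where "P = (\<lambda>b. measure (M b) {\<omega> \<in> space (M b).
      Max {\<bar>Z_stat (X b) 0 j k \<omega>\<bar> | j k. 0 < j \<and> j < k \<and> k \<le> m b} \<ge> b})"
  define T where "T = (\<lambda>b. 2 * normal_tail b * pair_sum b (m b))"
  obtain K where K: "0 < K" and mK: "eventually (\<lambda>b. norm (real (m b)) \<le> K * norm (b\<^sup>2)) at_top"
    using landau_o.bigE[OF bigthetaD1[OF assms(5)]] by metis
  obtain c where c: "0 < c" and mc: "eventually (\<lambda>b. norm (real (m b)) \<ge> c * norm (b\<^sup>2)) at_top"
    using landau_omega.bigE[OF bigthetaD2[OF assms(5)]] by metis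
  obtain d b\<^sub>1 where d: "0 < d" and b1: "0 < b\<^sub>1"
    and ps: "\<And>b m. b\<^sub>1 \<le> b \<Longrightarrow> c * b\<^sup>2 \<le> real m \<Longrightarrow> real m \<le> K * b\<^sup>2 \<Longrightarrow> d * b ^ 4 \<le> pair_sum b m"
    using pair_sum_ge[OF K c] by metis
  have large: "eventually (\<lambda>b. 0 < b \<and> b\<^sub>1 \<le> b \<and> c * b\<^sup>2 \<le> real (m b) \<and> real (m b) \<le> K * b\<^sup>2 \<and> 2 \<le> m b)
      at_top"
  proof -
    have "eventually (\<lambda>b. 2 \<le> c * b\<^sup>2) at_top" using c by real_asymp
    with mK mc eventually_gt_at_top[of 0] eventually_ge_at_top[of b\<^sub>1] show ?thesis
    proof eventually_elim
      case (elim b)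
      then have "2 \<le> real (m b)" by simp
      then show ?case using elim by simp
    qed
  qed
  have "((\<lambda>b. P b / T b) \<longlongrightarrow> 1) at_top"
  proof (rule tendstoI)
    fix r :: real assume r: "0 < r"
    define e where "e = d * r"
    have e: "0 < e" using d r by (simp add: e_def)
    obtain b\<^sub>0 where b0: "0 < b\<^sub>0" "\<And>b (M :: 'a measure) \<xi> m. b\<^sub>0 \<le> b \<Longrightarrow> gaussian_steps M \<xi> m \<Longrightarrow> real m \<le> K
        * b\<^sup>2 \<Longrightarrow>
      \<bar>measure M {\<omega> \<in> space M. \<exists>(j, k)\<in>all_pairs m. b \<le> \<bar>\<Sum>l=1..m. contrast j k l * \<xi> l \<omega>\<bar>}
        - 2 * normal_tail b * pair_sum b m\<bar> \<le> e * b ^ 4 * normal_tail b"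
      by (rule exceed_prob_approx[OF K e]) (rule that)
    show "eventually (\<lambda>b. dist (P b / T b) 1 < r) at_top"
      using large eventually_ge_at_top[of b\<^sub>0]
    proof eventually_elim
      case (elim b)
      have Q: "0 < normal_tail b" using elim by (intro normal_tail_pos) auto
      have gs: "gaussian_steps (M b) (\<lambda>l \<omega>. X b l \<omega> - \<mu>) (m b)"
        using assms by (intro gaussian_steps_centered) auto
      have "P b = measure (M b) {\<omega> \<in> space (M b). \<exists>(j, k)\<in>all_pairs (m b). b \<le> \<bar>\<Sum>l=1..m b. contrast j k l
          * (X b l \<omega> - \<mu>)\<bar>}"
        unfolding P_def using elim by (simp only: Max_Z_stat_ge_iff[of "m b" b "X b" _ \<mu>])
      then have dif: "\<bar>P b - T b\<bar> \<le> e * b ^ 4 * normal_tail b"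
        unfolding T_def using b0(2)[OF _ gs] elim by simp
      have "d * b ^ 4 \<le> pair_sum b (m b)" using ps elim by auto
      then have Tge: "2 * normal_tail b * (d * b ^ 4) \<le> T b"
        unfolding T_def using Q by (intro mult_left_mono) auto
      have pos: "0 < normal_tail b * (d * b ^ 4)" using Q d elim by simp
      then have Tpos: "0 < T b" using Tge by linarith
      have "e * b ^ 4 * normal_tail b = r * (normal_tail b * (d * b ^ 4))" by (simp add: e_def)
      also have "\<dots> < r * T b" using r Tge pos by (intro mult_strict_left_mono) linarith+
      finally have "\<bar>P b - T b\<bar> < r * T b" using dif by linarith
      then have "\<bar>P b - T b\<bar> / T b < r" using Tpos by (simp add: divide_less_eq)
      moreover have "P b / T b - 1 = (P b - T b) / T b" using Tpos by (simp add: diff_divide_distrib)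
      ultimately show ?case using Tpos by (simp add: dist_real_def)
    qed
  qed
  then have PT: "P \<sim>[at_top] T" by (rule asymp_equivI')
  define R where "R = (\<lambda>b. 1 / 2 * b ^ 3 * std_normal_density b *
              (\<Sum>k\<in>{1<..m b}. \<Sum>j\<in>{0<..<k}.
                 1 / (real j)\<^sup>2
                 * nu (b * sqrt ((real k - real j) / (real j * real k)))
                 * nu (b * sqrt (real k / (real j * (real k - real j))))))"
  have "normal_tail \<sim>[at_top] (\<lambda>b. std_normal_density b / b)"
  proof (rule asymp_equivI', rule tendsto_sandwich)
    show "eventually (\<lambda>b. 1 / (1 + 1 / b\<^sup>2) \<le> normal_tail b / (std_normal_density b / b)) at_top"
      using eventually_gt_at_top[of 0]
    proof eventually_elim
      case (elim b)
      have "0 < std_normal_density b / b" using elim by (intro divide_pos_pos normal_density_pos) auto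
      moreover have "0 < 1 + 1 / b\<^sup>2" by (simp add: add_pos_nonneg)
      moreover have "1 / k \<le> q / f" if "0 < f" "0 < k" "f \<le> k * q" for f k q :: real
        using that by (simp add: divide_simps mult.commute)
      ultimately show ?case using normal_tail_bounds(2)[OF elim] by blast
    qed
    show "eventually (\<lambda>b. normal_tail b / (std_normal_density b / b) \<le> 1) at_top"
      using eventually_gt_at_top[of 0]
    proof eventually_elim
      case (elim b)
      have "0 < std_normal_density b / b" using elim by (intro divide_pos_pos normal_density_pos) auto
      then show ?case using normal_tail_bounds(1)[OF elim] by (subst divide_le_eq) simp
    qed
    show "((\<lambda>b::real. 1 / (1 + 1 / b\<^sup>2)) \<longlongrightarrow> 1) at_top" by real_asymp
  qed simp
  then have "T \<sim>[at_top] (\<lambda>b. 2 * (std_normal_density b / b) * pair_sum b (m b))"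
    unfolding T_def by (intro asymp_equiv_intros)
  also have "eventually (\<lambda>b. 2 * (std_normal_density b / b) * pair_sum b (m b) = R b) at_top"
    using eventually_gt_at_top[of 0]
  proof eventually_elim
    case (elim b)
    show ?case unfolding R_def double_sum_eq_pair_sum[OF elim]
      using elim by (simp add: field_simps eval_nat_numeral)
  qed
  then have "(\<lambda>b. 2 * (std_normal_density b / b) * pair_sum b (m b)) \<sim>[at_top] R"
    by (rule asymp_equiv_refl_ev)
  finally have "T \<sim>[at_top] R" .
  with PT have "P \<sim>[at_top] R" by (rule asymp_equiv_trans)
  then show ?thesis unfolding P_def R_def .
qed

end
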